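(* Let $X$ be a complex algebraic variety, let $X^{\mathrm{An}}$ be its analytification with respect to the norm $\|\cdot\|=\max\{|\cdot|_\infty,|\cdot|_0\}$ on $\mathbf{C}$, and let $\lambda\colon X^{\mathrm{An}}\to[0,1]$ be the canonical map. Then $\lambda$ is open.
   Context: A complex algebraic variety is a reduced separated scheme of finite type over $\mathbf{C}$, not necessarily irreducible. Norms on $\mathbf{C}$: $|\cdot|_\infty$ is the usual Archimedean absolute value; $|\cdot|_0$ is the trivial norm, $|0|_0=0$ and $|a|_0=1$ for $a\ne0$. The norm $\|\cdot\|:=\max\{|\cdot|_\infty,|\cdot|_0\}$ is submultiplicative and makes $\mathbf{C}$ a Banach ring. Analytification: for an affine open subset $U=\mathrm{Spec}\,A$ of $X$, $U^{\mathrm{An}}$ is the set of multiplicative seminorms $|\cdot|_x$ on $A$ whose restriction to $\mathbf{C}$ is bounded by $\|\cdot\|$ (i.e. $|a|_x\le\|a\|$ for $a\in\mathbf{C}$), with the weakest topology such that $x\mapsto|f|_x$ is continuous for every $f\in A$. The space $X^{\mathrm{An}}$ is obtained by gluing the spaces $U^{\mathrm{An}}$ over affine open $U\subset X$ (each inclusion of affine opens inducing an open embedding); it is a locally compact Hausdorff space. The map $\lambda$: every multiplicative seminorm on $\mathbf{C}$ bounded by $\|\cdot\|$ is of the form $|\cdot|_\infty^\rho$ for a unique $\rho\in[0,1]$, where $\rho=0$ is interpreted as the trivial norm $|\cdot|_0$. For $x\in X^{\mathrm{An}}$, $\lambda(x)\in[0,1]$ is the number $\rho$ such that $|\cdot|_x$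 restricts to $|\cdot|_\infty^\rho$ on $\mathbf{C}$; equivalently $\lambda(x)=\log|e|_x$ with $e=\exp(1)$. The map $\lambda$ is continuous. *)

theory Defs
  imports "HOL-Algebra.Algebraic_Closure_Type" "HOL-Algebra.Generated_Rings" "HOL-Analysis.Analysis"
begin

section \<open>Ringed spaces\<close>

text \<open>
  The sections over all open sets live in one type \<open>'a\<close>; the ring of sections over \<open>U\<close> is the
  record \<open>sections Z U\<close>, with its own carrier. Only the values of \<open>sections Z\<close> at open sets, and of
  \<open>restr Z U V\<close> at open \<open>V \<subseteq> U\<close> and elements of \<open>carrier (sections Z U)\<close>, are relevant.
\<close>

record ('p, 'a) ringed_space =
  under :: "'p topology"
  sections :: "'p set \<Rightarrow> 'a ring"
  restr :: "'p set \<Rightarrow> 'p set \<Rightarrow> 'a \<Rightarrow> 'a"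

abbreviation opens :: "('p, 'a) ringed_space \<Rightarrow> 'p set \<Rightarrow> bool" where
  "opens Z U \<equiv> openin (under Z) U"

abbreviation points :: "('p, 'a) ringed_space \<Rightarrow> 'p set" where
  "points Z \<equiv> topspace (under Z)"

abbreviation secs :: "('p, 'a) ringed_space \<Rightarrow> 'p set \<Rightarrow> 'a set" where
  "secs Z U \<equiv> carrier (sections Z U)"

definition presheaf_of_rings :: "('p, 'a) ringed_space \<Rightarrow> bool" where
  "presheaf_of_rings Z \<longleftrightarrow>
     (\<forall>U. opens Z U \<longrightarrow> cring (sections Z U)) \<and>
     (\<forall>U V. opens Z U \<and> opens Z V \<and> V \<subseteq> U \<longrightarrow>
        restr Z U V \<in> ring_hom (sections Z U) (sections Z V)) \<and>
     (\<forall>U. opens Z U \<longrightarrow> (\<forall>s\<in>secs Z U. restr Z U U s = s)) \<and>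
     (\<forall>U V W. opens Z U \<and> opens Z V \<and> opens Z W \<and> W \<subseteq> V \<and> V \<subseteq> U \<longrightarrow>
        (\<forall>s\<in>secs Z U. restr Z V W (restr Z U V s) = restr Z U W s))"

definition sheaf_of_rings :: "('p, 'a) ringed_space \<Rightarrow> bool" where
  "sheaf_of_rings Z \<longleftrightarrow> presheaf_of_rings Z \<and>
     (\<forall>\<U>. (\<forall>U\<in>\<U>. opens Z U) \<longrightarrow>
        (\<forall>s\<in>secs Z (\<Union>\<U>). \<forall>t\<in>secs Z (\<Union>\<U>).
           (\<forall>U\<in>\<U>. restr Z (\<Union>\<U>) U s = restr Z (\<Union>\<U>) U t) \<longrightarrow> s = t)) \<and>
     (\<forall>\<U> \<sigma>. (\<forall>U\<in>\<U>. opens Z U \<and> \<sigma> U \<in> secs Z U) \<and>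
        (\<forall>U\<in>\<U>. \<forall>V\<in>\<U>. restr Z U (U \<inter> V) (\<sigma> U) = restr Z V (U \<inter> V) (\<sigma> V)) \<longrightarrow>
        (\<exists>s\<in>secs Z (\<Union>\<U>). \<forall>U\<in>\<U>. restr Z (\<Union>\<U>) U s = \<sigma> U))"

definition germ :: "('p, 'a) ringed_space \<Rightarrow> 'p \<Rightarrow> 'p set \<Rightarrow> 'a \<Rightarrow> ('p set \<times> 'a) set" where
  "germ Z x U s = {(V, t). opens Z V \<and> x \<in> V \<and> t \<in> secs Z V \<and>
     (\<exists>W. opens Z W \<and> x \<in> W \<and> W \<subseteq> U \<inter> V \<and> restr Z U W s = restr Z V W t)}"

text \<open>
  Operations on equivalence classes are given, here and for localizations, as unions over all
  representatives: these unions run over equal classes.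
\<close>

definition stalk :: "('p, 'a) ringed_space \<Rightarrow> 'p \<Rightarrow> ('p set \<times> 'a) set ring" where
  "stalk Z x = \<lparr>
     carrier = {germ Z x U s | U s. opens Z U \<and> x \<in> U \<and> s \<in> secs Z U},
     monoid.mult = (\<lambda>g h. \<Union>(U, s)\<in>g. \<Union>(V, t)\<in>h. germ Z x (U \<inter> V)
        (restr Z U (U \<inter> V) s \<otimes>\<^bsub>sections Z (U \<inter> V)\<^esub> restr Z V (U \<inter> V) t)),
     one = germ Z x (points Z) \<one>\<^bsub>sections Z (points Z)\<^esub>,
     ring.zero = germ Z x (points Z) \<zero>\<^bsub>sections Z (points Z)\<^esub>,
     add = (\<lambda>g h. \<Union>(U, s)\<in>g. \<Union>(V, t)\<in>h. germ Z x (U \<inter> V)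
        (restr Z U (U \<inter> V) s \<oplus>\<^bsub>sections Z (U \<inter> V)\<^esub> restr Z V (U \<inter> V) t))\<rparr>"

definition local_ring :: "('a, 'm) ring_scheme \<Rightarrow> bool" where
  "local_ring R \<longleftrightarrow> cring R \<and> (\<exists>!M. maximalideal M R)"

definition local_hom ::
  "('a, 'm) ring_scheme \<Rightarrow> ('b, 'n) ring_scheme \<Rightarrow> ('a \<Rightarrow> 'b) \<Rightarrow> bool" where
  "local_hom R S h \<longleftrightarrow> h \<in> ring_hom R S \<and>
     (\<forall>M N. maximalideal M R \<and> maximalideal N S \<longrightarrow> {r \<in> carrier R. h r \<in> N} = M)"

definition locally_ringed_space :: "('p, 'a) ringed_space \<Rightarrow> bool" where
  "locally_ringed_space Z \<longleftrightarrow> sheaf_of_rings Z \<and> (\<forall>x\<in>points Z. local_ring (stalk Z x))"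

definition open_subspace :: "('p, 'a) ringed_space \<Rightarrow> 'p set \<Rightarrow> ('p, 'a) ringed_space" where
  "open_subspace Z U = \<lparr>under = subtopology (under Z) U, sections = sections Z, restr = restr Z\<rparr>"


section \<open>Morphisms\<close>

text \<open>
  For \<open>f : Z \<rightarrow> Y\<close>, \<open>comap f V\<close> is the ring homomorphism from the sections of \<open>Y\<close> over \<open>V\<close> to
  the sections of \<open>Z\<close> over the preimage of \<open>V\<close>.
\<close>

record ('p, 'a, 'q, 'b) mor =
  base :: "'p \<Rightarrow> 'q"
  comap :: "'q set \<Rightarrow> 'b \<Rightarrow> 'a"

definition preim ::
  "('p, 'a) ringed_space \<Rightarrow> ('p, 'a, 'q, 'b) mor \<Rightarrow> 'q set \<Rightarrow> 'p set" where
  "preim Z f V = {x \<in> points Z. base f x \<in> V}"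

definition stalk_map ::
  "('p, 'a) ringed_space \<Rightarrow> ('p, 'a, 'q, 'b) mor \<Rightarrow> 'p \<Rightarrow> ('q set \<times> 'b) set \<Rightarrow> ('p set \<times> 'a) set"
  where "stalk_map Z f x g = (\<Union>(V, t)\<in>g. germ Z x (preim Z f V) (comap f V t))"

definition morphism ::
  "('p, 'a) ringed_space \<Rightarrow> ('q, 'b) ringed_space \<Rightarrow> ('p, 'a, 'q, 'b) mor \<Rightarrow> bool" where
  "morphism Z Y f \<longleftrightarrow>
     locally_ringed_space Z \<and> locally_ringed_space Y \<and>
     continuous_map (under Z) (under Y) (base f) \<and>
     (\<forall>V. opens Y V \<longrightarrow> comap f V \<in> ring_hom (sections Y V) (sections Z (preim Z f V))) \<and>
     (\<forall>V W. opens Y V \<and> opens Y W \<and> W \<subseteq> V \<longrightarrow> (\<forall>t\<in>secs Y V.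
        comap f W (restr Y V W t) = restr Z (preim Z f V) (preim Z f W) (comap f V t))) \<and>
     (\<forall>x\<in>points Z. local_hom (stalk Y (base f x)) (stalk Z x) (stalk_map Z f x))"

definition mor_eq ::
  "('p, 'a) ringed_space \<Rightarrow> ('q, 'b) ringed_space \<Rightarrow>
   ('p, 'a, 'q, 'b) mor \<Rightarrow> ('p, 'a, 'q, 'b) mor \<Rightarrow> bool" where
  "mor_eq Z Y f g \<longleftrightarrow> (\<forall>x\<in>points Z. base f x = base g x) \<and>
     (\<forall>V. opens Y V \<longrightarrow> (\<forall>t\<in>secs Y V. comap f V t = comap g V t))"

definition mor_id :: "('p, 'a, 'p, 'a) mor" where
  "mor_id = \<lparr>base = (\<lambda>x. x), comap = (\<lambda>_ s. s)\<rparr>"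

text \<open>The composite \<open>Z \<rightarrow> Y \<rightarrow> W\<close> of \<open>f\<close> and \<open>g\<close>; only the middle space \<open>Y\<close> enters the formula.\<close>

definition mor_comp ::
  "('q, 'b) ringed_space \<Rightarrow> ('q, 'b, 'r, 'c) mor \<Rightarrow> ('p, 'a, 'q, 'b) mor \<Rightarrow> ('p, 'a, 'r, 'c) mor"
  where "mor_comp Y g f =
    \<lparr>base = (\<lambda>x. base g (base f x)), comap = (\<lambda>W t. comap f (preim Y g W) (comap g W t))\<rparr>"

definition isomorphic_spaces :: "('p, 'a) ringed_space \<Rightarrow> ('q, 'b) ringed_space \<Rightarrow> bool" where
  "isomorphic_spaces Z Y \<longleftrightarrow> (\<exists>f g. morphism Z Y f \<and> morphism Y Z g \<and>
     mor_eq Z Z (mor_comp Y g f) mor_id \<and> mor_eq Y Y (mor_comp Z f g) mor_id)"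

definition closed_immersion ::
  "('p, 'a) ringed_space \<Rightarrow> ('q, 'b) ringed_space \<Rightarrow> ('p, 'a, 'q, 'b) mor \<Rightarrow> bool" where
  "closed_immersion Z Y f \<longleftrightarrow> morphism Z Y f \<and>
     embedding_map (under Z) (under Y) (base f) \<and> closedin (under Y) (base f ` points Z) \<and>
     (\<forall>V s y. opens Y V \<and> s \<in> secs Z (preim Z f V) \<and> y \<in> V \<longrightarrow>
        (\<exists>W. opens Y W \<and> y \<in> W \<and> W \<subseteq> V \<and>
           (\<exists>t\<in>secs Y W. comap f W t = restr Z (preim Z f V) (preim Z f W) s)))"


section \<open>Affine schemes and schemes\<close>

definition fraction :: "('a, 'm) ring_scheme \<Rightarrow> 'a set \<Rightarrow> 'a \<Rightarrow> 'a \<Rightarrow> ('a \<times> 'a) set" where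
  "fraction A S a f = {(b, g). b \<in> carrier A \<and> g \<in> S \<and>
     (\<exists>h\<in>S. h \<otimes>\<^bsub>A\<^esub> ((a \<otimes>\<^bsub>A\<^esub> g) \<ominus>\<^bsub>A\<^esub> (b \<otimes>\<^bsub>A\<^esub> f)) = \<zero>\<^bsub>A\<^esub>)}"

definition localization :: "('a, 'm) ring_scheme \<Rightarrow> 'a set \<Rightarrow> ('a \<times> 'a) set ring" where
  "localization A S = \<lparr>
     carrier = {fraction A S a f | a f. a \<in> carrier A \<and> f \<in> S},
     monoid.mult = (\<lambda>x y. \<Union>(a, f)\<in>x. \<Union>(b, g)\<in>y. fraction A S (a \<otimes>\<^bsub>A\<^esub> b) (f \<otimes>\<^bsub>A\<^esub> g)),
     one = fraction A S \<one>\<^bsub>A\<^esub> \<one>\<^bsub>A\<^esub>,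
     ring.zero = fraction A S \<zero>\<^bsub>A\<^esub> \<one>\<^bsub>A\<^esub>,
     add = (\<lambda>x y. \<Union>(a, f)\<in>x. \<Union>(b, g)\<in>y.
        fraction A S ((a \<otimes>\<^bsub>A\<^esub> g) \<oplus>\<^bsub>A\<^esub> (b \<otimes>\<^bsub>A\<^esub> f)) (f \<otimes>\<^bsub>A\<^esub> g))\<rparr>"

definition fraction_at :: "('a, 'm) ring_scheme \<Rightarrow> 'a set \<Rightarrow> 'a \<Rightarrow> 'a \<Rightarrow> ('a \<times> 'a) set" where
  "fraction_at A p a f = fraction A (carrier A - p) a f"

definition local_at :: "('a, 'm) ring_scheme \<Rightarrow> 'a set \<Rightarrow> ('a \<times> 'a) set ring" where
  "local_at A p = localization A (carrier A - p)"

definition zariski :: "('a, 'm) ring_scheme \<Rightarrow> 'a set topology" where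
  "zariski A = topology_generated_by {{p. primeideal p A \<and> f \<notin> p} | f. f \<in> carrier A}"

definition spec_sections ::
  "('a, 'm) ring_scheme \<Rightarrow> 'a set set \<Rightarrow> ('a set \<Rightarrow> ('a \<times> 'a) set) ring" where
  "spec_sections A U = \<lparr>
     carrier = {s \<in> (\<Pi>\<^sub>E p\<in>U. carrier (local_at A p)).
        \<forall>p\<in>U. \<exists>V. openin (zariski A) V \<and> p \<in> V \<and> V \<subseteq> U \<and>
          (\<exists>a\<in>carrier A. \<exists>f\<in>carrier A. \<forall>q\<in>V. f \<notin> q \<and> s q = fraction_at A q a f)},
     monoid.mult = (\<lambda>s t. \<lambda>p\<in>U. s p \<otimes>\<^bsub>local_at A p\<^esub> t p),
     one = (\<lambda>p\<in>U. \<one>\<^bsub>local_at A p\<^esub>),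
     ring.zero = (\<lambda>p\<in>U. \<zero>\<^bsub>local_at A p\<^esub>),
     add = (\<lambda>s t. \<lambda>p\<in>U. s p \<oplus>\<^bsub>local_at A p\<^esub> t p)\<rparr>"

definition Spec ::
  "('a, 'm) ring_scheme \<Rightarrow> ('a set, 'a set \<Rightarrow> ('a \<times> 'a) set) ringed_space" where
  "Spec A = \<lparr>under = zariski A, sections = spec_sections A, restr = (\<lambda>U V s. restrict s V)\<rparr>"

definition spec_const :: "('a, 'm) ring_scheme \<Rightarrow> 'a \<Rightarrow> 'a set \<Rightarrow> ('a \<times> 'a) set" where
  "spec_const A a = (\<lambda>p\<in>points (Spec A). fraction_at A p a \<one>\<^bsub>A\<^esub>)"

text \<open>
  A ring \<open>A\<close> with \<open>Z\<close> isomorphic to \<open>Spec A\<close> is isomorphic to the ring of global sections of \<open>Z\<close>, so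
  asking for \<open>A\<close> in the type \<open>'a\<close> of sections is no restriction.
\<close>

definition affine_scheme :: "('p, 'a) ringed_space \<Rightarrow> bool" where
  "affine_scheme Z \<longleftrightarrow> (\<exists>A :: 'a ring. cring A \<and> isomorphic_spaces Z (Spec A))"

definition affine_open :: "('p, 'a) ringed_space \<Rightarrow> 'p set \<Rightarrow> bool" where
  "affine_open Z U \<longleftrightarrow> opens Z U \<and> affine_scheme (open_subspace Z U)"

definition is_scheme :: "('p, 'a) ringed_space \<Rightarrow> bool" where
  "is_scheme Z \<longleftrightarrow> locally_ringed_space Z \<and> (\<forall>x\<in>points Z. \<exists>U. affine_open Z U \<and> x \<in> U)"

definition reduced_scheme :: "('p, 'a) ringed_space \<Rightarrow> bool" where
  "reduced_scheme Z \<longleftrightarrow> is_scheme Z \<and> (\<forall>U. opens Z U \<longrightarrow>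
     (\<forall>s\<in>secs Z U. \<forall>n::nat. s [^]\<^bsub>sections Z U\<^esub> n = \<zero>\<^bsub>sections Z U\<^esub> \<longrightarrow>
        s = \<zero>\<^bsub>sections Z U\<^esub>))"


section \<open>Complex algebraic varieties\<close>

abbreviation CC :: "complex ring" where
  "CC \<equiv> ring_of_type_algebra"

type_synonym cpt = "complex set"
type_synonym csec = "complex set \<Rightarrow> (complex \<times> complex) set"

definition scheme_over_C :: "('p, 'a) ringed_space \<Rightarrow> ('p, 'a, cpt, csec) mor \<Rightarrow> bool" where
  "scheme_over_C Z \<pi> \<longleftrightarrow> is_scheme Z \<and> morphism Z (Spec CC) \<pi>"

text \<open>The structure homomorphism from \<open>\<complex>\<close> to the ring of sections over \<open>U\<close>.\<close>

definition scalar ::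
  "('p, 'a) ringed_space \<Rightarrow> ('p, 'a, cpt, csec) mor \<Rightarrow> 'p set \<Rightarrow> complex \<Rightarrow> 'a" where
  "scalar Z \<pi> U c = restr Z (points Z) U (comap \<pi> (points (Spec CC)) (spec_const CC c))"

text \<open>
  Quasi-compact, and every affine open has a finitely generated \<open>\<complex>\<close>-algebra of sections. It is
  equivalent to ask the latter for the members of one affine open cover.
\<close>

definition finite_type_over_C :: "('p, 'a) ringed_space \<Rightarrow> ('p, 'a, cpt, csec) mor \<Rightarrow> bool" where
  "finite_type_over_C Z \<pi> \<longleftrightarrow> scheme_over_C Z \<pi> \<and> compact_space (under Z) \<and>
     (\<forall>U. affine_open Z U \<longrightarrow> (\<exists>F. finite F \<and> F \<subseteq> secs Z U \<and>
        generate_ring (sections Z U) (range (scalar Z \<pi> U) \<union> F) = secs Z U))"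

text \<open>
  \<open>P\<close>, with the projections \<open>p\<close> and \<open>q\<close>, is a fibre product of \<open>Z\<close> and \<open>Y\<close> over \<open>S\<close> within the
  schemes whose points and sections have the same types as those of \<open>P\<close>.
\<close>

definition fibre_product ::
  "('s, 'e) ringed_space \<Rightarrow> ('p, 'a) ringed_space \<Rightarrow> ('p, 'a, 's, 'e) mor \<Rightarrow>
   ('q, 'b) ringed_space \<Rightarrow> ('q, 'b, 's, 'e) mor \<Rightarrow>
   ('r, 'c) ringed_space \<Rightarrow> ('r, 'c, 'p, 'a) mor \<Rightarrow> ('r, 'c, 'q, 'b) mor \<Rightarrow> bool" where
  "fibre_product S Z \<phi> Y \<psi> P p q \<longleftrightarrow>
     is_scheme P \<and> morphism P Z p \<and> morphism P Y q \<and>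
     mor_eq P S (mor_comp Z \<phi> p) (mor_comp Y \<psi> q) \<and>
     (\<forall>(T :: ('r, 'c) ringed_space) f g.
        is_scheme T \<and> morphism T Z f \<and> morphism T Y g \<and>
        mor_eq T S (mor_comp Z \<phi> f) (mor_comp Y \<psi> g) \<longrightarrow>
        (\<exists>h. morphism T P h \<and>
           mor_eq T Z (mor_comp P p h) f \<and> mor_eq T Y (mor_comp P q h) g \<and>
           (\<forall>h'. morphism T P h' \<and>
              mor_eq T Z (mor_comp P p h') f \<and> mor_eq T Y (mor_comp P q h') g \<longrightarrow>
              mor_eq T P h' h)))"

text \<open>
  The diagonal into the fibre product over \<open>\<complex>\<close> of \<open>Z\<close> with itself is a closed immersion.
  The definition is meant for \<open>Z\<close> of finite type over \<open>\<complex>\<close>. Then the fibre product has at most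
  continuum many points, and so do all its rings of sections, so it can be realised on the type
  \<^typ>\<open>complex\<close>; it is unique up to isomorphism, and the diagonal \<open>d\<close> exists and is unique.
\<close>

definition separated_over_C :: "('p, 'a) ringed_space \<Rightarrow> ('p, 'a, cpt, csec) mor \<Rightarrow> bool" where
  "separated_over_C Z \<pi> \<longleftrightarrow>
     (\<forall>(P :: (complex, complex) ringed_space) p q d.
        fibre_product (Spec CC) Z \<pi> Z \<pi> P p q \<and> morphism Z P d \<and>
        mor_eq Z Z (mor_comp P p d) mor_id \<and> mor_eq Z Z (mor_comp P q d) mor_id \<longrightarrow>
        closed_immersion Z P d)"

definition complex_variety :: "('p, 'a) ringed_space \<Rightarrow> ('p, 'a, cpt, csec) mor \<Rightarrow> bool" where
  "complex_variety Z \<pi> \<longleftrightarrow>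
     reduced_scheme Z \<and> finite_type_over_C Z \<pi> \<and> separated_over_C Z \<pi>"


section \<open>The analytification\<close>

definition trivial_norm :: "complex \<Rightarrow> real" where
  "trivial_norm a = (if a = 0 then 0 else 1)"

definition hybrid_norm :: "complex \<Rightarrow> real" where
  "hybrid_norm a = max (cmod a) (trivial_norm a)"

definition mult_seminorm :: "('a, 'm) ring_scheme \<Rightarrow> ('a \<Rightarrow> real) \<Rightarrow> bool" where
  "mult_seminorm A s \<longleftrightarrow> s \<in> extensional (carrier A) \<and>
     (\<forall>a\<in>carrier A. 0 \<le> s a) \<and> s \<zero>\<^bsub>A\<^esub> = 0 \<and> s \<one>\<^bsub>A\<^esub> = 1 \<and>
     (\<forall>a\<in>carrier A. \<forall>b\<in>carrier A.
        s (a \<oplus>\<^bsub>A\<^esub> b) \<le> s a + s b \<and> s (a \<otimes>\<^bsub>A\<^esub> b) = s a * s b)"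

definition An_set ::
  "('p, 'a) ringed_space \<Rightarrow> ('p, 'a, cpt, csec) mor \<Rightarrow> 'p set \<Rightarrow> ('a \<Rightarrow> real) set" where
  "An_set Z \<pi> U = {s. mult_seminorm (sections Z U) s \<and>
     (\<forall>c. s (scalar Z \<pi> U c) \<le> hybrid_norm c)}"

definition An_affine ::
  "('p, 'a) ringed_space \<Rightarrow> ('p, 'a, cpt, csec) mor \<Rightarrow> 'p set \<Rightarrow> ('a \<Rightarrow> real) topology" where
  "An_affine Z \<pi> U = topology_generated_by
     {{s \<in> An_set Z \<pi> U. s f \<in> V} | f V. f \<in> secs Z U \<and> open V}"

definition An_disjoint ::
  "('p, 'a) ringed_space \<Rightarrow> ('p, 'a, cpt, csec) mor \<Rightarrow> ('p set \<times> ('a \<Rightarrow> real)) topology" where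
  "An_disjoint Z \<pi> = sum_topology (An_affine Z \<pi>) {U. affine_open Z U}"

text \<open>
  For affine open \<open>W \<subseteq> U\<close>, a seminorm over \<open>W\<close> is identified with its pullback along the restriction
  homomorphism; \<open>An_space Z \<pi>\<close> is the quotient of the disjoint union of the spaces over all
  affine opens by the equivalence relation that this generates.
\<close>

definition An_glue ::
  "('p, 'a) ringed_space \<Rightarrow> ('p, 'a, cpt, csec) mor \<Rightarrow>
   'p set \<times> ('a \<Rightarrow> real) \<Rightarrow> 'p set \<times> ('a \<Rightarrow> real) \<Rightarrow> bool" where
  "An_glue Z \<pi> w z \<longleftrightarrow>
     w \<in> topspace (An_disjoint Z \<pi>) \<and> z \<in> topspace (An_disjoint Z \<pi>) \<and> fst w \<subseteq> fst z \<and>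
     snd z = (\<lambda>f\<in>secs Z (fst z). snd w (restr Z (fst z) (fst w) f))"

definition An_class ::
  "('p, 'a) ringed_space \<Rightarrow> ('p, 'a, cpt, csec) mor \<Rightarrow>
   'p set \<times> ('a \<Rightarrow> real) \<Rightarrow> ('p set \<times> ('a \<Rightarrow> real)) set" where
  "An_class Z \<pi> z = {w. equivclp (An_glue Z \<pi>) z w}"

definition An_space ::
  "('p, 'a) ringed_space \<Rightarrow> ('p, 'a, cpt, csec) mor \<Rightarrow> ('p set \<times> ('a \<Rightarrow> real)) set topology" where
  "An_space Z \<pi> = topology (\<lambda>G. G \<subseteq> An_class Z \<pi> ` topspace (An_disjoint Z \<pi>) \<and>
     openin (An_disjoint Z \<pi>) {z \<in> topspace (An_disjoint Z \<pi>). An_class Z \<pi> z \<in> G})"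

lemma openin_An_space:
  "openin (An_space Z \<pi>) G \<longleftrightarrow> G \<subseteq> An_class Z \<pi> ` topspace (An_disjoint Z \<pi>) \<and>
     openin (An_disjoint Z \<pi>) {z \<in> topspace (An_disjoint Z \<pi>). An_class Z \<pi> z \<in> G}"
proof -
  let ?T = "An_disjoint Z \<pi>" and ?c = "An_class Z \<pi>"
  have "istopology (\<lambda>G. G \<subseteq> ?c ` topspace ?T \<and> openin ?T {z \<in> topspace ?T. ?c z \<in> G})"
    unfolding istopology_def
  proof (intro conjI allI impI)
    fix G H
    assume G: "G \<subseteq> ?c ` topspace ?T \<and> openin ?T {z \<in> topspace ?T. ?c z \<in> G}"
      and H: "H \<subseteq> ?c ` topspace ?T \<and> openin ?T {z \<in> topspace ?T. ?c z \<in> H}"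
    have "{z \<in> topspace ?T. ?c z \<in> G \<inter> H} =
        {z \<in> topspace ?T. ?c z \<in> G} \<inter> {z \<in> topspace ?T. ?c z \<in> H}"
      by blast
    then show "openin ?T {z \<in> topspace ?T. ?c z \<in> G \<inter> H}"
      using G H by (simp add: openin_Int)
    show "G \<inter> H \<subseteq> ?c ` topspace ?T"
      using G by blast
  next
    fix \<K>
    assume K: "\<forall>G\<in>\<K>. G \<subseteq> ?c ` topspace ?T \<and> openin ?T {z \<in> topspace ?T. ?c z \<in> G}"
    have eq: "{z \<in> topspace ?T. ?c z \<in> \<Union>\<K>} = (\<Union>G\<in>\<K>. {z \<in> topspace ?T. ?c z \<in> G})"
      by blast
    show "openin ?T {z \<in> topspace ?T. ?c z \<in> \<Union>\<K>}"
      unfolding eq by (rule openin_Union) (use K in auto)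
    show "\<Union>\<K> \<subseteq> ?c ` topspace ?T"
      using K by blast
  qed
  then show ?thesis
    unfolding An_space_def by (simp add: topology_inverse')
qed

text \<open>
  In Isabelle \<open>0 powr \<rho> = 0\<close> for every \<open>\<rho>\<close>, and \<open>x powr 0 = 1\<close> for \<open>x \<noteq> 0\<close>, so
  \<open>cmod c powr 0\<close> is the trivial norm.
\<close>

definition An_lambda ::
  "('p, 'a) ringed_space \<Rightarrow> ('p, 'a, cpt, csec) mor \<Rightarrow> ('p set \<times> ('a \<Rightarrow> real)) set \<Rightarrow> real" where
  "An_lambda Z \<pi> x = (THE \<rho>. \<rho> \<in> {0..1} \<and>
     (\<forall>(U, s)\<in>x. \<forall>c. s (scalar Z \<pi> U c) = cmod c powr \<rho>))"

end

theory Submission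
  imports Defs "HOL-Library.Poly_Mapping"
begin

text \<open>
  Over an affine open set with coordinate ring \<open>R\<close>, one has to show: given a multiplicative seminorm
  \<open>s\<close> on \<open>R\<close> restricting to \<open>cmod c powr \<rho>\<close> and finitely many \<open>f \<in> R\<close>, for every \<open>r\<close> near \<open>\<rho>\<close> there
  is a seminorm restricting to \<open>cmod c powr r\<close> whose values at the \<open>f\<close> are close to those of \<open>s\<close>. If
  \<open>\<rho> > 0\<close>, then \<open>s a = cmod (\<psi> a) powr \<rho>\<close> for a character \<open>\<psi>\<close> by Gelfand--Mazur, and one changes the
  exponent. If \<open>\<rho> = 0\<close>, present \<open>R\<close>, localized at the product of those \<open>f\<close> with \<open>s f \<noteq> 0\<close>, as a
  quotient of a polynomial ring by an ideal contained in \<open>I = {p. s p = 0}\<close>, and give the variables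
  real weights slightly above the logarithms of their seminorms. For linearly independent weights
  every \<open>p \<in> I\<close> has a leading monomial, which is not 1 because \<open>s\<close> is nonarchimedean. By Dickson's
  lemma finitely many members of \<open>I\<close> suffice for division with remainder, and for large \<open>R\<close> this
  division does not increase the \<open>\<ell>\<^sup>1\<close> norm in which a variable of weight \<open>w\<close> has norm \<open>R powr w\<close>.
  Hence 1 has distance 1 from \<open>I\<close>, and Gelfand's theorem yields a character that kills \<open>I\<close> and is
  bounded by this norm; with \<open>R = exp (1 / r)\<close> its absolute value to the power \<open>r\<close> is close to \<open>s\<close>.
\<close>

section \<open>Characters of commutative complex algebras\<close>

text \<open>The characters constructed for \<open>\<rho> = 0\<close> come with upper bounds only and
  could be far too small at some \<open>f\<close>. This is why the product of the \<open>f\<close>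
  with \<open>s f \<noteq> 0\<close> is inverted: an upper bound for the inverse is a lower bound
  for the product, and dividing by the upper bounds of the other factors bounds each single factor
  from below. Weights are negative where \<open>s f\<close> is well below 1, so monomials are not
  well-ordered and division may run forever. Hence nothing is deduced from a remainder; only norm
  estimates are used, and an l1 norm makes them checkable monomial by monomial. Division costs a
  constant factor from the coefficients but lowers weights by some \<open>\<delta> > 0\<close>, and
  \<open>R powr \<delta>\<close> beats the constant once \<open>R\<close> is large. Large
  \<open>R\<close> corresponds to small \<open>r\<close> because
  \<open>(R powr w) powr r = exp w\<close> for \<open>R = exp (1 / r)\<close>. Both theorems on
  characters rest on one elementary fact: for a multiplicative seminorm of positive exponent, every
  element is at distance 0 from a constant.\<close>

locale complex_algebra =
  fixes \<kappa> :: "complex \<Rightarrow> 'm::comm_ring_1"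
  assumes scal_add: "\<kappa> (a + b) = \<kappa> a + \<kappa> b"
    and scal_mult: "\<kappa> (a * b) = \<kappa> a * \<kappa> b"
    and scal_one [simp]: "\<kappa> 1 = 1"
begin

lemma scal_zero [simp]: "\<kappa> 0 = 0"
  using scal_add[of 0 0] by simp

lemma scal_minus: "\<kappa> (- a) = - \<kappa> a"
  using scal_add[of a "- a"] by (simp add: eq_neg_iff_add_eq_0 add.commute)

lemma scal_diff: "\<kappa> (a - b) = \<kappa> a - \<kappa> b"
  using scal_add[of a "- b"] by (simp add: scal_minus)

lemma scal_power: "\<kappa> (a ^ n) = \<kappa> a ^ n"
  by (induction n) (simp_all add: scal_mult)

text \<open>On constants only an upper bound is asked, which infima inherit easily;
  \<open>submult_scal\<close> recovers equality.\<close>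

definition submult :: "('m \<Rightarrow> real) \<Rightarrow> bool" where
  "submult N \<longleftrightarrow> (\<forall>a. 0 \<le> N a) \<and> (\<forall>a b. N (a + b) \<le> N a + N b) \<and>
     (\<forall>a b. N (a * b) \<le> N a * N b) \<and> N 1 = 1 \<and> (\<forall>c. N (\<kappa> c) \<le> cmod c)"

definition mult_over :: "real \<Rightarrow> ('m \<Rightarrow> real) \<Rightarrow> bool" where
  "mult_over \<rho> S \<longleftrightarrow> (\<forall>a. 0 \<le> S a) \<and> (\<forall>a b. S (a + b) \<le> S a + S b) \<and>
     (\<forall>a b. S (a * b) = S a * S b) \<and> (\<forall>c. S (\<kappa> c) = cmod c powr \<rho>)"

definition character :: "('m \<Rightarrow> complex) \<Rightarrow> bool" where
  "character \<phi> \<longleftrightarrow> (\<forall>a b. \<phi> (a + b) = \<phi> a + \<phi> b) \<and> (\<forall>a b. \<phi> (a * b) = \<phi> a * \<phi> b) \<and>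
     (\<forall>c. \<phi> (\<kappa> c) = c)"

section \<open>Multiplicative seminorms and the Gelfand-Mazur theorem\<close>

context
  fixes \<rho> :: real and S :: "'m \<Rightarrow> real"
  assumes S: "mult_over \<rho> S"
begin

lemma mult_over_nonneg: "0 \<le> S a"
  and mult_over_add: "S (a + b) \<le> S a + S b"
  and mult_over_mult: "S (a * b) = S a * S b"
  and mult_over_scal: "S (\<kappa> c) = cmod c powr \<rho>"
  using S by (auto simp: mult_over_def)

lemma mult_over_zero: "S 0 = 0"
  using mult_over_scal[of 0] by simp

lemma mult_over_one: "S 1 = 1"
  using mult_over_scal[of 1] by simp

lemma mult_over_power: "S (a ^ n) = S a ^ n"
  by (induction n) (simp_all add: mult_over_mult mult_over_one)

lemma mult_over_uminus: "S (- a) = S a"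
proof -
  have "S (\<kappa> (-1) * a) = S a"
    by (simp add: mult_over_mult mult_over_scal)
  then show ?thesis by (simp add: scal_minus)
qed

lemma mult_over_minus_commute: "S (a - b) = S (b - a)"
  using mult_over_uminus[of "a - b"] by simp

lemma mult_over_diff: "S (a - b) \<le> S a + S b"
  using mult_over_add[of a "- b"] by (simp add: mult_over_uminus)

lemma mult_over_triangle: "\<bar>S a - S b\<bar> \<le> S (a - b)"
  using mult_over_add[of "a - b" b] mult_over_add[of "b - a" a] mult_over_minus_commute[of a b]
  by auto

lemma mult_over_sum: "S (sum f A) \<le> (\<Sum>i\<in>A. S (f i))"
proof (induction A rule: infinite_finite_induct)
  case (insert x F)
  then show ?case using mult_over_add[of "f x" "sum f F"] by simp
qed (simp_all add: mult_over_zero)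

text \<open>With \<open>v\<close> a square root of \<open>u\<close>, the difference of
  \<open>g ^ 2 ^ (k + 1)\<close> and \<open>u\<close> is the product of \<open>g ^ 2 ^ k - v\<close>
  and \<open>g ^ 2 ^ k + v\<close>, and induction covers both factors. Repeated squaring needs no
  roots of constants but square roots.\<close>

lemma iterated_square_ge:
  assumes "0 < m" and min: "\<And>w. m \<le> S (g - \<kappa> w)"
  shows "m ^ 2 ^ k \<le> S (g ^ 2 ^ k - \<kappa> u)"
proof (induction k arbitrary: u)
  case 0
  then show ?case using min by simp
next
  case (Suc k)
  define v where "v = csqrt u"
  have u: "u = v * v" by (simp add: v_def flip: power2_eq_square)
  have "g ^ 2 ^ Suc k = g ^ 2 ^ k * g ^ 2 ^ k"
    by (simp add: mult_2 power_add)
  then have "g ^ 2 ^ Suc k - \<kappa> u = (g ^ 2 ^ k - \<kappa> v) * (g ^ 2 ^ k - \<kappa> (- v))"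
    by (simp only: u scal_mult scal_minus) (simp add: algebra_simps)
  then have "S (g ^ 2 ^ Suc k - \<kappa> u) = S (g ^ 2 ^ k - \<kappa> v) * S (g ^ 2 ^ k - \<kappa> (- v))"
    by (simp only: mult_over_mult)
  also have "\<dots> \<ge> m ^ 2 ^ k * m ^ 2 ^ k"
    using Suc \<open>0 < m\<close> mult_over_nonneg by (intro mult_mono) auto
  finally show ?case by (simp add: mult_2 power_add)
qed

text \<open>The factor \<open>g - w\<close> is kept, and each factor
  \<open>g ^ 2 ^ j + w ^ 2 ^ j\<close> with \<open>j < k\<close> is bounded below by
  \<open>m ^ 2 ^ j\<close>; these exponents add up to \<open>2 ^ k - 1\<close>.\<close>

lemma iterated_square_ge':
  assumes "0 < m" and min: "\<And>w. m \<le> S (g - \<kappa> w)"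
  shows "S (g - \<kappa> w) * m ^ (2 ^ k - 1) \<le> S (g ^ 2 ^ k - \<kappa> (w ^ 2 ^ k))"
proof (induction k)
  case 0
  then show ?case by simp
next
  case (Suc k)
  have "g ^ 2 ^ Suc k = g ^ 2 ^ k * g ^ 2 ^ k" "w ^ 2 ^ Suc k = w ^ 2 ^ k * w ^ 2 ^ k"
    by (simp_all add: mult_2 power_add)
  then have eq: "g ^ 2 ^ Suc k - \<kappa> (w ^ 2 ^ Suc k)
      = (g ^ 2 ^ k - \<kappa> (w ^ 2 ^ k)) * (g ^ 2 ^ k - \<kappa> (- (w ^ 2 ^ k)))"
    by (simp only: scal_mult scal_minus) (simp add: algebra_simps)
  have "(2::nat) ^ Suc k - 1 = (2 ^ k - 1) + 2 ^ k" by simp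
  then have "S (g - \<kappa> w) * m ^ (2 ^ Suc k - 1) = (S (g - \<kappa> w) * m ^ (2 ^ k - 1)) * m ^ 2 ^ k"
    by (simp only: power_add mult.assoc)
  also have "\<dots> \<le> S (g ^ 2 ^ k - \<kappa> (w ^ 2 ^ k)) * S (g ^ 2 ^ k - \<kappa> (- (w ^ 2 ^ k)))"
    by (intro mult_mono Suc iterated_square_ge assms mult_over_nonneg) (use \<open>0 < m\<close> in auto)
  finally show ?case by (simp only: eq mult_over_mult)
qed

text \<open>An elementary substitute for the maximum principle. The lower bound of
  \<open>iterated_square_ge'\<close> against the triangle inequality for
  \<open>g ^ 2 ^ k - w ^ 2 ^ k\<close> leaves \<open>m * (1 + q ^ 2 ^ k)\<close> with
  \<open>q < 1\<close>, and \<open>k\<close> tends to infinity.\<close>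

lemma minimum_spreads:
  assumes "0 < m" and min: "\<And>w. m \<le> S (g - \<kappa> w)" and "S g = m" and w: "cmod w powr \<rho> < m"
  shows "S (g - \<kappa> w) = m"
proof (rule antisym)
  define q where "q = cmod w powr \<rho> / m"
  have q: "0 \<le> q" "q < 1" using w \<open>0 < m\<close> by (auto simp: q_def)
  have le: "S (g - \<kappa> w) \<le> m * (1 + q ^ 2 ^ k)" for k
  proof -
    have pos: "0 < m ^ (2 ^ k - 1)" using \<open>0 < m\<close> by simp
    have mm: "m ^ (2 ^ k - 1) * m = m ^ 2 ^ k"
      by (rule power_minus_mult) simp
    have "S (g - \<kappa> w) * m ^ (2 ^ k - 1) \<le> S (g ^ 2 ^ k - \<kappa> (w ^ 2 ^ k))"
      by (rule iterated_square_ge' [OF assms(1,2)])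
    also have "\<dots> \<le> m ^ 2 ^ k + (cmod w powr \<rho>) ^ 2 ^ k"
      using mult_over_diff[of "g ^ 2 ^ k" "\<kappa> (w ^ 2 ^ k)"] \<open>S g = m\<close>
      by (simp add: mult_over_power scal_power mult_over_scal)
    also have "\<dots> = (1 + q ^ 2 ^ k) * m ^ 2 ^ k"
      using \<open>0 < m\<close> by (simp add: q_def power_divide distrib_right)
    also have "\<dots> = m * (1 + q ^ 2 ^ k) * m ^ (2 ^ k - 1)"
      by (simp add: mult_ac flip: mm)
    finally show ?thesis using pos by (simp only: mult_le_cancel_right_pos)
  qed
  have "(\<lambda>k. q ^ 2 ^ k) \<longlonglongrightarrow> 0"
  proof (rule tendsto_sandwich[of "\<lambda>_. 0" _ _ "\<lambda>k. q ^ k"])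
    show "(\<lambda>k. q ^ k) \<longlonglongrightarrow> 0" using q by (intro LIMSEQ_realpow_zero) auto
    have "q ^ 2 ^ k \<le> q ^ k" for k :: nat
      using q by (intro power_decreasing) (auto intro: less_imp_le)
    then show "\<forall>\<^sub>F k in sequentially. q ^ 2 ^ k \<le> q ^ k" by simp
  qed (use q in auto)
  then have "(\<lambda>k. m * (1 + q ^ 2 ^ k)) \<longlonglongrightarrow> m * (1 + 0)" by (intro tendsto_intros)
  then show "S (g - \<kappa> w) \<le> m" using le by (intro LIMSEQ_le_const) auto
qed (rule min)

text \<open>The distance from \<open>x\<close> to \<open>z\<close> is continuous in \<open>z\<close>
  and grows like \<open>cmod z powr \<rho>\<close>, so it attains a minimum \<open>m\<close>. If
  \<open>m\<close> were positive, \<open>minimum_spreads\<close> would carry this value along a ray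
  in steps of fixed length, against the growth.\<close>

lemma exists_eigenvalue:
  assumes "0 < \<rho>"
  obtains z where "S (x - \<kappa> z) = 0"
proof -
  define f where "f z = S (x - \<kappa> z)" for z
  have fdiff: "\<bar>f z - f w\<bar> \<le> cmod (z - w) powr \<rho>" for z w
  proof -
    have "\<bar>f z - f w\<bar> \<le> S (\<kappa> (w - z))"
      using mult_over_triangle[of "x - \<kappa> z" "x - \<kappa> w"] by (simp add: f_def scal_diff)
    then show ?thesis by (simp add: mult_over_scal norm_minus_commute)
  qed
  have "continuous_on UNIV f"
    unfolding continuous_on_def
  proof
    fix z :: complex
    have "((\<lambda>w. cmod (w - z) powr \<rho>) \<longlongrightarrow> cmod (z - z) powr \<rho>) (at z)"
      using \<open>0 < \<rho>\<close> by (intro tendsto_powr' tendsto_intros) auto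
    then have "((\<lambda>w. f w - f z) \<longlongrightarrow> 0) (at z)"
      by (rule Lim_null_comparison[rotated, OF tendsto_eq_rhs]) (use fdiff in auto)
    then show "(f \<longlongrightarrow> f z) (at z)" by (simp add: LIM_zero_iff)
  qed
  have big: "cmod z powr \<rho> - f 0 \<le> f z" for z
    using mult_over_triangle[of x "\<kappa> z"] by (simp add: f_def mult_over_scal)
  \<comment> \<open>By \<open>big\<close>, outside the ball of radius \<open>B\<close> the value of
    \<open>f\<close> exceeds \<open>f 0\<close>, so a minimum over the ball is a global one.\<close>
  define B where "B = (2 * f 0 + 1) powr (1 / \<rho>)"
  have f0: "0 \<le> f z" for z by (simp add: f_def mult_over_nonneg)
  have "0 \<le> B" by (simp add: B_def)
  have BB: "B powr \<rho> = 2 * f 0 + 1" using \<open>0 < \<rho>\<close> f0[of 0] by (simp add: B_def powr_powr)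
  obtain z0 where z0: "\<And>z. cmod z \<le> B \<Longrightarrow> f z0 \<le> f z"
  proof -
    have "\<exists>z\<in>cball 0 B. \<forall>w\<in>cball 0 B. f z \<le> f w"
      using \<open>0 \<le> B\<close> continuous_on_subset[OF \<open>continuous_on UNIV f\<close>]
      by (intro continuous_attains_inf) auto
    then show ?thesis using that by (metis mem_cball_0)
  qed
  define m where "m = f z0"
  have min: "m \<le> f z" for z
  proof (cases "cmod z \<le> B")
    case True
    then show ?thesis using z0 by (simp add: m_def)
  next
    case False
    then have "B powr \<rho> \<le> cmod z powr \<rho>"
      using \<open>0 < \<rho>\<close> \<open>0 \<le> B\<close> by (intro powr_mono2) auto
    then have "f 0 \<le> f z" using big[of z] BB f0[of 0] by linarith
    then show ?thesis using z0[of 0] \<open>0 \<le> B\<close> by (simp add: m_def)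
  qed
  have "m = 0"
  proof (rule ccontr)
    assume "m \<noteq> 0"
    then have "0 < m" using f0[of z0] by (simp add: m_def)
    \<comment> \<open>This step length satisfies \<open>r powr \<rho> = m / 2\<close>, within the
      disc allowed by \<open>minimum_spreads\<close>.\<close>
    define r where "r = (m / 2) powr (1 / \<rho>)"
    have "0 < r" "r powr \<rho> < m"
      using \<open>0 < m\<close> \<open>0 < \<rho>\<close> by (auto simp: r_def powr_powr)
    have "f (z0 + of_real (real j * r)) = m" for j
    proof (induction j)
      case 0
      show ?case by (simp add: m_def)
    next
      case (Suc j)
      define g where "g = x - \<kappa> (z0 + of_real (real j * r))"
      have g: "S (g - \<kappa> w) = f (z0 + of_real (real j * r) + w)" for w
        by (simp add: g_def f_def scal_add algebra_simps)
      have "S (g - \<kappa> (of_real r)) = m"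
      proof (rule minimum_spreads [OF \<open>0 < m\<close>])
        show "m \<le> S (g - \<kappa> w)" for w using min g by simp
        show "S g = m" using Suc g[of 0] by simp
        show "cmod (of_real r) powr \<rho> < m" using \<open>0 < r\<close> \<open>r powr \<rho> < m\<close> by simp
      qed
      then show ?case by (simp add: g algebra_simps)
    qed
    note fj = this
    \<comment> \<open>Beyond radius \<open>C\<close>, \<open>big\<close> forces \<open>f\<close> to
      be at least \<open>m + 1\<close>.\<close>
    define C where "C = (m + f 0 + 1) powr (1 / \<rho>)"
    obtain j :: nat where j: "C + cmod z0 < real j * r"
      using \<open>0 < r\<close> by (metis mult.commute reals_Archimedean3)
    have "real j * r \<le> cmod (z0 + of_real (real j * r)) + cmod z0"
      using norm_triangle_ineq4[of "z0 + of_real (real j * r)" z0] \<open>0 < r\<close>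
      by (simp add: norm_mult)
    then have "C \<le> cmod (z0 + of_real (real j * r))" using j by linarith
    then have "C powr \<rho> \<le> cmod (z0 + of_real (real j * r)) powr \<rho>"
      using \<open>0 < \<rho>\<close> by (intro powr_mono2) (auto simp: C_def)
    moreover have "C powr \<rho> = m + f 0 + 1"
      using \<open>0 < \<rho>\<close> \<open>0 < m\<close> f0[of 0] by (simp add: C_def powr_powr)
    ultimately show False using big[of "z0 + of_real (real j * r)"] fj[of j] by linarith
  qed
  then show ?thesis using that by (simp add: m_def f_def)
qed

text \<open>\<open>\<phi> a\<close> is the only constant at distance 0 from \<open>a\<close>; this
  uniqueness turns identities modulo the kernel of \<open>S\<close> into identities for
  \<open>\<phi>\<close>.\<close>

theorem mult_over_character:
  assumes "0 < \<rho>"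
  obtains \<phi> where "character \<phi>" "\<And>a. S a = cmod (\<phi> a) powr \<rho>"
proof -
  have "\<exists>\<phi>. \<forall>a. S (a - \<kappa> (\<phi> a)) = 0"
    using exists_eigenvalue[OF assms] by (intro choice allI) blast
  then obtain \<phi> where \<phi>: "\<And>a. S (a - \<kappa> (\<phi> a)) = 0" by blast
  have uniq: "\<phi> a = z" if "S (a - \<kappa> z) = 0" for a z
  proof -
    have "S (\<kappa> (\<phi> a - z)) \<le> S (a - \<kappa> z) + S (a - \<kappa> (\<phi> a))"
      using mult_over_diff[of "a - \<kappa> z" "a - \<kappa> (\<phi> a)"] by (simp add: scal_diff)
    then have "cmod (\<phi> a - z) powr \<rho> \<le> 0"
      using that \<phi>[of a] by (simp add: mult_over_scal)
    then show ?thesis by simp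
  qed
  have "S ((a + b) - \<kappa> (\<phi> a + \<phi> b)) \<le> S (a - \<kappa> (\<phi> a)) + S (b - \<kappa> (\<phi> b))" for a b
    using mult_over_add[of "a - \<kappa> (\<phi> a)" "b - \<kappa> (\<phi> b)"] by (simp add: scal_add algebra_simps)
  then have add: "\<phi> (a + b) = \<phi> a + \<phi> b" for a b
    by (intro uniq antisym mult_over_nonneg) (simp add: \<phi>)
  have "a * b - \<kappa> (\<phi> a * \<phi> b) = (a - \<kappa> (\<phi> a)) * b + \<kappa> (\<phi> a) * (b - \<kappa> (\<phi> b))" for a b
    by (simp add: scal_mult algebra_simps)
  then have "S (a * b - \<kappa> (\<phi> a * \<phi> b)) \<le> 0" for a b
    using mult_over_add[of "(a - \<kappa> (\<phi> a)) * b" "\<kappa> (\<phi> a) * (b - \<kappa> (\<phi> b))"]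
    by (simp add: mult_over_mult \<phi>)
  then have mult: "\<phi> (a * b) = \<phi> a * \<phi> b" for a b
    by (intro uniq antisym mult_over_nonneg)
  have "\<phi> (\<kappa> c) = c" for c by (intro uniq) (simp add: mult_over_zero)
  moreover have "S a = cmod (\<phi> a) powr \<rho>" for a
    using mult_over_triangle[of a "\<kappa> (\<phi> a)"] \<phi>[of a] by (simp add: mult_over_scal)
  ultimately show ?thesis using add mult by (intro that[of \<phi>]) (auto simp: character_def)
qed

end

end

section \<open>Gelfand's theorem through minimal submultiplicative seminorms\<close>

lemma le_mult_Inf:
  fixes A :: "real set"
  assumes "A \<noteq> {}" "0 \<le> u" "\<And>v. v \<in> A \<Longrightarrow> L \<le> u * v"
  shows "L \<le> u * Inf A"
proof (cases "u = 0")
  case True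
  then show ?thesis using assms by auto
next
  case False
  then have "L / u \<le> Inf A"
    using assms by (intro cInf_greatest) (auto simp: field_simps)
  then show ?thesis using False assms(2) by (simp add: field_simps)
qed

context complex_algebra begin

text \<open>Common to infima of chains, quotient norms and limits under multiplication by powers of
  an element: \<open>V a\<close> collects the competing values at \<open>a\<close>, and
  \<open>one\<close> prevents the infimum from collapsing.\<close>

lemma submult_Inf:
  fixes V :: "'m \<Rightarrow> real set"
  assumes ne: "\<And>a. V a \<noteq> {}"
    and nonneg: "\<And>a u. u \<in> V a \<Longrightarrow> 0 \<le> u"
    and add: "\<And>a b u v. u \<in> V a \<Longrightarrow> v \<in> V b \<Longrightarrow> \<exists>w\<in>V (a + b). w \<le> u + v"
    and mult: "\<And>a b u v. u \<in> V a \<Longrightarrow> v \<in> V b \<Longrightarrow> \<exists>w\<in>V (a * b). w \<le> u * v"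
    and one: "\<And>u. u \<in> V 1 \<Longrightarrow> 1 \<le> u"
    and const: "\<And>c. \<exists>u\<in>V (\<kappa> c). u \<le> cmod c"
  shows "submult (\<lambda>a. Inf (V a))"
proof -
  have low: "Inf (V a) \<le> u" if "u \<in> V a" for a u
    using that nonneg by (intro cInf_lower bdd_belowI) auto
  have Inf_const: "Inf (V (\<kappa> c)) \<le> cmod c" for c
    using const[of c] low by fastforce
  have "Inf (V (a + b)) \<le> Inf (V a) + Inf (V b)" for a b
  proof -
    have "Inf (V (a + b)) - u \<le> Inf (V b)" if "u \<in> V a" for u
      by (rule cInf_greatest[OF ne]) (use add[OF that] low in fastforce)
    then have "Inf (V (a + b)) - Inf (V b) \<le> Inf (V a)"
      by (intro cInf_greatest[OF ne]) fastforce
    then show ?thesis by simp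
  qed
  moreover have "Inf (V (a * b)) \<le> Inf (V a) * Inf (V b)" for a b
  proof -
    have Infn: "0 \<le> Inf (V b)" by (intro cInf_greatest ne nonneg)
    have "Inf (V (a * b)) \<le> u * Inf (V b)" if "u \<in> V a" for u
      by (rule le_mult_Inf[OF ne nonneg[OF that]]) (use mult[OF that] low in fastforce)
    then have "Inf (V (a * b)) \<le> Inf (V b) * Inf (V a)"
      by (intro le_mult_Inf[OF ne Infn]) (simp add: mult.commute)
    then show ?thesis by (simp add: mult.commute)
  qed
  moreover have "Inf (V 1) = 1"
    using Inf_const[of 1] by (intro antisym cInf_greatest ne one) auto
  moreover have "0 \<le> Inf (V a)" for a by (intro cInf_greatest ne nonneg)
  ultimately show ?thesis using Inf_const by (simp add: submult_def)
qed

text \<open>Zorn's lemma for the reversed order. A chain has a submultiplicative pointwise infimum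
  because the smaller of two members serves for both, and all members have the value 1 at 1.\<close>

lemma exists_minimal_submult:
  assumes "submult N0"
  obtains N where "submult N" "\<And>a. N a \<le> N0 a"
    "\<And>N' a. submult N' \<Longrightarrow> (\<And>a. N' a \<le> N a) \<Longrightarrow> N' a = N a"
proof -
  let ?A = "{N. submult N \<and> (\<forall>a. N a \<le> N0 a)}" and ?P = "\<lambda>N N' :: 'm \<Rightarrow> real. \<forall>a. N' a \<le> N a"
  have "\<exists>m\<in>?A. \<forall>a\<in>?A. ?P m a \<longrightarrow> a = m"
  proof (rule predicate_Zorn)
    show "partial_order_on ?A (relation_of ?P ?A)"
      by (rule partial_order_on_relation_ofI) (auto simp: fun_eq_iff intro: order_trans antisym)
    fix C assume C: "C \<in> Chains (relation_of ?P ?A)"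
    have CA: "N \<in> ?A" if "N \<in> C" for N
      using C that by (auto simp: Chains_def relation_of_def)
    have tot: "(\<forall>a. N a \<le> N' a) \<or> (\<forall>a. N' a \<le> N a)" if "N \<in> C" "N' \<in> C" for N N'
      using C that by (auto simp: Chains_def relation_of_def)
    show "\<exists>u\<in>?A. \<forall>a\<in>C. ?P a u"
    proof (cases "C = {}")
      case True
      then show ?thesis using assms by auto
    next
      case False
      define V where "V a = (\<lambda>N. N a) ` C" for a
      have sm: "submult (\<lambda>a. Inf (V a))"
      proof (rule submult_Inf)
        show "V a \<noteq> {}" for a using False by (simp add: V_def)
        show "u \<in> V a \<Longrightarrow> 0 \<le> u" for u a using CA by (auto simp: V_def submult_def)
        show "1 \<le> u" if u: "u \<in> V 1" for u
        proof -
          obtain M where "M \<in> C" "u = M 1" using u by (auto simp: V_def)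
          then show ?thesis using CA[of M] by (simp add: submult_def)
        qed
        show "\<exists>u\<in>V (\<kappa> c). u \<le> cmod c" for c
        proof -
          obtain M where "M \<in> C" using False by blast
          then show ?thesis using CA[of M] by (auto simp: V_def submult_def)
        qed
        fix a b u v assume "u \<in> V a" "v \<in> V b"
        then obtain M M' where M: "M \<in> C" "M' \<in> C" "u = M a" "v = M' b" by (auto simp: V_def)
        obtain L where L: "L \<in> C" "\<And>a. L a \<le> M a" "\<And>a. L a \<le> M' a"
          using tot[OF M(1,2)] M(1,2) by blast
        have sL: "submult L" using CA L(1) by auto
        have "L (a + b) \<le> u + v"
          using sL L(2)[of a] L(3)[of b] M unfolding submult_def by (smt (verit))
        then show "\<exists>w\<in>V (a + b). w \<le> u + v" using L(1) by (auto simp: V_def)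
        have "L (a * b) \<le> L a * L b" using sL by (auto simp: submult_def)
        also have "\<dots> \<le> u * v"
          using sL L M CA by (intro mult_mono) (auto simp: submult_def)
        finally show "\<exists>w\<in>V (a * b). w \<le> u * v" using L(1) by (auto simp: V_def)
      qed
      have low: "Inf (V a) \<le> N a" if "N \<in> C" for N a
        unfolding V_def using that CA by (intro cInf_lower bdd_belowI[of _ 0]) (auto simp: submult_def)
      then have "(\<lambda>a. Inf (V a)) \<in> ?A" using sm False CA by (fastforce intro: order_trans)
      then show ?thesis using low by (intro bexI[of _ "\<lambda>a. Inf (V a)"]) auto
    qed
  qed
  then obtain N where N: "N \<in> ?A" "\<And>N'. N' \<in> ?A \<Longrightarrow> \<forall>a. N' a \<le> N a \<Longrightarrow> N' = N" by blast
  show ?thesis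
  proof (rule that[of N])
    fix N' a assume N': "submult N'" "\<And>a. N' a \<le> N a"
    then have "N' \<in> ?A" using N(1) by (auto intro: order_trans)
    then show "N' a = N a" using N(2)[of N'] N' by simp
  qed (use N(1) in auto)
qed

context
  fixes N :: "'m \<Rightarrow> real"
  assumes N: "submult N"
begin

lemma submult_nonneg: "0 \<le> N a"
  and submult_add: "N (a + b) \<le> N a + N b"
  and submult_mult: "N (a * b) \<le> N a * N b"
  and submult_one: "N 1 = 1"
  and submult_scal_le: "N (\<kappa> c) \<le> cmod c"
  using N by (auto simp: submult_def)

lemma submult_zero: "N 0 = 0"
  using submult_scal_le[of 0] submult_nonneg[of 0] by simp

lemma submult_power: "N (a ^ n) \<le> N a ^ n"
proof (induction n)
  case (Suc n)
  have "N (a ^ Suc n) \<le> N a * N (a ^ n)" using submult_mult by simp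
  also have "\<dots> \<le> N a * N a ^ n" using Suc submult_nonneg by (intro mult_left_mono) auto
  finally show ?case by simp
qed (simp add: submult_one)

text \<open>An upper bound at \<open>inverse c\<close> is a lower bound at \<open>c\<close>.\<close>

lemma submult_scal: "N (\<kappa> c) = cmod c"
proof (cases "c = 0")
  case False
  have "1 = N (\<kappa> c * \<kappa> (inverse c))"
    using False by (simp add: submult_one flip: scal_mult)
  also have "\<dots> \<le> N (\<kappa> c) * N (\<kappa> (inverse c))" by (rule submult_mult)
  also have "\<dots> \<le> N (\<kappa> c) * cmod (inverse c)"
    by (intro mult_left_mono submult_scal_le submult_nonneg)
  finally have "1 \<le> N (\<kappa> c) / cmod c" by (simp only: norm_inverse divide_inverse)
  then have "cmod c \<le> N (\<kappa> c)" using False by (simp add: le_divide_eq)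
  then show ?thesis using submult_scal_le[of c] by simp
qed (simp add: submult_zero)

text \<open>The l1 norm in which coefficients are measured by \<open>N\<close> and the variable has
  norm \<open>r\<close>, in Horner form.\<close>

definition pnorm :: "real \<Rightarrow> 'm poly \<Rightarrow> real" where
  "pnorm r p = fold_coeffs (\<lambda>a b. N a + r * b) p 0"

lemma pnorm_0 [simp]: "pnorm r 0 = 0"
  by (simp add: pnorm_def)

lemma pnorm_pCons [simp]: "pnorm r (pCons a p) = N a + r * pnorm r p"
  by (cases "a = 0 \<and> p = 0") (auto simp: pnorm_def submult_zero)

context
  fixes r :: real
  assumes r: "0 \<le> r"
begin

lemma pnorm_nonneg: "0 \<le> pnorm r p"
  by (induction p) (use r submult_nonneg in auto)

lemma pnorm_add: "pnorm r (p + q) \<le> pnorm r p + pnorm r q"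
proof (induction p q rule: poly_induct2)
  case (pCons a p b q)
  have "r * pnorm r (p + q) \<le> r * (pnorm r p + pnorm r q)"
    using r pCons by (intro mult_left_mono) auto
  then show ?case using submult_add[of a b] by (simp add: distrib_left)
qed simp

lemma pnorm_smult: "pnorm r (smult a p) \<le> N a * pnorm r p"
proof (induction p)
  case (pCons b p)
  have "r * pnorm r (smult a p) \<le> r * (N a * pnorm r p)"
    using r pCons by (intro mult_left_mono) auto
  then show ?case using submult_mult[of a b] by (simp add: distrib_left mult_ac)
qed simp

lemma pnorm_mult: "pnorm r (p * q) \<le> pnorm r p * pnorm r q"
proof (induction p)
  case (pCons a p)
  have "pnorm r (pCons a p * q) \<le> pnorm r (smult a q) + pnorm r (pCons 0 (p * q))"
    unfolding mult_pCons_left by (rule pnorm_add)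
  also have "\<dots> \<le> N a * pnorm r q + r * (pnorm r p * pnorm r q)"
    using r pCons by (intro add_mono pnorm_smult) (auto simp: submult_zero intro: mult_left_mono)
  finally show ?case by (simp add: algebra_simps)
qed simp

lemma pnorm_power: "pnorm r (p ^ n) \<le> pnorm r p ^ n"
proof (induction n)
  case (Suc n)
  have "pnorm r (p ^ Suc n) \<le> pnorm r p * pnorm r (p ^ n)" using pnorm_mult by simp
  also have "\<dots> \<le> pnorm r p * pnorm r p ^ n" using Suc pnorm_nonneg by (intro mult_left_mono) auto
  finally show ?case by simp
qed (simp add: one_pCons submult_one)

text \<open>Evaluation at \<open>x\<close> is bounded once the powers of \<open>x\<close> grow at
  most like those of \<open>r\<close>. The factor \<open>x ^ i\<close> is carried along because each
  \<open>pCons\<close> shifts the exponent.\<close>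

lemma eval_le_pnorm:
  assumes C: "\<And>i. N (x ^ i) \<le> C * r ^ i"
  shows "N (x ^ i * poly p x) \<le> C * r ^ i * pnorm r p"
proof (induction p arbitrary: i)
  case (pCons a p)
  have "N (x ^ i * poly (pCons a p) x) \<le> N (x ^ i * a) + N (x ^ Suc i * poly p x)"
    using submult_add[of "x ^ i * a" "x ^ Suc i * poly p x"] by (simp add: algebra_simps)
  also have "\<dots> \<le> C * r ^ i * N a + C * r ^ Suc i * pnorm r p"
    using pCons(2)[of "Suc i"] submult_mult[of "x ^ i" a] C[of i] submult_nonneg[of a]
    by (intro add_mono) (auto intro: order_trans mult_right_mono)
  finally show ?case by (simp add: algebra_simps)
qed (simp add: submult_zero)

end

context
  assumes minimal: "\<And>N' a. submult N' \<Longrightarrow> (\<And>a. N' a \<le> N a) \<Longrightarrow> N' a = N a"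
begin

text \<open>
  If \<open>N (x ^ n) < N x ^ n\<close>, then the quotient norm of the polynomial algebra, with the variable of
  norm \<open>r < N x\<close>, along evaluation at \<open>x\<close> is strictly smaller than \<open>N\<close>.
\<close>

lemma minimal_power: "N (x ^ n) = N x ^ n"
proof (rule ccontr)
  assume "N (x ^ n) \<noteq> N x ^ n"
  then have less: "N (x ^ n) < N x ^ n" using submult_power[of x n] by simp
  then have n: "0 < n" by (cases n) (auto simp: submult_one)
  have Nx: "0 < N x"
    using less submult_nonneg[of x] submult_nonneg[of "x ^ n"] n
    by (metis le_less_trans less_eq_real_def zero_power)
  \<comment> \<open>Both entries are below \<open>N x\<close>; the second one keeps \<open>r\<close>
    positive when \<open>N (x ^ n) = 0\<close>.\<close>
  define r where "r = max (root n (N (x ^ n))) (N x / 2)"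
  have "root n (N (x ^ n)) < root n (N x ^ n)" using n less by simp
  then have rx: "0 < r" "r < N x"
    using Nx n by (auto simp: r_def real_root_power_cancel)
  have rn: "N (x ^ n) \<le> r ^ n"
  proof -
    have "N (x ^ n) = root n (N (x ^ n)) ^ n" using n submult_nonneg by simp
    also have "\<dots> \<le> r ^ n" using submult_nonneg n by (intro power_mono) (auto simp: r_def)
    finally show ?thesis .
  qed
  \<comment> \<open>Every block of \<open>n\<close> factors \<open>x\<close> costs at most
    \<open>r ^ n\<close>; \<open>C\<close> absorbs the remaining power, with exponent below
    \<open>n\<close>.\<close>
  define C where "C = (\<Sum>l<n. N (x ^ l) / r ^ l)"
  have C: "N (x ^ i) \<le> C * r ^ i" for i
  proof -
    let ?l = "i mod n" and ?j = "i div n"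
    have i: "i = n * ?j + ?l" by simp
    have "N (x ^ ?l) / r ^ ?l \<le> C"
      unfolding C_def using n rx submult_nonneg by (intro member_le_sum) auto
    then have Cl: "N (x ^ ?l) \<le> C * r ^ ?l" using rx by (simp add: field_simps)
    have "N (x ^ i) = N ((x ^ n) ^ ?j * x ^ ?l)"
      by (subst i) (simp only: power_add power_mult)
    also have "\<dots> \<le> N ((x ^ n) ^ ?j) * N (x ^ ?l)" by (rule submult_mult)
    also have "\<dots> \<le> (r ^ n) ^ ?j * (C * r ^ ?l)"
    proof (intro mult_mono Cl)
      show "N ((x ^ n) ^ ?j) \<le> (r ^ n) ^ ?j"
        using submult_power[of "x ^ n" ?j] power_mono[OF rn submult_nonneg, of ?j] by linarith
    qed (use rx submult_nonneg in auto)
    also have "\<dots> = C * r ^ (n * ?j + ?l)" by (simp only: power_add power_mult mult_ac)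
    finally show ?thesis using i by simp
  qed
  define V where "V a = pnorm r ` {p. poly p x = a}" for a
  have r0: "0 \<le> r" using rx by simp
  have VI: "N a \<in> V a" for a
    unfolding V_def by (rule image_eqI[of _ _ "[:a:]"]) auto
  have sm: "submult (\<lambda>a. Inf (V a))"
  proof (rule submult_Inf)
    show "V a \<noteq> {}" for a using VI by blast
    show "u \<in> V a \<Longrightarrow> 0 \<le> u" for u a by (auto simp: V_def pnorm_nonneg[OF r0])
    show "\<exists>u\<in>V (\<kappa> c). u \<le> cmod c" for c using VI submult_scal_le by blast
    fix a b u v assume "u \<in> V a" "v \<in> V b"
    then obtain p q where pq: "u = pnorm r p" "poly p x = a" "v = pnorm r q" "poly q x = b"
      by (auto simp: V_def)
    have "pnorm r (p + q) \<in> V (a + b)" "pnorm r (p * q) \<in> V (a * b)"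
      using pq by (auto simp: V_def)
    then show "\<exists>w\<in>V (a + b). w \<le> u + v" "\<exists>w\<in>V (a * b). w \<le> u * v"
      using pnorm_add[OF r0] pnorm_mult[OF r0] pq by blast+
  next
    fix u assume "u \<in> V 1"
    then obtain p where p: "u = pnorm r p" "poly p x = 1" by (auto simp: V_def)
    \<comment> \<open>All powers of \<open>p\<close> evaluate to 1 as well, which allows the
      constant \<open>C\<close> to be removed in the limit.\<close>
    have le: "1 \<le> C * u ^ k" for k
    proof -
      have "1 = N (x ^ 0 * poly (p ^ k) x)" using p by (simp add: submult_one poly_power)
      also have "\<dots> \<le> C * r ^ 0 * pnorm r (p ^ k)" by (rule eval_le_pnorm[OF r0 C])
      also have "\<dots> \<le> C * u ^ k"
        using C[of 0] pnorm_power[OF r0, of p k] p by (auto simp: submult_one intro: mult_left_mono)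
      finally show ?thesis .
    qed
    show "1 \<le> u"
    proof (rule ccontr)
      assume "\<not> 1 \<le> u"
      then have "(\<lambda>k. C * u ^ k) \<longlonglongrightarrow> C * 0"
        using p pnorm_nonneg[OF r0] by (intro tendsto_intros LIMSEQ_realpow_zero) auto
      then have "1 \<le> C * 0" using le by (intro LIMSEQ_le_const) auto
      then show False by simp
    qed
  qed
  have low: "Inf (V a) \<le> u" if "u \<in> V a" for u a
    using that pnorm_nonneg[OF r0] by (intro cInf_lower bdd_belowI[of _ 0]) (auto simp: V_def)
  have "Inf (V x) = N x" by (rule minimal[OF sm]) (use low VI in blast)
  \<comment> \<open>The variable evaluates to \<open>x\<close> but has norm \<open>r < N x\<close>:
    the contradiction with minimality.\<close>
  moreover have "pnorm r [:0, 1:] \<in> V x" unfolding V_def by (rule imageI) simp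
  then have "Inf (V x) \<le> r" using low by (fastforce simp: submult_zero submult_one)
  ultimately show False using rx by simp
qed

text \<open>By \<open>minimal_power\<close>, \<open>N (a * x ^ n) / N x ^ n\<close> decreases in
  \<open>n\<close> and is constantly 1 for \<open>a = 1\<close>. Its infimum is a submultiplicative
  seminorm below \<open>N\<close>, hence equals \<open>N\<close>; the term \<open>n = 1\<close> then
  gives the missing inequality.\<close>

lemma minimal_mult: "N (a * x) = N a * N x"
proof (cases "N x = 0")
  case True
  then show ?thesis using submult_mult[of a x] submult_nonneg[of "a * x"] by simp
next
  case False
  then have Nx: "0 < N x" using submult_nonneg[of x] by simp
  define f where "f a n = N (a * x ^ n) / N x ^ n" for a n
  have f_decr: "f a (n + k) \<le> f a n" for a n k
  proof -
    have "N (a * x ^ (n + k)) \<le> N (a * x ^ n) * N (x ^ k)"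
      using submult_mult[of "a * x ^ n" "x ^ k"] by (simp add: power_add mult.assoc)
    then show ?thesis using Nx by (simp add: f_def minimal_power power_add field_simps)
  qed
  have sm: "submult (\<lambda>a. Inf (range (f a)))"
  proof (rule submult_Inf)
    show "u \<in> range (f a) \<Longrightarrow> 0 \<le> u" for u a using submult_nonneg Nx by (auto simp: f_def)
    show "u \<in> range (f 1) \<Longrightarrow> 1 \<le> u" for u using Nx by (auto simp: f_def minimal_power)
    show "\<exists>u\<in>range (f (\<kappa> c)). u \<le> cmod c" for c
      using submult_scal_le[of c] by (intro bexI[of _ "f (\<kappa> c) 0"] rangeI) (simp add: f_def)
    fix a b u v assume "u \<in> range (f a)" "v \<in> range (f b)"
    then obtain n k where nk: "u = f a n" "v = f b k" by auto
    have "f (a + b) (n + k) \<le> f a (n + k) + f b (k + n)"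
      using divide_right_mono[OF submult_add[of "a * x ^ (n + k)" "b * x ^ (n + k)"], of "N x ^ (n + k)"] Nx
      by (simp add: f_def add_divide_distrib distrib_right add.commute[of k])
    then have "f (a + b) (n + k) \<le> u + v" using f_decr[of a n k] f_decr[of b k n] nk by linarith
    then show "\<exists>w\<in>range (f (a + b)). w \<le> u + v" by blast
    have "f (a * b) (n + k) \<le> u * v"
      using divide_right_mono[OF submult_mult[of "a * x ^ n" "b * x ^ k"], of "N x ^ (n + k)"] Nx
      by (simp add: f_def nk power_add mult_ac)
    then show "\<exists>w\<in>range (f (a * b)). w \<le> u * v" by blast
  qed auto
  have low: "Inf (range (f a)) \<le> f a n" for a n
    using submult_nonneg Nx by (intro cInf_lower bdd_belowI[of _ 0]) (auto simp: f_def)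
  have eq: "Inf (range (f a)) = N a" for a
    by (rule minimal[OF sm]) (use low[of _ 0] in \<open>simp add: f_def\<close>)
  have "N a \<le> f a 1" using low eq by metis
  then have "N a * N x \<le> N (a * x)" using Nx by (simp add: f_def field_simps)
  then show ?thesis using submult_mult[of a x] by simp
qed

end

end

text \<open>A minimal seminorm below \<open>N\<close> is multiplicative of exponent 1, so it is the
  absolute value of its Gelfand-Mazur character.\<close>

theorem exists_character:
  assumes "submult N"
  obtains \<phi> where "character \<phi>" "\<And>a. cmod (\<phi> a) \<le> N a"
proof -
  obtain M where M: "submult M" "\<And>a. M a \<le> N a"
    and min: "\<And>N' a. submult N' \<Longrightarrow> (\<And>a. N' a \<le> M a) \<Longrightarrow> N' a = M a"
    using exists_minimal_submult[OF assms] by blast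
  have "M (a * x) = M a * M x" for a x by (rule minimal_mult[OF M(1)]) (rule min)
  then have "mult_over 1 M"
    unfolding mult_over_def
    using submult_nonneg[OF M(1)] submult_add[OF M(1)] submult_scal[OF M(1)] by simp
  then obtain \<phi> where "character \<phi>" "\<And>a. M a = cmod (\<phi> a) powr 1"
    by (rule mult_over_character) auto
  then show ?thesis using M(2) by (intro that[of \<phi>]) (auto simp: powr_one)
qed

end

section \<open>Weighted division of polynomials\<close>

text \<open>Induction on the number of coordinates. A finite set that suffices for the first
  \<open>n\<close> coordinates also suffices where coordinate \<open>n\<close> is at least its
  maximum \<open>M\<close> on that set; each of the finitely many smaller values is a slice with its
  own finite set.\<close>

lemma Dickson:
  fixes L :: "(nat \<Rightarrow> nat) set"
  shows "\<exists>B\<subseteq>L. finite B \<and> (\<forall>\<alpha>\<in>L. \<exists>\<beta>\<in>B. \<forall>i<n. \<beta> i \<le> \<alpha> i)"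
proof (induction n arbitrary: L)
  case 0
  show ?case
  proof (cases "L = {}")
    case False
    then obtain \<beta> where "\<beta> \<in> L" by blast
    then show ?thesis by (intro exI[of _ "{\<beta>}"]) auto
  qed auto
next
  case (Suc n)
  obtain B where B: "B \<subseteq> L" "finite B" "\<forall>\<alpha>\<in>L. \<exists>\<beta>\<in>B. \<forall>i<n. \<beta> i \<le> \<alpha> i"
    using Suc[of L] by blast
  define M where "M = Max (insert 0 ((\<lambda>\<beta>. \<beta> n) ` B))"
  have M: "\<beta> n \<le> M" if "\<beta> \<in> B" for \<beta>
    using that B(2) by (auto simp: M_def)
  have "\<forall>j. \<exists>B'\<subseteq>{\<alpha>\<in>L. \<alpha> n = j}. finite B' \<and>
      (\<forall>\<alpha>\<in>{\<alpha>\<in>L. \<alpha> n = j}. \<exists>\<beta>\<in>B'. \<forall>i<n. \<beta> i \<le> \<alpha> i)"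
    by (intro allI Suc)
  from choice[OF this] obtain F where "\<forall>j. F j \<subseteq> {\<alpha>\<in>L. \<alpha> n = j} \<and> finite (F j) \<and>
      (\<forall>\<alpha>\<in>{\<alpha>\<in>L. \<alpha> n = j}. \<exists>\<beta>\<in>F j. \<forall>i<n. \<beta> i \<le> \<alpha> i)"
    by (rule exE)
  then have F: "F j \<subseteq> {\<alpha>\<in>L. \<alpha> n = j}" "finite (F j)"
    "\<alpha> \<in> L \<Longrightarrow> \<alpha> n = j \<Longrightarrow> \<exists>\<beta>\<in>F j. \<forall>i<n. \<beta> i \<le> \<alpha> i" for j \<alpha>
    by (auto dest: spec[of _ j])
  let ?B = "B \<union> (\<Union>j<M. F j)"
  have "\<exists>\<beta>\<in>?B. \<forall>i<Suc n. \<beta> i \<le> \<alpha> i" if \<alpha>: "\<alpha> \<in> L" for \<alpha>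
  proof (cases "\<alpha> n < M")
    case True
    obtain \<beta> where "\<beta> \<in> F (\<alpha> n)" "\<forall>i<n. \<beta> i \<le> \<alpha> i" using F(3)[OF \<alpha> refl] by blast
    moreover from this have "\<beta> n = \<alpha> n" using F(1) by blast
    ultimately have "\<beta> \<in> ?B" "\<forall>i<Suc n. \<beta> i \<le> \<alpha> i" using True by (auto simp: less_Suc_eq)
    then show ?thesis by (intro bexI[of _ \<beta>])
  next
    case False
    obtain \<beta> where "\<beta> \<in> B" "\<forall>i<n. \<beta> i \<le> \<alpha> i" using B(3) \<alpha> by blast
    moreover from this have "\<beta> n \<le> \<alpha> n" using M[of \<beta>] False by simp
    ultimately have "\<beta> \<in> ?B" "\<forall>i<Suc n. \<beta> i \<le> \<alpha> i" by (auto simp: less_Suc_eq)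
    then show ?thesis by (intro bexI[of _ \<beta>])
  qed
  moreover have "?B \<subseteq> L" "finite ?B" using B(1,2) F(1,2) by auto
  ultimately show ?case by (intro exI[of _ ?B] conjI ballI)
qed

text \<open>Given the earlier weights, only countably many values of the next one create an integer
  relation, and the interval is uncountable.\<close>

lemma exists_independent_weights:
  fixes a b :: "nat \<Rightarrow> real"
  assumes "\<And>i. i < n \<Longrightarrow> a i < b i"
  shows "\<exists>w. (\<forall>i<n. a i < w i \<and> w i < b i) \<and>
    (\<forall>k :: nat \<Rightarrow> int. (\<Sum>i<n. of_int (k i) * w i) = 0 \<longrightarrow> (\<forall>i<n. k i = 0))"
  using assms
proof (induction n)
  case (Suc n)
  then obtain w where w: "\<forall>i<n. a i < w i \<and> w i < b i"
    "\<And>k :: nat \<Rightarrow> int. (\<Sum>i<n. of_int (k i) * w i) = 0 \<Longrightarrow> \<forall>i<n. k i = 0"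
    using less_SucI by metis
  \<comment> \<open>Coefficient vectors are coded as lists to have a countable index type, unlike
    \<open>nat \<Rightarrow> int\<close>.\<close>
  define Q where "Q = (\<lambda>l :: int list. - (\<Sum>i<n. of_int (l ! i) * w i) / of_int (l ! n)) ` UNIV"
  have "countable Q" by (simp add: Q_def)
  moreover have "uncountable {a n<..<b n}" using Suc.prems by (intro uncountable_open_interval[THEN iffD2]) auto
  ultimately obtain v where v: "v \<in> {a n<..<b n}" "v \<notin> Q"
    by (metis countable_subset subsetI)
  define w' where "w' = w(n := v)"
  have "\<forall>i<Suc n. a i < w' i \<and> w' i < b i" using w(1) v by (auto simp: w'_def less_Suc_eq)
  moreover have "\<forall>i<Suc n. k i = 0" if k: "(\<Sum>i<Suc n. of_int (k i) * w' i) = 0" for k :: "nat \<Rightarrow> int"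
  proof -
    have eq: "(\<Sum>i<n. of_int (k i) * w i) + of_int (k n) * v = 0"
      using k by (simp add: w'_def)
    have "k n = 0"
    proof (rule ccontr)
      assume "k n \<noteq> 0"
      then have "v = - (\<Sum>i<n. of_int (k i) * w i) / of_int (k n)"
        using eq by (simp add: field_simps)
      also have "\<dots> = - (\<Sum>i<n. of_int (map k [0..<Suc n] ! i) * w i) / of_int (map k [0..<Suc n] ! n)"
        by (simp add: nth_append del: upt_Suc)
      also have "\<dots> \<in> Q" unfolding Q_def by (rule rangeI)
      finally show False using v by blast
    qed
    then show ?thesis using eq w(2)[of k] by (simp add: less_Suc_eq)
  qed
  ultimately show ?case by blast
qed auto

text \<open>Disposes of the factor \<open>k + 1\<close>, the number of terms in the expansion of a
  \<open>k\<close>-th power of a sum.\<close>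

lemma exp_le_linear_imp_le_1:
  fixes x :: real
  assumes "0 \<le> x" "\<And>k. x ^ k \<le> real k + 1"
  shows "x \<le> 1"
proof (rule ccontr)
  assume "\<not> x \<le> 1"
  then have x: "1 < x" by simp
  have "(\<lambda>k. of_nat k * inverse x ^ k) \<longlonglongrightarrow> 0"
    using x by (intro powser_times_n_limit_0) (simp add: inverse_less_1_iff)
  moreover have "(\<lambda>k. inverse x ^ k) \<longlonglongrightarrow> 0"
    using x by (intro LIMSEQ_realpow_zero) (auto simp: inverse_less_1_iff)
  ultimately have "(\<lambda>k. real k * inverse x ^ k + inverse x ^ k) \<longlonglongrightarrow> 0 + 0"
    by (rule tendsto_add)
  moreover have "1 \<le> real k * inverse x ^ k + inverse x ^ k" for k
  proof -
    have "1 = x ^ k * inverse x ^ k" using x by (simp flip: power_mult_distrib)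
    also have "\<dots> \<le> (real k + 1) * inverse x ^ k"
      using assms(2) x by (intro mult_right_mono) auto
    finally show ?thesis by (simp add: distrib_right)
  qed
  ultimately have "1 \<le> (0::real) + 0" by (intro LIMSEQ_le_const) auto
  then show False by simp
qed

context complex_algebra begin

text \<open>Integers are constants and so have seminorm at most 1. The binomial theorem therefore
  bounds \<open>S (a + b) ^ k\<close> by \<open>(k + 1) * M ^ k\<close>, and the linear factor does
  not survive high powers.\<close>

lemma mult_over_0_ultrametric:
  assumes S: "mult_over 0 S"
  shows "S (a + b) \<le> max (S a) (S b)"
proof -
  define M where "M = max (S a) (S b)"
  have M0: "0 \<le> M" using mult_over_nonneg[OF S] by (simp add: M_def le_max_iff_disj)
  show ?thesis
  proof (cases "M = 0")
    case True
    then show ?thesis using mult_over_add[OF S, of a b] by (auto simp: M_def)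
  next
    case False
    then have M: "0 < M" using M0 by simp
    have of_nat: "S (of_nat m) \<le> 1" for m
    proof -
      have "\<kappa> (of_nat m) = of_nat m" by (induction m) (simp_all add: scal_add)
      then have "S (of_nat m) = cmod (of_nat m) powr 0"
        using mult_over_scal[OF S, of "of_nat m"] by simp
      then show ?thesis by simp
    qed
    have "S (a + b) ^ k \<le> (real k + 1) * M ^ k" for k
    proof -
      have "S (a + b) ^ k = S (\<Sum>i\<le>k. of_nat (k choose i) * a ^ i * b ^ (k - i))"
        by (simp add: binomial_ring flip: mult_over_power[OF S])
      also have "\<dots> \<le> (\<Sum>i\<le>k. S (of_nat (k choose i) * a ^ i * b ^ (k - i)))"
        by (rule mult_over_sum[OF S])
      also have "\<dots> \<le> (\<Sum>i\<le>k. M ^ k)"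
      proof (rule sum_mono)
        fix i assume "i \<in> {..k}"
        have "S (of_nat (k choose i) * a ^ i * b ^ (k - i)) = S (of_nat (k choose i)) * S a ^ i * S b ^ (k - i)"
          by (simp add: mult_over_mult[OF S] mult_over_power[OF S])
        also have "\<dots> \<le> 1 * M ^ i * M ^ (k - i)"
          using M0 of_nat mult_over_nonneg[OF S] by (intro mult_mono power_mono) (auto simp: M_def)
        also have "\<dots> = M ^ k" using \<open>i \<in> {..k}\<close> by (simp flip: power_add)
        finally show "S (of_nat (k choose i) * a ^ i * b ^ (k - i)) \<le> M ^ k" .
      qed
      finally show ?thesis by (simp add: add.commute)
    qed
    then have "(S (a + b) / M) ^ k \<le> real k + 1" for k
      using M by (simp add: power_divide pos_divide_le_eq)
    then have "S (a + b) / M \<le> 1"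
      using M mult_over_nonneg[OF S] by (intro exp_le_linear_imp_le_1) auto
    then show ?thesis using M by (simp add: M_def[symmetric] divide_le_eq)
  qed
qed

lemma mult_over_0_sum_less:
  assumes S: "mult_over 0 S" and "finite A" "0 < r" "\<And>i. i \<in> A \<Longrightarrow> S (f i) < r"
  shows "S (sum f A) < r"
  using assms(2,4)
proof (induction A)
  case (insert x A)
  then show ?case using mult_over_0_ultrametric[OF S, of "f x" "sum f A"] by fastforce
qed (simp add: mult_over_zero[OF S] \<open>0 < r\<close>)

end

section \<open>Polynomials in countably many variables and weighted l1 norms\<close>

type_synonym mono = "nat \<Rightarrow>\<^sub>0 nat"
type_synonym cpoly = "mono \<Rightarrow>\<^sub>0 complex"

abbreviation const :: "complex \<Rightarrow> cpoly" where "const \<equiv> Poly_Mapping.single 0"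
abbreviation xpow :: "mono \<Rightarrow> cpoly" where "xpow \<alpha> \<equiv> Poly_Mapping.single \<alpha> 1"

interpretation cpoly: complex_algebra const
  by unfold_locales (simp_all add: single_add mult_single)

lemma poly_mapping_sum_singles:
  "p = (\<Sum>\<alpha>\<in>Poly_Mapping.keys p. Poly_Mapping.single \<alpha> (Poly_Mapping.lookup p \<alpha>))"
proof (rule poly_mapping_eqI)
  fix \<beta>
  show "Poly_Mapping.lookup p \<beta> = Poly_Mapping.lookup
      (\<Sum>\<alpha>\<in>Poly_Mapping.keys p. Poly_Mapping.single \<alpha> (Poly_Mapping.lookup p \<alpha>)) \<beta>"
    by (simp add: lookup_sum lookup_single when_def not_in_keys_iff_lookup_eq_zero)
qed

text \<open>The complex-linear endomorphism that sends \<open>xpow \<alpha>\<close> to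
  \<open>e \<alpha>\<close>.\<close>

definition lin :: "(mono \<Rightarrow> cpoly) \<Rightarrow> cpoly \<Rightarrow> cpoly" where
  "lin e p = (\<Sum>\<alpha>\<in>Poly_Mapping.keys p. const (Poly_Mapping.lookup p \<alpha>) * e \<alpha>)"

lemma lin_superset:
  assumes "finite A" "Poly_Mapping.keys p \<subseteq> A"
  shows "lin e p = (\<Sum>\<alpha>\<in>A. const (Poly_Mapping.lookup p \<alpha>) * e \<alpha>)"
  unfolding lin_def using assms
  by (intro sum.mono_neutral_left) (auto simp: not_in_keys_iff_lookup_eq_zero)

lemma lin_monom: "lin xpow p = p"
  by (subst (2) poly_mapping_sum_singles) (simp add: lin_def mult_single)

lemma lin_diff: "lin e (p - q) = lin e p - lin e q"
proof -
  let ?A = "Poly_Mapping.keys p \<union> Poly_Mapping.keys q"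
  have "Poly_Mapping.keys (p - q) \<subseteq> ?A" by (rule keys_diff)
  then have "lin e (p - q) = (\<Sum>\<alpha>\<in>?A. const (Poly_Mapping.lookup (p - q) \<alpha>) * e \<alpha>)"
    by (intro lin_superset) auto
  also have "\<dots> = lin e p - lin e q"
    by (simp add: lin_superset[of ?A] lookup_minus single_diff left_diff_distrib sum_subtractf)
  finally show ?thesis .
qed

lemma keys_lin: "Poly_Mapping.keys (lin e p) \<subseteq> (\<Union>\<alpha>\<in>Poly_Mapping.keys p. Poly_Mapping.keys (e \<alpha>))"
proof -
  have "Poly_Mapping.keys (const c * q) \<subseteq> Poly_Mapping.keys q" for c q
    using keys_mult[of "const c" q] by (auto split: if_splits)
  then show ?thesis unfolding lin_def
    by (intro order_trans[OF keys_sum] UN_mono) auto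
qed

locale monomial_weight =
  fixes W :: "mono \<Rightarrow> real"
  assumes W_pos: "0 < W \<alpha>" and W_add: "W (\<alpha> + \<beta>) = W \<alpha> * W \<beta>"
begin

lemma W_0: "W 0 = 1"
  using W_add[of 0 0] W_pos[of 0] by simp

definition nrm :: "cpoly \<Rightarrow> real" where
  "nrm p = (\<Sum>\<alpha>\<in>Poly_Mapping.keys p. cmod (Poly_Mapping.lookup p \<alpha>) * W \<alpha>)"

lemma nrm_superset:
  assumes "finite A" "Poly_Mapping.keys p \<subseteq> A"
  shows "nrm p = (\<Sum>\<alpha>\<in>A. cmod (Poly_Mapping.lookup p \<alpha>) * W \<alpha>)"
  unfolding nrm_def using assms
  by (intro sum.mono_neutral_left) (auto simp: not_in_keys_iff_lookup_eq_zero)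

lemma nrm_nonneg: "0 \<le> nrm p"
  unfolding nrm_def by (intro sum_nonneg mult_nonneg_nonneg less_imp_le[OF W_pos]) simp

lemma nrm_single: "nrm (Poly_Mapping.single \<alpha> c) = cmod c * W \<alpha>"
  by (simp add: nrm_superset[of "{\<alpha>}"])

lemma nrm_0: "nrm 0 = 0"
  by (simp add: nrm_def)

lemma nrm_add: "nrm (p + q) \<le> nrm p + nrm q"
proof -
  let ?A = "Poly_Mapping.keys p \<union> Poly_Mapping.keys q"
  have "nrm (p + q) = (\<Sum>\<alpha>\<in>?A. cmod (Poly_Mapping.lookup (p + q) \<alpha>) * W \<alpha>)"
    by (rule nrm_superset) (auto dest: subsetD[OF Poly_Mapping.keys_add])
  also have "\<dots> \<le> (\<Sum>\<alpha>\<in>?A. cmod (Poly_Mapping.lookup p \<alpha>) * W \<alpha> + cmod (Poly_Mapping.lookup q \<alpha>) * W \<alpha>)"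
    unfolding lookup_add distrib_right[symmetric]
    using W_pos by (intro sum_mono mult_right_mono norm_triangle_ineq) (auto intro: less_imp_le)
  also have "\<dots> = nrm p + nrm q" by (simp add: nrm_superset[of ?A] sum.distrib)
  finally show ?thesis .
qed

lemma nrm_sum: "nrm (sum f A) \<le> (\<Sum>i\<in>A. nrm (f i))"
proof (induction A rule: infinite_finite_induct)
  case (insert x F)
  then show ?case using nrm_add[of "f x" "sum f F"] by simp
qed (simp_all add: nrm_0)

lemma nrm_mult: "nrm (p * q) \<le> nrm p * nrm q"
proof -
  let ?l = Poly_Mapping.lookup and ?s = Poly_Mapping.single and ?k = Poly_Mapping.keys
  have "p * q = (\<Sum>\<alpha>\<in>?k p. ?s \<alpha> (?l p \<alpha>)) * (\<Sum>\<beta>\<in>?k q. ?s \<beta> (?l q \<beta>))"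
    by (simp flip: poly_mapping_sum_singles)
  also have "\<dots> = (\<Sum>\<alpha>\<in>?k p. \<Sum>\<beta>\<in>?k q. ?s (\<alpha> + \<beta>) (?l p \<alpha> * ?l q \<beta>))"
    by (simp add: sum_product mult_single)
  also have "nrm \<dots> \<le> (\<Sum>\<alpha>\<in>?k p. \<Sum>\<beta>\<in>?k q. nrm (?s (\<alpha> + \<beta>) (?l p \<alpha> * ?l q \<beta>)))"
    by (intro order_trans[OF nrm_sum] sum_mono nrm_sum)
  also have "\<dots> = nrm p * nrm q"
    unfolding nrm_single by (simp add: W_add norm_mult nrm_def sum_product mult_ac)
  finally show ?thesis .
qed

text \<open>The advantage of an l1 norm: a linear map is a contraction as soon as it is one on
  monomials.\<close>

lemma nrm_lin:
  assumes "\<And>\<alpha>. \<alpha> \<in> Poly_Mapping.keys p \<Longrightarrow> nrm (e \<alpha>) \<le> W \<alpha>"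
  shows "nrm (lin e p) \<le> nrm p"
proof -
  have "nrm (lin e p) \<le> (\<Sum>\<alpha>\<in>Poly_Mapping.keys p. nrm (const (Poly_Mapping.lookup p \<alpha>) * e \<alpha>))"
    unfolding lin_def by (rule nrm_sum)
  also have "\<dots> \<le> nrm p"
    unfolding nrm_def[of p]
  proof (rule sum_mono)
    fix \<alpha> assume "\<alpha> \<in> Poly_Mapping.keys p"
    then show "nrm (const (Poly_Mapping.lookup p \<alpha>) * e \<alpha>) \<le> cmod (Poly_Mapping.lookup p \<alpha>) * W \<alpha>"
      using nrm_mult[of "const (Poly_Mapping.lookup p \<alpha>)" "e \<alpha>"] assms[of \<alpha>]
      by (simp add: nrm_single W_0) (meson mult_left_mono norm_ge_zero order_trans)
  qed
  finally show ?thesis .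
qed

lemma lookup_0_le_nrm: "cmod (Poly_Mapping.lookup p 0) \<le> nrm p"
proof (cases "0 \<in> Poly_Mapping.keys p")
  case True
  have "cmod (Poly_Mapping.lookup p 0) * W 0 \<le> nrm p"
    unfolding nrm_def by (rule member_le_sum) (use True in \<open>auto intro: mult_nonneg_nonneg less_imp_le[OF W_pos]\<close>)
  then show ?thesis by (simp add: W_0)
qed (simp add: not_in_keys_iff_lookup_eq_zero nrm_nonneg)

text \<open>
  \<open>lin e\<close> is one round of division by a standard basis: it replaces every monomial in \<open>L\<close> by terms
  of lower weight. It need not terminate, since weights may be negative, but it does not increase the
  norm and eventually pushes a member of \<open>I\<close> below weight 0.
\<close>

lemma one_le_nrm_one_minus:
  fixes wt :: "mono \<Rightarrow> real"
  assumes "0 < \<delta>" and wt0: "wt 0 = 0"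
    and nrm_e: "\<And>\<alpha>. \<alpha> \<in> D \<Longrightarrow> nrm (e \<alpha>) \<le> W \<alpha>"
    and keys_e: "\<And>\<alpha>. \<alpha> \<in> D \<Longrightarrow> Poly_Mapping.keys (e \<alpha>) \<subseteq> D" and D0: "0 \<in> D"
    and std: "\<And>\<alpha>. \<alpha> \<notin> L \<Longrightarrow> e \<alpha> = xpow \<alpha>" and L0: "0 \<notin> L"
    and drop: "\<And>\<alpha> \<beta>. \<alpha> \<in> L \<Longrightarrow> \<beta> \<in> Poly_Mapping.keys (e \<alpha>) \<Longrightarrow> wt \<beta> \<le> wt \<alpha> - \<delta>"
    and ID: "\<And>p. p \<in> I \<Longrightarrow> Poly_Mapping.keys p \<subseteq> D" and IE: "\<And>p. p \<in> I \<Longrightarrow> lin e p \<in> I"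
    and lead: "\<And>p. p \<in> I \<Longrightarrow> p \<noteq> 0 \<Longrightarrow> \<exists>\<alpha>\<in>L \<inter> Poly_Mapping.keys p. \<forall>\<beta>\<in>Poly_Mapping.keys p. wt \<beta> \<le> wt \<alpha>"
    and p: "p \<in> I"
  shows "1 \<le> nrm (1 - p)"
proof -
  define P where "P k = (lin e ^^ k) p" for k
  have P_Suc: "P (Suc k) = lin e (P k)" for k by (simp add: P_def)
  have PI: "P k \<in> I" for k by (induction k) (use p IE in \<open>auto simp: P_def\<close>)
  define M where "M = Max (insert 0 (wt ` Poly_Mapping.keys p))"
  \<comment> \<open>Only monomials in \<open>L\<close> sink; those outside it stay where they
    are.\<close>
  have bound: "\<beta> \<in> L \<inter> Poly_Mapping.keys (P k) \<Longrightarrow> wt \<beta> \<le> M - real k * \<delta>" for k \<beta>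
  proof (induction k arbitrary: \<beta>)
    case 0
    then show ?case by (auto simp: P_def M_def)
  next
    case (Suc k)
    then obtain \<alpha> where \<alpha>: "\<alpha> \<in> Poly_Mapping.keys (P k)" "\<beta> \<in> Poly_Mapping.keys (e \<alpha>)"
      using keys_lin[of e "P k"] by (auto simp: P_Suc)
    \<comment> \<open>A monomial outside \<open>L\<close> is reproduced unchanged, so it cannot give
      rise to \<open>\<beta> \<in> L\<close>.\<close>
    have "\<alpha> \<in> L"
      using std[of \<alpha>] \<alpha>(2) Suc.prems by (cases "\<alpha> \<in> L") auto
    then have "wt \<beta> \<le> wt \<alpha> - \<delta>" "wt \<alpha> \<le> M - real k * \<delta>"
      using drop \<alpha> Suc.IH[of \<alpha>] by auto
    then show ?case by (simp add: algebra_simps)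
  qed
  obtain k :: nat where "M < real k * \<delta>"
    using \<open>0 < \<delta>\<close> by (metis mult.commute reals_Archimedean3)
  \<comment> \<open>The monomial 1 is itself outside \<open>L\<close>. If it occurred, the leading
    monomial, which is in \<open>L\<close>, would have weight at least 0, but by now all weights in
    \<open>L\<close> are negative.\<close>
  have "Poly_Mapping.lookup (P k) 0 = 0"
  proof (rule ccontr)
    assume "Poly_Mapping.lookup (P k) 0 \<noteq> 0"
    then have 0: "0 \<in> Poly_Mapping.keys (P k)" "P k \<noteq> 0" by (auto simp: in_keys_iff)
    obtain \<alpha> where "\<alpha> \<in> L \<inter> Poly_Mapping.keys (P k)" "wt 0 \<le> wt \<alpha>"
      using lead[OF PI 0(2)] 0(1) by blast
    then show False using bound[of \<alpha> k] wt0 \<open>M < real k * \<delta>\<close> by simp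
  qed
  then have "1 \<le> nrm (1 - P k)"
    using lookup_0_le_nrm[of "1 - P k"] by (simp add: lookup_minus)
  \<comment> \<open>\<open>lin e\<close> fixes 1, so \<open>1 - P k\<close> arises from
    \<open>1 - p\<close> by \<open>k\<close> contractions.\<close>
  also have "nrm (1 - P k) \<le> nrm (1 - p)" for k
  proof (induction k)
    case (Suc k)
    have "lin e 1 = 1" using std[OF L0] by (simp add: lin_def)
    then have "1 - P (Suc k) = lin e (1 - P k)" by (simp add: lin_diff P_Suc)
    moreover have "nrm (lin e (1 - P k)) \<le> nrm (1 - P k)"
    proof (rule nrm_lin, rule nrm_e)
      fix \<alpha> assume "\<alpha> \<in> Poly_Mapping.keys (1 - P k)"
      then show "\<alpha> \<in> D"
        using keys_diff[of 1 "P k"] ID[OF PI, of k] D0 by auto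
    qed
    ultimately show ?case using Suc by simp
  qed (simp add: P_def)
  finally show ?thesis .
qed

end

lemma lookup_const_mult:
  "Poly_Mapping.lookup (const c * p) \<alpha> = c * Poly_Mapping.lookup p \<alpha>"
  by (simp add: Poly_Mapping.map.rep_eq when_def flip: mult_map_scale_conv_mult)

abbreviation xvar :: "nat \<Rightarrow> cpoly" where "xvar i \<equiv> xpow (Poly_Mapping.single i 1)"

text \<open>\<open>reach\<close> reduces the infinitely many variables of \<open>cpoly\<close> to
  the first \<open>n\<close> modulo the kernel of \<open>S\<close>, as Dickson's lemma needs
  finitely many. The strict inequality in \<open>vw\<close> leaves an interval in which to choose
  independent weights.\<close>

theorem trivially_valued_character:
  fixes S :: "cpoly \<Rightarrow> real"
  assumes S: "cpoly.mult_over 0 S"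
    and S_monom: "\<And>\<alpha>. Poly_Mapping.keys \<alpha> \<subseteq> {..<n} \<Longrightarrow>
      S (xpow \<alpha>) = (\<Prod>i<n. v i ^ Poly_Mapping.lookup \<alpha> i)"
    and v0: "\<And>i. i < n \<Longrightarrow> 0 \<le> v i"
    and vw: "\<And>i. i < n \<Longrightarrow> v i < exp (w i)"
    and reach: "\<And>p. \<exists>q. (\<forall>\<alpha>\<in>Poly_Mapping.keys q. Poly_Mapping.keys \<alpha> \<subseteq> {..<n}) \<and> S (p - q) = 0"
  obtains R0 where "1 \<le> R0"
    "\<And>R. R0 \<le> R \<Longrightarrow> \<exists>\<phi>. cpoly.character \<phi> \<and> (\<forall>p. S p = 0 \<longrightarrow> \<phi> p = 0) \<and>
      (\<forall>i<n. cmod (\<phi> (xvar i)) \<le> R powr w i)"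
proof -
  let ?l = Poly_Mapping.lookup and ?k = Poly_Mapping.keys
  note S_nonneg = cpoly.mult_over_nonneg[OF S] and S_add = cpoly.mult_over_add[OF S]
    and S_mult = cpoly.mult_over_mult[OF S] and S_0 = cpoly.mult_over_zero[OF S]
    and S_diff = cpoly.mult_over_diff[OF S]
  have S_const: "S (const c) = (if c = 0 then 0 else 1)" for c
    using cpoly.mult_over_scal[OF S, of c] by simp
  have S_eq0: "S a = 0 \<longleftrightarrow> S a \<le> 0" for a using S_nonneg[of a] by simp

  \<comment> \<open>Weights on the monomials in the first \<open>n\<close> variables\<close>
  define D :: "mono set" where "D = {\<alpha>. ?k \<alpha> \<subseteq> {..<n}}"
  have D0: "0 \<in> D" by (simp add: D_def)
  have D_add: "\<alpha> + \<beta> \<in> D" if "\<alpha> \<in> D" "\<beta> \<in> D" for \<alpha> \<beta>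
    using that Poly_Mapping.keys_add[of \<alpha> \<beta>] by (auto simp: D_def)
  have D_lookup: "?l \<alpha> i = 0" if "\<alpha> \<in> D" "\<not> i < n" for \<alpha> i
    using that by (auto simp: D_def not_in_keys_iff_lookup_eq_zero[symmetric])
  \<comment> \<open>For \<open>v i = 0\<close> the logarithm would be minus infinity, and any number
    below \<open>w i\<close> can serve as lower end.\<close>
  obtain w' where w': "\<And>i. i < n \<Longrightarrow> (if v i = 0 then w i - 1 else ln (v i)) < w' i"
      "\<And>i. i < n \<Longrightarrow> w' i < w i"
    and indep: "\<And>k :: nat \<Rightarrow> int. (\<Sum>i<n. of_int (k i) * w' i) = 0 \<Longrightarrow> \<forall>i<n. k i = 0"
  proof -
    have "(if v i = 0 then w i - 1 else ln (v i)) < w i" if "i < n" for i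
      using vw[OF that] v0[OF that] ln_less_cancel_iff[of "v i" "exp (w i)"] by auto
    then have "\<exists>u. (\<forall>i<n. (if v i = 0 then w i - 1 else ln (v i)) < u i \<and> u i < w i) \<and>
        (\<forall>k :: nat \<Rightarrow> int. (\<Sum>i<n. of_int (k i) * u i) = 0 \<longrightarrow> (\<forall>i<n. k i = 0))"
      by (rule exists_independent_weights)
    then obtain u where u: "\<forall>i<n. (if v i = 0 then w i - 1 else ln (v i)) < u i \<and> u i < w i"
      "\<forall>k :: nat \<Rightarrow> int. (\<Sum>i<n. of_int (k i) * u i) = 0 \<longrightarrow> (\<forall>i<n. k i = 0)"
      by (elim exE conjE)
    show ?thesis by (rule that[of u]) (use u(1) u(2)[rule_format] in simp_all)
  qed
  have vw': "v i \<le> exp (w' i)" if "i < n" for i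
  proof (cases "v i = 0")
    case False
    then have "v i = exp (ln (v i))" using v0[OF that] by simp
    also have "\<dots> \<le> exp (w' i)" using w'(1)[OF that] False by simp
    finally show ?thesis .
  qed simp
  define wt :: "mono \<Rightarrow> real" where "wt \<alpha> = (\<Sum>i<n. real (?l \<alpha> i) * w' i)" for \<alpha>
  have wt_0: "wt 0 = 0" by (simp add: wt_def)
  have wt_add: "wt (\<alpha> + \<beta>) = wt \<alpha> + wt \<beta>" for \<alpha> \<beta>
    by (simp add: wt_def lookup_add distrib_right sum.distrib)
  have wt_inj: "\<alpha> = \<beta>" if "\<alpha> \<in> D" "\<beta> \<in> D" "wt \<alpha> = wt \<beta>" for \<alpha> \<beta>
  proof (rule poly_mapping_eqI)
    fix i
    have "(\<Sum>i<n. of_int (int (?l \<alpha> i) - int (?l \<beta> i)) * w' i) = 0"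
      using that(3) by (simp add: wt_def left_diff_distrib sum_subtractf)
    then show "?l \<alpha> i = ?l \<beta> i"
      using indep[of "\<lambda>i. int (?l \<alpha> i) - int (?l \<beta> i)"] D_lookup[OF that(1), of i]
        D_lookup[OF that(2), of i] by (cases "i < n") auto
  qed
  have S_wt: "S (xpow \<alpha>) \<le> exp (wt \<alpha>)" if "\<alpha> \<in> D" for \<alpha>
  proof -
    have "S (xpow \<alpha>) \<le> (\<Prod>i<n. exp (w' i) ^ ?l \<alpha> i)"
      using that S_monom[of \<alpha>] vw' v0 by (auto simp: D_def intro!: prod_mono power_mono)
    also have "\<dots> = exp (wt \<alpha>)"
      by (simp add: wt_def exp_sum exp_of_nat_mult)
    finally show ?thesis .
  qed

  \<comment> \<open>Leading monomials of the kernel and a finite standard basis\<close>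
  define I where "I = {p. ?k p \<subseteq> D \<and> S p = 0}"
  define is_lead where "is_lead p \<alpha> \<longleftrightarrow> \<alpha> \<in> ?k p \<and> (\<forall>\<beta>\<in>?k p - {\<alpha>}. wt \<beta> < wt \<alpha>)" for p :: cpoly and \<alpha>
  have ex_lead: "\<exists>\<alpha>. is_lead p \<alpha>" if "?k p \<subseteq> D" "p \<noteq> 0" for p
  proof -
    have "wt ` ?k p \<noteq> {}" using that(2) by simp
    then have "Max (wt ` ?k p) \<in> wt ` ?k p" by (intro Max_in) auto
    then obtain \<alpha> where \<alpha>: "\<alpha> \<in> ?k p" "wt \<alpha> = Max (wt ` ?k p)" by force
    have "wt \<beta> < wt \<alpha>" if "\<beta> \<in> ?k p - {\<alpha>}" for \<beta>
    proof -
      have "wt \<beta> \<le> wt \<alpha>" using that \<alpha>(2) by simp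
      moreover have "wt \<beta> \<noteq> wt \<alpha>" using wt_inj[of \<beta> \<alpha>] that \<alpha>(1) \<open>?k p \<subseteq> D\<close> by blast
      ultimately show ?thesis by simp
    qed
    then show ?thesis using \<alpha>(1) by (auto simp: is_lead_def)
  qed
  define L0 where "L0 = {\<alpha>. \<exists>p\<in>I. is_lead p \<alpha>}"
  have L0D: "L0 \<subseteq> D" by (auto simp: L0_def I_def is_lead_def)
  \<comment> \<open>If 1 were leading, all other terms would have seminorm below 1, hence so would
    their sum by the ultrametric inequality; the nonzero constant term has seminorm exactly
    1.\<close>
  have "0 \<notin> L0"
  proof
    assume "0 \<in> L0"
    then obtain p where p: "?k p \<subseteq> D" "S p = 0" "0 \<in> ?k p" "\<And>\<beta>. \<beta> \<in> ?k p - {0} \<Longrightarrow> wt \<beta> < 0"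
      by (auto simp: L0_def I_def is_lead_def wt_0)
    define r where "r = (\<Sum>\<beta>\<in>?k p - {0}. Poly_Mapping.single \<beta> (?l p \<beta>))"
    have "p = const (?l p 0) + r"
      unfolding r_def by (subst poly_mapping_sum_singles) (simp add: sum.remove[OF _ p(3)])
    then have "S (const (?l p 0)) \<le> S p + S r"
      using S_diff[of p r] by (metis add_diff_cancel_right')
    moreover have "S r < 1"
      unfolding r_def
    proof (rule cpoly.mult_over_0_sum_less[OF S])
      fix \<beta> assume \<beta>: "\<beta> \<in> ?k p - {0}"
      have "S (Poly_Mapping.single \<beta> (?l p \<beta>)) = S (const (?l p \<beta>) * xpow \<beta>)"
        by (simp add: mult_single)
      also have "\<dots> \<le> 1 * exp (wt \<beta>)"
        unfolding S_mult using \<beta> p(1) S_wt[of \<beta>] by (intro mult_mono) (auto simp: S_const S_nonneg)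
      also have "\<dots> < 1" using p(4)[OF \<beta>] by simp
      finally show "S (Poly_Mapping.single \<beta> (?l p \<beta>)) < 1" .
    qed auto
    ultimately show False using p(2,3) by (simp add: S_const in_keys_iff)
  qed
  obtain B where B: "B \<subseteq> L0" "finite B" "\<And>\<alpha>. \<alpha> \<in> L0 \<Longrightarrow> \<exists>\<beta>\<in>B. \<forall>i. ?l \<beta> i \<le> ?l \<alpha> i"
  proof -
    obtain B0 where B0: "B0 \<subseteq> ?l ` L0" "finite B0" "\<forall>\<alpha>\<in>?l ` L0. \<exists>\<beta>\<in>B0. \<forall>i<n. \<beta> i \<le> \<alpha> i"
      using Dickson[of "?l ` L0" n] by (elim exE conjE)
    obtain B where B: "B \<subseteq> L0" "finite B" "B0 = ?l ` B"
      using finite_subset_image[OF B0(2,1)] by blast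
    have "\<exists>\<beta>\<in>B. \<forall>i. ?l \<beta> i \<le> ?l \<alpha> i" if \<alpha>: "\<alpha> \<in> L0" for \<alpha>
    proof -
      obtain \<beta> where \<beta>: "\<beta> \<in> B" "\<forall>i<n. ?l \<beta> i \<le> ?l \<alpha> i"
        using B0(3) \<alpha> unfolding B(3) by blast
      have "?l \<beta> i \<le> ?l \<alpha> i" for i
        using \<beta> D_lookup[of \<beta> i] B(1) L0D by (cases "i < n") auto
      then show ?thesis using \<beta>(1) by blast
    qed
    then show ?thesis using that B by blast
  qed
  have "\<exists>g. g \<in> I \<and> is_lead g \<beta> \<and> ?l g \<beta> = 1" if \<beta>: "\<beta> \<in> B" for \<beta>
  proof -
    obtain p where p: "p \<in> I" "is_lead p \<beta>" using \<beta> B(1) by (auto simp: L0_def)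
    define c where "c = inverse (?l p \<beta>)"
    have c: "c \<noteq> 0" "c * ?l p \<beta> = 1" using p(2) by (auto simp: c_def is_lead_def in_keys_iff)
    then have "?k (const c * p) = ?k p" by (auto simp: in_keys_iff lookup_const_mult)
    then have "const c * p \<in> I" "is_lead (const c * p) \<beta>"
      using p by (auto simp: I_def is_lead_def S_mult)
    then show ?thesis using c(2) by (metis lookup_const_mult)
  qed
  then obtain g where g: "\<And>\<beta>. \<beta> \<in> B \<Longrightarrow> g \<beta> \<in> I" "\<And>\<beta>. \<beta> \<in> B \<Longrightarrow> is_lead (g \<beta>) \<beta>"
    "\<And>\<beta>. \<beta> \<in> B \<Longrightarrow> ?l (g \<beta>) \<beta> = 1"
    by metis

  \<comment> \<open>Rewriting leading monomials by lighter tails\<close>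
  define t where "t \<beta> = xpow \<beta> - g \<beta>" for \<beta>
  have keys_t: "?k (t \<beta>) \<subseteq> ?k (g \<beta>) - {\<beta>}" if "\<beta> \<in> B" for \<beta>
    using g(3)[OF that] by (auto simp: t_def in_keys_iff lookup_minus lookup_single when_def split: if_splits)
  have t_D: "?k (t \<beta>) \<subseteq> D" if "\<beta> \<in> B" for \<beta>
    using keys_t[OF that] g(1)[OF that] by (auto simp: I_def)
  \<comment> \<open>At most the smallest gap between a leading monomial and its tail; the entry 1
    covers the case of no tails at all.\<close>
  define \<delta> where "\<delta> = Min (insert 1 (\<Union>\<beta>\<in>B. (\<lambda>\<gamma>. wt \<beta> - wt \<gamma>) ` ?k (t \<beta>)))"
  have fin: "finite (insert 1 (\<Union>\<beta>\<in>B. (\<lambda>\<gamma>. wt \<beta> - wt \<gamma>) ` ?k (t \<beta>)))" using B(2) by auto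
  have \<delta>_le: "wt \<gamma> \<le> wt \<beta> - \<delta>" if "\<beta> \<in> B" "\<gamma> \<in> ?k (t \<beta>)" for \<beta> \<gamma>
  proof -
    have "\<delta> \<le> wt \<beta> - wt \<gamma>" unfolding \<delta>_def using that by (intro Min_le[OF fin]) auto
    then show ?thesis by simp
  qed
  have "0 < \<delta>"
    unfolding \<delta>_def
  proof (subst Min_gr_iff[OF fin])
    show "\<forall>a\<in>insert 1 (\<Union>\<beta>\<in>B. (\<lambda>\<gamma>. wt \<beta> - wt \<gamma>) ` ?k (t \<beta>)). 0 < a"
      using g(2) keys_t by (fastforce simp: is_lead_def)
  qed simp
  define C where "C = (\<Sum>\<beta>\<in>B. \<Sum>\<gamma>\<in>?k (t \<beta>). cmod (?l (t \<beta>) \<gamma>))"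
  have C_ge: "(\<Sum>\<gamma>\<in>?k (t \<beta>). cmod (?l (t \<beta>) \<gamma>)) \<le> C" if "\<beta> \<in> B" for \<beta>
    unfolding C_def using that B(2) by (intro member_le_sum) (auto intro: sum_nonneg)
  have "0 \<le> C" unfolding C_def by (intro sum_nonneg) auto
  \<comment> \<open>The monomials divisible by a leading monomial of the basis; by the choice of
    \<open>B\<close> they include all of \<open>L0\<close>.\<close>
  define L where "L = {\<alpha>\<in>D. \<exists>\<beta>\<in>B. \<forall>i. ?l \<beta> i \<le> ?l \<alpha> i}"
  have "\<exists>\<beta>. \<beta> \<in> B \<and> (\<forall>i. ?l \<beta> i \<le> ?l \<alpha> i)" if "\<alpha> \<in> L" for \<alpha>
    using that by (auto simp: L_def)
  then obtain b where b: "\<And>\<alpha>. \<alpha> \<in> L \<Longrightarrow> b \<alpha> \<in> B" "\<And>\<alpha> i. \<alpha> \<in> L \<Longrightarrow> ?l (b \<alpha>) i \<le> ?l \<alpha> i"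
    by metis
  \<comment> \<open>Subtraction of exponents is truncated; it is exact here because
    \<open>b \<alpha>\<close> divides \<open>\<alpha>\<close>.\<close>
  have split: "(\<alpha> - b \<alpha>) + b \<alpha> = \<alpha>" if "\<alpha> \<in> L" for \<alpha>
    using b(2)[OF that] by (intro poly_mapping_eqI) (simp add: lookup_add lookup_minus)
  have diff_D: "\<alpha> - b \<alpha> \<in> D" if "\<alpha> \<in> L" for \<alpha>
    using that by (auto simp: L_def D_def in_keys_iff lookup_minus subset_iff)
  define e where "e \<alpha> = (if \<alpha> \<in> L then xpow (\<alpha> - b \<alpha>) * t (b \<alpha>) else xpow \<alpha>)" for \<alpha>
  have keys_e: "\<exists>\<gamma>\<in>?k (t (b \<alpha>)). \<beta> = (\<alpha> - b \<alpha>) + \<gamma>" if "\<alpha> \<in> L" "\<beta> \<in> ?k (e \<alpha>)" for \<alpha> \<beta>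
    using that keys_mult[of "xpow (\<alpha> - b \<alpha>)" "t (b \<alpha>)"] by (auto simp: e_def)
  have e_D: "?k (e \<alpha>) \<subseteq> D" if "\<alpha> \<in> D" for \<alpha>
  proof (cases "\<alpha> \<in> L")
    case True
    then show ?thesis using keys_e[OF True] t_D[OF b(1)[OF True]] diff_D[OF True] D_add by blast
  qed (simp add: e_def that)
  have L0: "0 \<notin> L"
  proof
    assume "0 \<in> L"
    then obtain \<beta> where "\<beta> \<in> B" "\<forall>i. ?l \<beta> i \<le> 0" by (auto simp: L_def)
    then have "\<beta> = 0" by (intro poly_mapping_eqI) auto
    then show False using \<open>\<beta> \<in> B\<close> B(1) \<open>0 \<notin> L0\<close> by auto
  qed
  have drop: "wt \<beta> \<le> wt \<alpha> - \<delta>" if *: "\<alpha> \<in> L" "\<beta> \<in> ?k (e \<alpha>)" for \<alpha> \<beta>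
  proof -
    obtain \<gamma> where \<gamma>: "\<gamma> \<in> ?k (t (b \<alpha>))" "\<beta> = (\<alpha> - b \<alpha>) + \<gamma>" using keys_e[OF *] by blast
    have "wt (\<alpha> - b \<alpha>) + wt (b \<alpha>) = wt \<alpha>" using split[OF that(1)] by (metis wt_add)
    then show ?thesis using \<delta>_le[OF b(1)[OF that(1)] \<gamma>(1)] \<gamma>(2) by (simp add: wt_add)
  qed
  have S_e: "S (xpow \<alpha> - e \<alpha>) = 0" for \<alpha>
  proof (cases "\<alpha> \<in> L")
    case True
    have "xpow \<alpha> = xpow (\<alpha> - b \<alpha>) * xpow (b \<alpha>)" using split[OF True] by (simp add: mult_single)
    then have "xpow \<alpha> - e \<alpha> = xpow (\<alpha> - b \<alpha>) * g (b \<alpha>)"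
      using True by (simp add: e_def t_def algebra_simps)
    then show ?thesis using g(1)[OF b(1)[OF True]] by (simp add: S_mult I_def)
  qed (simp add: e_def S_0)
  have I_lin: "lin e p \<in> I" if "p \<in> I" for p
  proof -
    have pD: "?k p \<subseteq> D" "S p = 0" using that by (auto simp: I_def)
    have "p - lin e p = (\<Sum>\<alpha>\<in>?k p. const (?l p \<alpha>) * (xpow \<alpha> - e \<alpha>))"
      by (subst (1) lin_monom[symmetric]) (simp add: lin_def right_diff_distrib sum_subtractf)
    then have "S (p - lin e p) \<le> (\<Sum>\<alpha>\<in>?k p. S (const (?l p \<alpha>) * (xpow \<alpha> - e \<alpha>)))"
      by (simp only: cpoly.mult_over_sum[OF S])
    also have "\<dots> = 0" by (simp add: S_mult S_e)
    finally have "S (lin e p) = 0"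
      using S_diff[of p "p - lin e p"] pD(2) S_eq0[of "lin e p"] by simp
    moreover have "?k (lin e p) \<subseteq> D" using keys_lin[of e p] e_D pD(1) by blast
    ultimately show ?thesis by (simp add: I_def)
  qed
  \<comment> \<open>Chosen so that \<open>C \<le> R powr \<delta>\<close> for
    \<open>R0 \<le> R\<close>: the drop in weight then pays for the coefficients of a tail.\<close>
  define R0 where "R0 = max 1 (C powr (1 / \<delta>))"

  \<comment> \<open>The quotient norm modulo the kernel and its character\<close>
  have main: "\<exists>\<phi>. cpoly.character \<phi> \<and> (\<forall>p. S p = 0 \<longrightarrow> \<phi> p = 0) \<and>
      (\<forall>i<n. cmod (\<phi> (xvar i)) \<le> R powr w i)" if R: "R0 \<le> R" for R
  proof -
    have R1: "1 \<le> R" "C powr (1 / \<delta>) \<le> R" using R by (auto simp: R0_def)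
    have "C = (C powr (1 / \<delta>)) powr \<delta>" using \<open>0 < \<delta>\<close> \<open>0 \<le> C\<close> by (simp add: powr_powr)
    also have "\<dots> \<le> R powr \<delta>" using R1 \<open>0 < \<delta>\<close> by (intro powr_mono2) auto
    finally have CR: "C \<le> R powr \<delta>" .
    interpret W: monomial_weight "\<lambda>\<alpha>. R powr wt \<alpha>"
      using R1 by unfold_locales (auto simp: wt_add powr_add)
    have nrm_t: "W.nrm (t \<beta>) \<le> R powr wt \<beta>" if "\<beta> \<in> B" for \<beta>
    proof -
      have "W.nrm (t \<beta>) \<le> (\<Sum>\<gamma>\<in>?k (t \<beta>). cmod (?l (t \<beta>) \<gamma>) * R powr (wt \<beta> - \<delta>))"
        unfolding W.nrm_def using \<delta>_le[OF that] R1 by (intro sum_mono mult_left_mono powr_mono) auto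
      also have "\<dots> = (\<Sum>\<gamma>\<in>?k (t \<beta>). cmod (?l (t \<beta>) \<gamma>)) * R powr (wt \<beta> - \<delta>)"
        by (simp add: sum_distrib_right)
      also have "\<dots> \<le> R powr \<delta> * R powr (wt \<beta> - \<delta>)"
        using C_ge[OF that] CR by (intro mult_right_mono) auto
      also have "\<dots> = R powr wt \<beta>" by (simp flip: powr_add)
      finally show ?thesis .
    qed
    have nrm_e: "W.nrm (e \<alpha>) \<le> R powr wt \<alpha>" for \<alpha>
    proof (cases "\<alpha> \<in> L")
      case True
      have "W.nrm (e \<alpha>) \<le> W.nrm (xpow (\<alpha> - b \<alpha>)) * W.nrm (t (b \<alpha>))"
        using True W.nrm_mult by (simp add: e_def)
      also have "\<dots> \<le> R powr wt (\<alpha> - b \<alpha>) * R powr wt (b \<alpha>)"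
        using nrm_t[OF b(1)[OF True]] by (simp add: W.nrm_single mult_left_mono)
      also have "\<dots> = R powr wt \<alpha>" using split[OF True] by (metis W.W_add)
      finally show ?thesis .
    qed (simp add: e_def W.nrm_single)
    have I_one: "1 \<le> W.nrm (1 - p)" if "p \<in> I" for p
    proof (rule W.one_le_nrm_one_minus[where \<delta> = \<delta> and wt = wt and e = e and D = D and L = L and I = I])
      fix q assume q: "q \<in> I" "q \<noteq> 0"
      then obtain \<alpha> where \<alpha>: "is_lead q \<alpha>" using ex_lead by (auto simp: I_def)
      then have "\<alpha> \<in> L0" using q(1) by (auto simp: L0_def)
      then have "\<alpha> \<in> L" using B(3) L0D by (auto simp: L_def)
      moreover have "\<alpha> \<in> ?k q" using \<alpha> by (simp add: is_lead_def)
      moreover have "wt \<beta> \<le> wt \<alpha>" if "\<beta> \<in> ?k q" for \<beta>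
        using \<alpha> that by (cases "\<beta> = \<alpha>") (auto simp: is_lead_def intro: less_imp_le)
      ultimately show "\<exists>\<alpha>\<in>L \<inter> ?k q. \<forall>\<beta>\<in>?k q. wt \<beta> \<le> wt \<alpha>" by blast
    qed (use \<open>0 < \<delta>\<close> wt_0 nrm_e e_D D0 L0 drop I_lin that in \<open>auto simp: e_def[of \<alpha> for \<alpha>] I_def\<close>)
    \<comment> \<open>The infimum of \<open>V p\<close> is the quotient norm of \<open>p\<close>
      modulo the kernel of \<open>S\<close>; \<open>I_one\<close> says that 1 keeps norm 1.\<close>
    define V where "V p = W.nrm ` {q. ?k q \<subseteq> D \<and> S (p - q) = 0}" for p
    have VI: "W.nrm q \<in> V p" if "?k q \<subseteq> D" "S (p - q) = 0" for p q
      using that by (auto simp: V_def)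
    have "cpoly.submult (\<lambda>p. Inf (V p))"
    proof (rule cpoly.submult_Inf)
      show "V p \<noteq> {}" for p using reach[of p] by (auto simp: V_def D_def)
      show "u \<in> V p \<Longrightarrow> 0 \<le> u" for u p using W.nrm_nonneg by (auto simp: V_def)
      show "1 \<le> u" if "u \<in> V 1" for u
      proof -
        obtain q where q: "u = W.nrm q" "?k q \<subseteq> D" "S (1 - q) = 0" using \<open>u \<in> V 1\<close> by (auto simp: V_def)
        have "1 - q \<in> I" using q keys_diff[of 1 q] D0 by (auto simp: I_def)
        then show ?thesis using I_one[of "1 - q"] q(1) by simp
      qed
      show "\<exists>u\<in>V (const c). u \<le> cmod c" for c
        using D0 by (intro bexI[of _ "W.nrm (const c)"] VI) (auto simp: W.nrm_single wt_0 S_0)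
      fix p q u x assume "u \<in> V p" "x \<in> V q"
      then obtain p' q' where p': "u = W.nrm p'" "?k p' \<subseteq> D" "S (p - p') = 0"
        and q': "x = W.nrm q'" "?k q' \<subseteq> D" "S (q - q') = 0" by (auto simp: V_def)
      have "S ((p + q) - (p' + q')) \<le> S (p - p') + S (q - q')"
        using S_add[of "p - p'" "q - q'"] by (simp add: algebra_simps)
      moreover have "?k (p' + q') \<subseteq> D"
        using Poly_Mapping.keys_add[of p' q'] p'(2) q'(2) by blast
      ultimately have "W.nrm (p' + q') \<in> V (p + q)"
        using p' q' S_eq0 by (intro VI) auto
      then show "\<exists>y\<in>V (p + q). y \<le> u + x" using W.nrm_add p'(1) q'(1) by blast
      have "p * q - p' * q' = (p - p') * q + p' * (q - q')" by (simp add: algebra_simps)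
      then have "S (p * q - p' * q') \<le> S ((p - p') * q) + S (p' * (q - q'))"
        using S_add by metis
      moreover have "?k (p' * q') \<subseteq> D"
        using keys_mult[of p' q'] p'(2) q'(2) D_add by blast
      ultimately have "W.nrm (p' * q') \<in> V (p * q)"
        using p' q' S_eq0 by (intro VI) (auto simp: S_mult)
      then show "\<exists>y\<in>V (p * q). y \<le> u * x" using W.nrm_mult p'(1) q'(1) by blast
    qed
    then obtain \<phi> where \<phi>: "cpoly.character \<phi>" "\<And>p. cmod (\<phi> p) \<le> Inf (V p)"
      by (rule cpoly.exists_character) blast
    have low: "cmod (\<phi> p) \<le> W.nrm q" if "?k q \<subseteq> D" "S (p - q) = 0" for p q
      using VI[OF that] \<phi>(2)[of p] W.nrm_nonneg
      by (intro order_trans[OF \<phi>(2)] cInf_lower bdd_belowI[of _ 0]) (auto simp: V_def)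
    have wt_var: "wt (Poly_Mapping.single i 1) = w' i" if "i < n" for i
    proof -
      have "wt (Poly_Mapping.single i 1) = (\<Sum>j<n. if j = i then w' j else 0)"
        unfolding wt_def by (intro sum.cong) (auto simp: lookup_single when_def)
      then show ?thesis using that by simp
    qed
    have "cmod (\<phi> (xvar i)) \<le> R powr w i" if "i < n" for i
    proof -
      have "Poly_Mapping.single i 1 \<in> D" using that by (simp add: D_def)
      then have "cmod (\<phi> (xvar i)) \<le> W.nrm (xvar i)" by (intro low) (auto simp: S_0)
      also have "\<dots> = R powr w' i" using wt_var[OF that] by (simp only: W.nrm_single) simp
      also have "\<dots> \<le> R powr w i" using R1 w'(2)[OF that] by (intro powr_mono) auto
      finally show ?thesis .
    qed
    \<comment> \<open>Such a \<open>p\<close> has the representative 0.\<close>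
    moreover have "\<phi> p = 0" if "S p = 0" for p
      using low[of 0 p] that by (simp add: W.nrm_0)
    ultimately show ?thesis using \<phi>(1) by blast
  qed
  show ?thesis by (rule that[of R0]) (use main in \<open>auto simp: R0_def\<close>)
qed

section \<open>Presentations of seminormed algebras\<close>

text \<open>After division by \<open>a + b\<close> both terms lie in the unit interval, where
  raising to the power \<open>r \<le> 1\<close> does not decrease a number.\<close>

lemma powr_subadditive:
  fixes a b r :: real
  assumes "0 \<le> a" "0 \<le> b" "0 < r" "r \<le> 1"
  shows "(a + b) powr r \<le> a powr r + b powr r"
proof (cases "a + b = 0")
  case False
  then have s: "0 < a + b" using assms by simp
  have "a / (a + b) \<le> (a / (a + b)) powr r" "b / (a + b) \<le> (b / (a + b)) powr r"
    using powr_mono'[of r 1 "a / (a + b)"] powr_mono'[of r 1 "b / (a + b)"] assms s by auto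
  moreover have "a / (a + b) + b / (a + b) = 1" using s by (simp flip: add_divide_distrib)
  ultimately have "1 \<le> a powr r / (a + b) powr r + b powr r / (a + b) powr r"
    using assms s by (simp add: powr_divide)
  then show ?thesis using s by (simp add: le_divide_eq flip: add_divide_distrib)
qed (use assms in simp)

locale record_algebra = cring R for R (structure) +
  fixes sc :: "complex \<Rightarrow> 'a"
  assumes sc_closed [simp]: "sc c \<in> carrier R"
    and sc_add: "sc (c + d) = sc c \<oplus> sc d"
    and sc_mult: "sc (c * d) = sc c \<otimes> sc d"
    and sc_one [simp]: "sc 1 = \<one>"
begin

lemma sc_zero [simp]: "sc 0 = \<zero>"
  using sc_add[of 0 0] by (metis add.r_cancel_one' add.right_neutral sc_closed)

definition lift :: "(mono \<Rightarrow> 'a) \<Rightarrow> cpoly \<Rightarrow> 'a" where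
  "lift m p = (\<Oplus>\<alpha>\<in>Poly_Mapping.keys p. sc (Poly_Mapping.lookup p \<alpha>) \<otimes> m \<alpha>)"

context
  fixes m :: "mono \<Rightarrow> 'a"
  assumes m [simp]: "\<And>\<alpha>. m \<alpha> \<in> carrier R"
begin

lemma lift_closed [simp]: "lift m p \<in> carrier R"
  by (simp add: lift_def Pi_def)

lemma lift_superset:
  assumes "finite A" "Poly_Mapping.keys p \<subseteq> A"
  shows "lift m p = (\<Oplus>\<alpha>\<in>A. sc (Poly_Mapping.lookup p \<alpha>) \<otimes> m \<alpha>)"
  unfolding lift_def using assms
  by (intro add.finprod_mono_neutral_cong_left) (auto simp: not_in_keys_iff_lookup_eq_zero)

lemma lift_single: "lift m (Poly_Mapping.single \<alpha> c) = sc c \<otimes> m \<alpha>"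
  by (simp add: lift_superset[of "{\<alpha>}"])

lemma lift_add: "lift m (p + q) = lift m p \<oplus> lift m q"
proof -
  let ?A = "Poly_Mapping.keys p \<union> Poly_Mapping.keys q"
  have "lift m (p + q) = (\<Oplus>\<alpha>\<in>?A. sc (Poly_Mapping.lookup (p + q) \<alpha>) \<otimes> m \<alpha>)"
    by (rule lift_superset) (auto dest: subsetD[OF Poly_Mapping.keys_add])
  also have "\<dots> = (\<Oplus>\<alpha>\<in>?A. sc (Poly_Mapping.lookup p \<alpha>) \<otimes> m \<alpha> \<oplus> sc (Poly_Mapping.lookup q \<alpha>) \<otimes> m \<alpha>)"
    by (intro finsum_cong') (auto simp: lookup_add sc_add l_distr)
  also have "\<dots> = lift m p \<oplus> lift m q"
    by (simp add: lift_superset[of ?A p] lift_superset[of ?A q] finsum_addf Pi_def)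
  finally show ?thesis .
qed

lemma lift_zero [simp]: "lift m 0 = \<zero>"
  by (simp add: lift_def)

lemma lift_diff: "lift m (p - q) = lift m p \<ominus> lift m q"
proof -
  have "lift m p = lift m (p - q) \<oplus> lift m q" using lift_add[of "p - q" q] by simp
  then show ?thesis by (simp add: a_minus_def a_assoc r_neg)
qed

lemma lift_sum: "finite A \<Longrightarrow> lift m (sum h A) = (\<Oplus>i\<in>A. lift m (h i))"
  by (induction A rule: finite_induct) (simp_all add: lift_add Pi_def)

end

text \<open>Three value functions are needed because cleared denominators add up: powers
  \<open>N\<close> and \<open>M\<close> of \<open>g\<close> multiply to \<open>N + M\<close>. The
  identity \<open>eq\<close> is asked on occurring monomials only, as truncated subtraction spoils
  it elsewhere.\<close>

lemma lift_mult:
  assumes m: "\<And>\<alpha>. m1 \<alpha> \<in> carrier R" "\<And>\<alpha>. m2 \<alpha> \<in> carrier R" "\<And>\<alpha>. m3 \<alpha> \<in> carrier R"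
    and eq: "\<And>\<alpha> \<beta>. \<alpha> \<in> Poly_Mapping.keys p \<Longrightarrow> \<beta> \<in> Poly_Mapping.keys q \<Longrightarrow>
      m1 \<alpha> \<otimes> m2 \<beta> = m3 (\<alpha> + \<beta>)"
  shows "lift m1 p \<otimes> lift m2 q = lift m3 (p * q)"
proof -
  let ?l = Poly_Mapping.lookup and ?s = Poly_Mapping.single and ?k = Poly_Mapping.keys
  note [simp] = m
  have "p * q = (\<Sum>\<alpha>\<in>?k p. ?s \<alpha> (?l p \<alpha>)) * (\<Sum>\<beta>\<in>?k q. ?s \<beta> (?l q \<beta>))"
    by (simp flip: poly_mapping_sum_singles)
  also have "\<dots> = (\<Sum>\<alpha>\<in>?k p. \<Sum>\<beta>\<in>?k q. ?s (\<alpha> + \<beta>) (?l p \<alpha> * ?l q \<beta>))"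
    by (simp add: sum_product mult_single)
  also have "lift m3 \<dots> = (\<Oplus>\<alpha>\<in>?k p. \<Oplus>\<beta>\<in>?k q. sc (?l p \<alpha> * ?l q \<beta>) \<otimes> m3 (\<alpha> + \<beta>))"
    by (simp add: lift_sum lift_single)
  also have "\<dots> = (\<Oplus>\<alpha>\<in>?k p. \<Oplus>\<beta>\<in>?k q. (sc (?l p \<alpha>) \<otimes> m1 \<alpha>) \<otimes> (sc (?l q \<beta>) \<otimes> m2 \<beta>))"
    by (intro finsum_cong' refl finsum_closed funcsetI) (auto simp: sc_mult m_ac simp flip: eq)
  also have "\<dots> = (\<Oplus>\<alpha>\<in>?k p. (sc (?l p \<alpha>) \<otimes> m1 \<alpha>) \<otimes> lift m2 q)"
    by (intro finsum_cong' refl) (auto simp: lift_def finsum_rdistr Pi_def)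
  also have "\<dots> = lift m1 p \<otimes> lift m2 q"
    by (subst (2) lift_def) (simp add: finsum_ldistr Pi_def)
  finally show ?thesis by simp
qed

primrec monomial :: "(nat \<Rightarrow> 'a) \<Rightarrow> nat \<Rightarrow> mono \<Rightarrow> 'a" where
  "monomial f 0 \<alpha> = \<one>"
| "monomial f (Suc k) \<alpha> = monomial f k \<alpha> \<otimes> f k [^] Poly_Mapping.lookup \<alpha> k"

context
  fixes f :: "nat \<Rightarrow> 'a" and n :: nat
  assumes f: "\<And>i. i < n \<Longrightarrow> f i \<in> carrier R"
begin

lemma monomial_closed: "k \<le> n \<Longrightarrow> monomial f k \<alpha> \<in> carrier R"
  by (induction k) (use f in auto)

lemma monomial_add: "k \<le> n \<Longrightarrow> monomial f k (\<alpha> + \<beta>) = monomial f k \<alpha> \<otimes> monomial f k \<beta>"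
proof (induction k)
  case (Suc k)
  then have "f k \<in> carrier R" using f by simp
  then show ?case
    using Suc monomial_closed[of k] by (simp add: lookup_add nat_pow_mult[symmetric] m_ac)
qed simp

lemma monomial_eq_one: "k \<le> n \<Longrightarrow> (\<And>i. i < k \<Longrightarrow> Poly_Mapping.lookup \<alpha> i = 0) \<Longrightarrow> monomial f k \<alpha> = \<one>"
  by (induction k) auto

lemma monomial_var:
  assumes "i < k" "k \<le> n"
  shows "monomial f k (Poly_Mapping.single i 1) = f i"
  using assms
proof (induction k)
  case (Suc k)
  show ?case
  proof (cases "i = k")
    case True
    then have "monomial f k (Poly_Mapping.single i 1) = \<one>"
      using Suc.prems by (intro monomial_eq_one) (auto simp: lookup_single when_def)
    then show ?thesis using True f Suc.prems by simp
  next
    case False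
    then show ?thesis using Suc f[of i] by (simp add: lookup_single when_def)
  qed
qed simp

lemma monomial_cong:
  "(\<And>i. i < k \<Longrightarrow> Poly_Mapping.lookup \<alpha> i = Poly_Mapping.lookup \<beta> i) \<Longrightarrow> monomial f k \<alpha> = monomial f k \<beta>"
  by (induction k) auto

lemma monomial_hom:
  fixes h :: "'a \<Rightarrow> 'c::comm_monoid_mult"
  assumes "h \<one> = 1" "\<And>a b. a \<in> carrier R \<Longrightarrow> b \<in> carrier R \<Longrightarrow> h (a \<otimes> b) = h a * h b"
  shows "k \<le> n \<Longrightarrow> h (monomial f k \<alpha>) = (\<Prod>i<k. h (f i) ^ Poly_Mapping.lookup \<alpha> i)"
proof (induction k)
  case (Suc k)
  have "h (a [^] j) = h a ^ j" if "a \<in> carrier R" for a and j :: nat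
    by (induction j) (simp_all add: assms that mult.commute)
  then show ?case
    using Suc f[of k] monomial_closed[of k] by (simp add: assms(2))
qed (simp add: assms)

end

end

text \<open>
  \<open>pres\<close> sends the variables below \<open>n\<close> to \<open>f\<close> and the variable \<open>n\<close> to the inverse of \<open>g\<close>; it is
  multiplied by \<open>g ^ N\<close> to clear denominators, as long as no exponent of the variable \<open>n\<close> exceeds \<open>N\<close>.
\<close>

locale seminormed_presentation = record_algebra R sc for R (structure) and sc +
  fixes s :: "'a \<Rightarrow> real" and \<rho> :: real and f :: "nat \<Rightarrow> 'a" and n :: nat and g :: 'a
  assumes s: "mult_seminorm R s" and s_sc: "s (sc c) = cmod c powr \<rho>"
    and f: "\<And>i. i < n \<Longrightarrow> f i \<in> carrier R"
    and gen: "generate_ring R (range sc \<union> f ` {..<n}) = carrier R"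
    and g: "g \<in> carrier R" and sg: "s g \<noteq> 0"
begin

lemma s_nonneg: "a \<in> carrier R \<Longrightarrow> 0 \<le> s a"
  and s_zero: "s \<zero> = 0" and s_one: "s \<one> = 1"
  and s_add: "a \<in> carrier R \<Longrightarrow> b \<in> carrier R \<Longrightarrow> s (a \<oplus> b) \<le> s a + s b"
  and s_mult: "a \<in> carrier R \<Longrightarrow> b \<in> carrier R \<Longrightarrow> s (a \<otimes> b) = s a * s b"
  using s by (auto simp: mult_seminorm_def)

lemma s_pow: "a \<in> carrier R \<Longrightarrow> s (a [^] (k::nat)) = s a ^ k"
  by (induction k) (simp_all add: s_one s_mult mult.commute)

lemma s_g_pos: "0 < s g"
  using sg s_nonneg[OF g] by simp

lemma mono_closed: "monomial f n \<alpha> \<in> carrier R"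
  by (rule monomial_closed[of n f n]) (use f in auto)

lemma mono_add: "monomial f n (\<alpha> + \<beta>) = monomial f n \<alpha> \<otimes> monomial f n \<beta>"
  by (rule monomial_add[of n f n]) (use f in auto)

lemma mono_one: "(\<And>i. i < n \<Longrightarrow> Poly_Mapping.lookup \<alpha> i = 0) \<Longrightarrow> monomial f n \<alpha> = \<one>"
  by (rule monomial_eq_one[of n f n]) (use f in auto)

lemma mono_var: "i < n \<Longrightarrow> monomial f n (Poly_Mapping.single i 1) = f i"
  by (rule monomial_var[of n f i n]) (use f in auto)

lemma mono_cong:
  "(\<And>i. i < n \<Longrightarrow> Poly_Mapping.lookup \<alpha> i = Poly_Mapping.lookup \<beta> i) \<Longrightarrow> monomial f n \<alpha> = monomial f n \<beta>"
  by (rule monomial_cong[of n f n]) (use f in auto)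

lemma mono_hom:
  fixes h :: "'a \<Rightarrow> 'c::comm_monoid_mult"
  assumes "h \<one> = 1" "\<And>a b. a \<in> carrier R \<Longrightarrow> b \<in> carrier R \<Longrightarrow> h (a \<otimes> b) = h a * h b"
  shows "h (monomial f n \<alpha>) = (\<Prod>i<n. h (f i) ^ Poly_Mapping.lookup \<alpha> i)"
  by (rule monomial_hom[of n f h n]) (use f assms in auto)

definition pm :: "nat \<Rightarrow> mono \<Rightarrow> 'a" where
  "pm N \<alpha> = monomial f n \<alpha> \<otimes> g [^] (N - Poly_Mapping.lookup \<alpha> n)"

definition pres :: "nat \<Rightarrow> cpoly \<Rightarrow> 'a" where
  "pres N = lift (pm N)"

definition ydeg :: "cpoly \<Rightarrow> nat" where
  "ydeg p = Max (insert 0 ((\<lambda>\<alpha>. Poly_Mapping.lookup \<alpha> n) ` Poly_Mapping.keys p))"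

text \<open>The pullback to polynomials of the extension of \<open>s\<close> to the localization of
  \<open>R\<close> at \<open>g\<close>, without constructing the localization.\<close>

definition S :: "cpoly \<Rightarrow> real" where
  "S p = s (pres (ydeg p) p) / s g ^ ydeg p"

lemma pm_closed [simp]: "pm N \<alpha> \<in> carrier R"
  using mono_closed g by (simp add: pm_def)

lemma pres_closed [simp]: "pres N p \<in> carrier R"
  by (simp add: pres_def)

lemma lookup_le_ydeg: "\<alpha> \<in> Poly_Mapping.keys p \<Longrightarrow> Poly_Mapping.lookup \<alpha> n \<le> ydeg p"
  by (simp add: ydeg_def)

lemma ydeg_le: "(\<And>\<alpha>. \<alpha> \<in> Poly_Mapping.keys p \<Longrightarrow> Poly_Mapping.lookup \<alpha> n \<le> N) \<Longrightarrow> ydeg p \<le> N"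
  by (simp add: ydeg_def)

lemma pm_add:
  assumes "Poly_Mapping.lookup \<alpha> n \<le> N" "Poly_Mapping.lookup \<beta> n \<le> M"
  shows "pm N \<alpha> \<otimes> pm M \<beta> = pm (N + M) (\<alpha> + \<beta>)"
proof -
  have "N + M - Poly_Mapping.lookup (\<alpha> + \<beta>) n
      = (N - Poly_Mapping.lookup \<alpha> n) + (M - Poly_Mapping.lookup \<beta> n)"
    using assms by (simp add: lookup_add)
  then show ?thesis
    using mono_closed g mono_add[of \<alpha> \<beta>]
    by (simp add: pm_def nat_pow_mult[symmetric] m_ac)
qed

lemma pres_mult:
  assumes "ydeg p \<le> N" "ydeg q \<le> M"
  shows "pres N p \<otimes> pres M q = pres (N + M) (p * q)"
  unfolding pres_def using assms lookup_le_ydeg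
  by (intro lift_mult pm_closed pm_add) (meson order_trans)+

lemma pres_one: "pres N 1 = g [^] N"
proof -
  have "pres N (Poly_Mapping.single 0 1) = sc 1 \<otimes> pm N 0"
    unfolding pres_def by (rule lift_single) simp
  then show ?thesis using g mono_one[of 0] by (simp add: pm_def)
qed

text \<open>Clearing more denominators than necessary multiplies the numerator by a power of
  \<open>g\<close>, that is, by \<open>pres (N - ydeg p) 1\<close>.\<close>

lemma S_eq:
  assumes "ydeg p \<le> N"
  shows "S p = s (pres N p) / s g ^ N"
proof -
  have "pres (ydeg p) p \<otimes> pres (N - ydeg p) 1 = pres (ydeg p + (N - ydeg p)) (p * 1)"
    by (rule pres_mult) (auto simp: ydeg_def)
  then have "pres N p = pres (ydeg p) p \<otimes> g [^] (N - ydeg p)" using assms by (simp add: pres_one)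
  then have "s (pres N p) = s (pres (ydeg p) p) * s g ^ (N - ydeg p)"
    using g by (simp add: s_mult s_pow)
  moreover have "s g ^ N = s g ^ ydeg p * s g ^ (N - ydeg p)" using assms by (simp flip: power_add)
  ultimately show ?thesis using sg by (simp add: S_def)
qed

lemma ydeg_mult: "ydeg (p * q) \<le> ydeg p + ydeg q"
proof (rule ydeg_le)
  fix \<alpha> assume "\<alpha> \<in> Poly_Mapping.keys (p * q)"
  then obtain a b where "\<alpha> = a + b" "a \<in> Poly_Mapping.keys p" "b \<in> Poly_Mapping.keys q"
    using keys_mult[of p q] by auto
  then show "Poly_Mapping.lookup \<alpha> n \<le> ydeg p + ydeg q"
    by (simp add: lookup_add add_mono lookup_le_ydeg)
qed

lemma mult_over_S: "cpoly.mult_over \<rho> S"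
  unfolding cpoly.mult_over_def
proof (intro conjI allI)
  fix p q :: cpoly and c
  show "0 \<le> S p" using s_nonneg s_g_pos by (simp add: S_def)
  define N where "N = max (ydeg p) (max (ydeg q) (ydeg (p + q)))"
  have "s (pres N (p + q)) \<le> s (pres N p) + s (pres N q)"
    unfolding pres_def by (simp add: lift_add s_add)
  then have "s (pres N (p + q)) / s g ^ N \<le> s (pres N p) / s g ^ N + s (pres N q) / s g ^ N"
    using s_g_pos by (simp add: divide_right_mono flip: add_divide_distrib)
  moreover have "ydeg p \<le> N" "ydeg q \<le> N" "ydeg (p + q) \<le> N" by (auto simp: N_def)
  ultimately show "S (p + q) \<le> S p + S q" by (simp add: S_eq)
  have "S (p * q) = s (pres (ydeg p + ydeg q) (p * q)) / s g ^ (ydeg p + ydeg q)"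
    by (rule S_eq[OF ydeg_mult])
  also have "\<dots> = S p * S q"
    by (simp add: S_def s_mult power_add flip: pres_mult)
  finally show "S (p * q) = S p * S q" .
  have "ydeg (const c) \<le> 0" by (rule ydeg_le) (auto split: if_splits)
  then have "S (const c) = s (pres 0 (const c)) / s g ^ 0" by (rule S_eq)
  also have "pres 0 (const c) = sc c"
    using mono_one[of 0] by (simp add: pres_def lift_single) (simp add: pm_def)
  finally show "S (const c) = cmod c powr \<rho>" by (simp add: s_sc)
qed

lemma S_monom:
  "S (xpow \<alpha>) = (\<Prod>i<Suc n. (if i < n then s (f i) else inverse (s g)) ^ Poly_Mapping.lookup \<alpha> i)"
proof -
  have "ydeg (xpow \<alpha>) \<le> Poly_Mapping.lookup \<alpha> n" by (rule ydeg_le) simp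
  then have "S (xpow \<alpha>) = s (pres (Poly_Mapping.lookup \<alpha> n) (xpow \<alpha>)) / s g ^ Poly_Mapping.lookup \<alpha> n"
    by (rule S_eq)
  also have "pres (Poly_Mapping.lookup \<alpha> n) (xpow \<alpha>) = monomial f n \<alpha>"
    using mono_closed by (simp add: pres_def lift_single) (simp add: pm_def)
  also have "s (monomial f n \<alpha>) = (\<Prod>i<n. s (f i) ^ Poly_Mapping.lookup \<alpha> i)"
    using mono_hom[of s \<alpha>] s_one s_mult by simp
  finally show ?thesis by (simp add: power_inverse divide_inverse)
qed

text \<open>\<open>pm\<close> ignores the variables above \<open>n\<close>, in effect setting them
  to 1; \<open>q\<close> is \<open>p\<close> with those variables deleted.\<close>

lemma reach_small:
  "\<exists>q. (\<forall>\<alpha>\<in>Poly_Mapping.keys q. Poly_Mapping.keys \<alpha> \<subseteq> {..<Suc n}) \<and> S (p - q) = 0"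
proof -
  let ?l = Poly_Mapping.lookup and ?k = Poly_Mapping.keys
  define r :: "mono \<Rightarrow> mono" where "r \<alpha> = (\<Sum>i<Suc n. Poly_Mapping.single i (?l \<alpha> i))" for \<alpha>
  have r: "?l (r \<alpha>) i = (if i < Suc n then ?l \<alpha> i else 0)" for \<alpha> i
    by (auto simp: r_def lookup_sum lookup_single when_def simp del: sum.lessThan_Suc)
  have kr: "?k (r \<alpha>) \<subseteq> {..<Suc n}" for \<alpha>
    by (auto simp: in_keys_iff r split: if_splits)
  define q where "q = (\<Sum>\<alpha>\<in>?k p. Poly_Mapping.single (r \<alpha>) (?l p \<alpha>))"
  have "?k q \<subseteq> r ` ?k p"
    unfolding q_def by (rule order_trans[OF keys_sum]) (auto split: if_splits)
  then have "\<forall>\<alpha>\<in>?k q. ?k \<alpha> \<subseteq> {..<Suc n}" using kr by blast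
  moreover have "S (p - q) = 0"
  proof -
    define N where "N = ydeg (p - q)"
    have "pm N (r \<alpha>) = pm N \<alpha>" for \<alpha>
      using mono_cong[of "r \<alpha>" \<alpha>] by (simp add: pm_def r)
    then have "pres N q = pres N p"
      unfolding q_def pres_def by (simp add: lift_sum lift_single) (simp add: lift_def)
    then have "pres N (p - q) = \<zero>"
      using pres_closed[of N p] unfolding pres_def by (simp add: lift_diff a_minus_def r_neg)
    then show ?thesis by (simp add: S_def s_zero flip: N_def)
  qed
  ultimately show ?thesis by blast
qed

text \<open>Polynomials without the variable \<open>n\<close> that stands for the inverse of
  \<open>g\<close>. On them \<open>pres 0\<close> is a genuine ring homomorphism, and it is onto
  \<open>R\<close>.\<close>

definition small :: "cpoly set" where
  "small = {p. \<forall>\<alpha>\<in>Poly_Mapping.keys p. Poly_Mapping.lookup \<alpha> n = 0}"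

lemma ydeg_small: "p \<in> small \<Longrightarrow> ydeg p \<le> N"
  by (rule ydeg_le) (simp add: small_def)

lemma small_diff: "p \<in> small \<Longrightarrow> q \<in> small \<Longrightarrow> p - q \<in> small"
  using keys_diff[of p q] by (auto simp: small_def)

lemma small_add: "p \<in> small \<Longrightarrow> q \<in> small \<Longrightarrow> p + q \<in> small"
  using Poly_Mapping.keys_add[of p q] by (auto simp: small_def)

lemma small_mult: "p \<in> small \<Longrightarrow> q \<in> small \<Longrightarrow> p * q \<in> small"
  using keys_mult[of p q] by (fastforce simp: small_def lookup_add)

lemma pres_const: "pres 0 (const c) = sc c"
  using mono_one[of 0] by (simp add: pres_def lift_single) (simp add: pm_def)

lemma pres_var: "i < n \<Longrightarrow> pres 0 (xvar i) = f i"
  using mono_var[of i] f[of i] by (simp add: pres_def lift_single) (simp add: pm_def)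

lemma pres_small_surj:
  assumes "a \<in> carrier R"
  shows "\<exists>p\<in>small. pres 0 p = a"
proof -
  have "a \<in> generate_ring R (range sc \<union> f ` {..<n})" using assms gen by simp
  then show ?thesis
  proof induction
    case one
    then show ?case using pres_const[of 1] by (intro bexI[of _ "const 1"]) (auto simp: small_def)
  next
    case (incl h)
    then consider c where "h = sc c" | i where "i < n" "h = f i" by auto
    then show ?case
    proof cases
      case 1
      then show ?thesis using pres_const by (intro bexI[of _ "const c" for c]) (auto simp: small_def split: if_splits)
    next
      case 2
      then show ?thesis using pres_var[of i]
        by (intro bexI[of _ "xvar i"]) (auto simp: small_def lookup_single)
    qed
  next
    case (a_inv h)
    then obtain p where "p \<in> small" "pres 0 p = h" by blast
    then show ?case
      using small_diff[of 0 p] lift_diff[of "pm 0" 0 p]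
      by (intro bexI[of _ "0 - p"]) (auto simp: pres_def a_minus_def small_def)
  next
    case (eng_add a b)
    then obtain p q where "p \<in> small" "pres 0 p = a" "q \<in> small" "pres 0 q = b" by blast
    then show ?case by (intro bexI[of _ "p + q"] small_add) (auto simp: pres_def lift_add)
  next
    case (eng_mult a b)
    then obtain p q where "p \<in> small" "pres 0 p = a" "q \<in> small" "pres 0 q = b" by blast
    then show ?case using pres_mult[OF ydeg_small ydeg_small, of p q 0 0]
      by (intro bexI[of _ "p * q"] small_mult) auto
  qed
qed

text \<open>Two preimages in \<open>small\<close> of one element differ by a member of the kernel of
  \<open>S\<close>, so any choice of preimage defines the same \<open>\<psi>\<close>.\<close>

lemma descend_character:
  assumes \<phi>: "cpoly.character \<phi>" and ker: "\<And>p. S p = 0 \<Longrightarrow> \<phi> p = 0"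
  obtains \<psi> where "\<And>a b. a \<in> carrier R \<Longrightarrow> b \<in> carrier R \<Longrightarrow> \<psi> (a \<oplus> b) = \<psi> a + \<psi> b"
    "\<And>a b. a \<in> carrier R \<Longrightarrow> b \<in> carrier R \<Longrightarrow> \<psi> (a \<otimes> b) = \<psi> a * \<psi> b"
    "\<And>c. \<psi> (sc c) = c" "\<And>i. i < n \<Longrightarrow> \<psi> (f i) = \<phi> (xvar i)" "\<phi> (xvar n) * \<psi> g = 1"
    "\<And>p. p \<in> small \<Longrightarrow> \<psi> (pres 0 p) = \<phi> p"
proof -
  have \<phi>_add: "\<phi> (p + q) = \<phi> p + \<phi> q" and \<phi>_mult: "\<phi> (p * q) = \<phi> p * \<phi> q"
    and \<phi>_const: "\<phi> (const c) = c" for p q c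
    using \<phi> by (auto simp: cpoly.character_def)
  have \<phi>_diff: "\<phi> (p - q) = \<phi> p - \<phi> q" for p q
    using \<phi>_add[of "p - q" q] by simp
  define \<psi> where "\<psi> a = \<phi> (SOME p. p \<in> small \<and> pres 0 p = a)" for a
  have \<psi>: "\<psi> (pres 0 p) = \<phi> p" if "p \<in> small" for p
  proof -
    define q where "q = (SOME q. q \<in> small \<and> pres 0 q = pres 0 p)"
    have q: "q \<in> small" "pres 0 q = pres 0 p"
      using someI[of "\<lambda>q. q \<in> small \<and> pres 0 q = pres 0 p" p] that by (auto simp: q_def)
    have "pres 0 (q - p) = \<zero>"
      using q(2) pres_closed[of 0 p] unfolding pres_def by (simp add: lift_diff a_minus_def r_neg)
    then have "S (q - p) = 0"
      using S_eq[OF ydeg_small[OF small_diff[OF q(1) that]], of 0] by (simp add: s_zero)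
    then show ?thesis using ker[of "q - p"] by (simp add: \<phi>_diff \<psi>_def flip: q_def)
  qed
  show ?thesis
  proof (rule that[of \<psi>])
    fix a b assume "a \<in> carrier R" "b \<in> carrier R"
    then obtain p q where pq: "p \<in> small" "pres 0 p = a" "q \<in> small" "pres 0 q = b"
      using pres_small_surj by metis
    have "pres 0 (p + q) = a \<oplus> b" using pq unfolding pres_def by (simp add: lift_add)
    then show "\<psi> (a \<oplus> b) = \<psi> a + \<psi> b"
      using \<psi>[OF small_add[of p q]] \<psi>[of p] \<psi>[of q] pq by (simp add: \<phi>_add)
    have "pres 0 (p * q) = a \<otimes> b"
      using pq pres_mult[OF ydeg_small ydeg_small, of p q 0 0] by simp
    then show "\<psi> (a \<otimes> b) = \<psi> a * \<psi> b"
      using \<psi>[OF small_mult[of p q]] \<psi>[of p] \<psi>[of q] pq by (simp add: \<phi>_mult)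
  next
    show "\<psi> (sc c) = c" for c
      using \<psi>[of "const c"] by (simp add: pres_const \<phi>_const small_def)
    show "\<psi> (f i) = \<phi> (xvar i)" if "i < n" for i
      using \<psi>[of "xvar i"] that pres_var[OF that] by (simp add: small_def lookup_single)
  next
    \<comment> \<open>\<open>xvar n * G - 1\<close> vanishes after one denominator is cleared, so it
      lies in the kernel.\<close>
    obtain G where G: "G \<in> small" "pres 0 G = g" using pres_small_surj[OF g] by blast
    have y1: "ydeg (xvar n) \<le> 1" by (rule ydeg_le) simp
    have "pm 1 (Poly_Mapping.single n 1) = \<one>"
      using mono_one[of "Poly_Mapping.single n 1"]
      by (simp add: pm_def lookup_single when_def)
    then have p1: "pres 1 (xvar n) = \<one>" by (simp add: pres_def lift_single)
    have "pres 1 (xvar n * G) = g"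
      using pres_mult[OF y1 ydeg_small[OF G(1), of 0]] p1 G(2) g by simp
    then have "pres 1 (xvar n * G - 1) = \<zero>"
      using g pres_one[of 1] unfolding pres_def by (simp add: lift_diff a_minus_def r_neg)
    moreover have "ydeg (xvar n * G - 1) \<le> 1"
    proof (rule ydeg_le)
      fix \<alpha> assume "\<alpha> \<in> Poly_Mapping.keys (xvar n * G - 1)"
      then have "\<alpha> \<in> Poly_Mapping.keys (xvar n * G) \<or> \<alpha> = 0"
        using keys_diff[of "xvar n * G" 1] by auto
      then show "Poly_Mapping.lookup \<alpha> n \<le> 1"
        using lookup_le_ydeg[of \<alpha> "xvar n * G"] ydeg_mult[of "xvar n" G] y1 ydeg_small[OF G(1), of 0]
        by auto
    qed
    ultimately have "S (xvar n * G - 1) = 0" using S_eq by (simp add: s_zero)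
    then have "\<phi> (xvar n * G) = \<phi> (const 1)" using ker[of "xvar n * G - 1"] by (simp add: \<phi>_diff)
    then show "\<phi> (xvar n) * \<psi> g = 1" using \<psi>[OF G(1)] G(2) \<phi>_const[of 1] by (simp add: \<phi>_mult)
  qed (rule \<psi>)
qed

end

section \<open>Deformation of seminorms\<close>

context record_algebra begin

lemma character_powr_seminorm:
  assumes add: "\<And>a b. a \<in> carrier R \<Longrightarrow> b \<in> carrier R \<Longrightarrow> \<psi> (a \<oplus> b) = \<psi> a + \<psi> b"
    and mult: "\<And>a b. a \<in> carrier R \<Longrightarrow> b \<in> carrier R \<Longrightarrow> \<psi> (a \<otimes> b) = \<psi> a * \<psi> b"
    and const: "\<And>c. \<psi> (sc c) = c" and r: "0 < r" "r \<le> 1"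
  shows "mult_seminorm R (\<lambda>a\<in>carrier R. cmod (\<psi> a) powr r)"
proof -
  have "\<psi> \<zero> = 0" "\<psi> \<one> = 1" using const[of 0] const[of 1] by simp_all
  moreover have "cmod (x + y) powr r \<le> cmod x powr r + cmod y powr r" for x y
  proof -
    have "cmod (x + y) powr r \<le> (cmod x + cmod y) powr r"
      using r by (intro powr_mono2 norm_triangle_ineq) auto
    also have "\<dots> \<le> cmod x powr r + cmod y powr r" using r by (intro powr_subadditive) auto
    finally show ?thesis .
  qed
  ultimately show ?thesis
    by (auto simp: mult_seminorm_def add mult norm_mult powr_mult)
qed

lemma seminorm_deformation_archimedean:
  assumes gen: "generate_ring R (range sc \<union> F) = carrier R" and F: "finite F" "F \<subseteq> carrier R"
    and s: "mult_seminorm R s" "\<And>c. s (sc c) = cmod c powr \<rho>" and \<rho>: "0 < \<rho>" "\<rho> \<le> 1"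
    and A: "finite A" "A \<subseteq> carrier R" and "0 < \<epsilon>"
  shows "\<exists>d>0. \<forall>r\<in>{0..1}. \<bar>r - \<rho>\<bar> < d \<longrightarrow> (\<exists>s'. mult_seminorm R s' \<and>
    (\<forall>c. s' (sc c) = cmod c powr r) \<and> (\<forall>a\<in>A. \<bar>s' a - s a\<bar> < \<epsilon>))"
proof -
  obtain n and f :: "nat \<Rightarrow> 'a" where f: "F = f ` {i. i < n}"
    using finite_imp_nat_seg_image_inj_on[OF F(1)] by blast
  \<comment> \<open>Nothing has to be inverted for positive exponents, so \<open>g\<close> is
    1.\<close>
  interpret P: seminormed_presentation R sc s \<rho> f n "\<one>"
  proof
    show "mult_seminorm R s" "s (sc c) = cmod c powr \<rho>" for c by (rule s)+
    show "f i \<in> carrier R" if "i < n" for i using that F(2) f by auto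
    show "generate_ring R (range sc \<union> f ` {..<n}) = carrier R"
      using gen f by (simp add: lessThan_def)
    show "s \<one> \<noteq> 0" using s(1) by (simp add: mult_seminorm_def)
  qed simp
  obtain \<phi> where \<phi>: "cpoly.character \<phi>" "\<And>p. P.S p = cmod (\<phi> p) powr \<rho>"
    using cpoly.mult_over_character[OF P.mult_over_S \<rho>(1)] by blast
  have ker: "\<phi> p = 0" if "P.S p = 0" for p using \<phi>(2)[of p] that by simp
  obtain \<psi> where \<psi>: "\<And>a b. a \<in> carrier R \<Longrightarrow> b \<in> carrier R \<Longrightarrow> \<psi> (a \<oplus> b) = \<psi> a + \<psi> b"
    "\<And>a b. a \<in> carrier R \<Longrightarrow> b \<in> carrier R \<Longrightarrow> \<psi> (a \<otimes> b) = \<psi> a * \<psi> b"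
    "\<And>c. \<psi> (sc c) = c" "\<And>p. p \<in> P.small \<Longrightarrow> \<psi> (P.pres 0 p) = \<phi> p"
    using P.descend_character[OF \<phi>(1) ker] by metis
  have s\<psi>: "s a = cmod (\<psi> a) powr \<rho>" if a: "a \<in> carrier R" for a
  proof -
    obtain p where "p \<in> P.small" "P.pres 0 p = a" using P.pres_small_surj[OF a] by blast
    then show ?thesis using P.S_eq[OF P.ydeg_small, of p 0] \<phi>(2)[of p] \<psi>(4)[of p] by simp
  qed
  have "\<forall>\<^sub>F r in nhds \<rho>. \<bar>cmod (\<psi> a) powr r - s a\<bar> < \<epsilon>" if "a \<in> A" for a
  proof -
    have "((\<lambda>r. cmod (\<psi> a) powr r) \<longlongrightarrow> cmod (\<psi> a) powr \<rho>) (nhds \<rho>)"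
      by (cases "\<psi> a = 0") (auto intro!: tendsto_intros filterlim_ident)
    then have "\<forall>\<^sub>F r in nhds \<rho>. dist (cmod (\<psi> a) powr r) (cmod (\<psi> a) powr \<rho>) < \<epsilon>"
      using \<open>0 < \<epsilon>\<close> by (rule tendstoD)
    then show ?thesis using s\<psi>[of a] A(2) that by (auto simp: dist_real_def)
  qed
  then have "\<forall>\<^sub>F r in nhds \<rho>. \<forall>a\<in>A. \<bar>cmod (\<psi> a) powr r - s a\<bar> < \<epsilon>"
    using A(1) by (simp add: eventually_ball_finite_distrib)
  then obtain d where d: "0 < d" "\<And>r. \<bar>r - \<rho>\<bar> < d \<Longrightarrow> \<forall>a\<in>A. \<bar>cmod (\<psi> a) powr r - s a\<bar> < \<epsilon>"
    by (auto simp: eventually_nhds_metric dist_real_def)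
  show ?thesis
  \<comment> \<open>The bound \<open>\<rho>\<close> keeps \<open>r\<close> positive.\<close>
  proof (intro exI[of _ "min d \<rho>"] conjI ballI impI)
    fix r :: real assume r: "r \<in> {0..1}" "\<bar>r - \<rho>\<bar> < min d \<rho>"
    then have "0 < r" by auto
    then have "mult_seminorm R (\<lambda>a\<in>carrier R. cmod (\<psi> a) powr r)"
      using r \<psi> by (intro character_powr_seminorm) auto
    then show "\<exists>s'. mult_seminorm R s' \<and> (\<forall>c. s' (sc c) = cmod c powr r) \<and> (\<forall>a\<in>A. \<bar>s' a - s a\<bar> < \<epsilon>)"
      using d(2)[of r] r A(2) \<psi>(3) by (intro exI[of _ "\<lambda>a\<in>carrier R. cmod (\<psi> a) powr r"]) auto
  qed (use d \<rho> in auto)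
qed

lemma seminorm_deformation_trivial:
  assumes gen: "generate_ring R (range sc \<union> F) = carrier R" and F: "finite F" "F \<subseteq> carrier R"
    and s: "mult_seminorm R s" "\<And>c. s (sc c) = cmod c powr 0"
    and A: "finite A" "A \<subseteq> carrier R" and "0 < \<epsilon>"
  shows "\<exists>d>0. \<forall>r\<in>{0..1}. \<bar>r\<bar> < d \<longrightarrow> (\<exists>s'. mult_seminorm R s' \<and>
    (\<forall>c. s' (sc c) = cmod c powr r) \<and> (\<forall>a\<in>A. \<bar>s' a - s a\<bar> < \<epsilon>))"
proof -
  \<comment> \<open>The elements to be controlled join the generators, so each of them is the image
    of a variable.\<close>
  obtain n and f :: "nat \<Rightarrow> 'a" where fFA: "F \<union> A = f ` {i. i < n}"
    using finite_imp_nat_seg_image_inj_on[of "F \<union> A"] F(1) A(1) by blast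
  have f: "f i \<in> carrier R" if "i < n" for i using that F(2) A(2) fFA by blast
  have s0: "0 \<le> s a" if "a \<in> carrier R" for a using s(1) that by (simp add: mult_seminorm_def)
  define J where "J = {i. i < n \<and> s (f i) \<noteq> 0}"
  have J: "finite J" "J \<subseteq> {..<n}" by (auto simp: J_def)
  have sJ: "0 < s (f i)" if "i \<in> J" for i using that s0[OF f, of i] by (auto simp: J_def)
  \<comment> \<open>The exponent vector of the product of the \<open>f i\<close> with
    \<open>i \<in> J\<close>, which becomes \<open>g\<close>.\<close>
  define e :: mono where "e = (\<Sum>i\<in>J. Poly_Mapping.single i 1)"
  have e: "Poly_Mapping.lookup e i = (if i \<in> J then 1 else 0)" for i
    using J(1) by (auto simp: e_def lookup_sum lookup_single when_def)
  define g where "g = monomial f n e"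
  have g: "g \<in> carrier R" unfolding g_def by (rule monomial_closed[of n f n]) (use f in auto)
  have prod_e: "h g = (\<Prod>i\<in>J. h (f i))"
    if "h \<one> = 1" "\<And>a b. a \<in> carrier R \<Longrightarrow> b \<in> carrier R \<Longrightarrow> h (a \<otimes> b) = h a * h b"
    for h :: "'a \<Rightarrow> real"
  proof -
    have "h g = (\<Prod>i<n. h (f i) ^ Poly_Mapping.lookup e i)"
      unfolding g_def by (rule monomial_hom[of n f h n]) (use f that in auto)
    also have "\<dots> = (\<Prod>i\<in>J. h (f i))"
      using J by (intro prod.mono_neutral_cong_right) (auto simp: e)
    finally show ?thesis .
  qed
  have sg: "s g = (\<Prod>i\<in>J. s (f i))"
    using s(1) by (intro prod_e) (auto simp: mult_seminorm_def)
  then have sg_pos: "0 < s g" using sJ by (simp add: prod_pos)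
  interpret P: seminormed_presentation R sc s 0 f n g
  proof
    show "mult_seminorm R s" "s (sc c) = cmod c powr 0" for c by (rule s)+
    have "carrier R \<subseteq> generate_ring R (range sc \<union> f ` {..<n})"
    proof -
      have fn: "f ` {..<n} = F \<union> A" using fFA by (auto simp: lessThan_def)
      have "generate_ring R (range sc \<union> F) \<subseteq> generate_ring R (range sc \<union> f ` {..<n})"
        unfolding fn
        by (rule generate_ring_min_subring1[OF _ generate_ring_is_subring])
          (use F(2) A(2) in \<open>auto intro: generate_ring.incl\<close>)
      then show ?thesis using gen by simp
    qed
    moreover have "generate_ring R (range sc \<union> f ` {..<n}) \<subseteq> carrier R"
      using f by (intro generate_ring_incl) auto
    ultimately show "generate_ring R (range sc \<union> f ` {..<n}) = carrier R" by blast
  qed (use f g sg_pos in auto)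
  \<comment> \<open>The upper bound loses one factor \<open>exp \<eta>\<close>. The lower bound
    loses one for the inverse of \<open>g\<close> and one for each of the fewer than
    \<open>n\<close> other factors of \<open>g\<close>, estimated by \<open>n + 1\<close> in
    all.\<close>
  have "\<forall>\<^sub>F \<eta> in at_right 0. \<forall>i<n. s (f i) * exp \<eta> - s (f i) < \<epsilon> \<and>
      s (f i) - s (f i) * exp (- (real n + 1) * \<eta>) < \<epsilon>"
  proof -
    have "\<forall>\<^sub>F \<eta> in at_right 0. s (f i) * exp \<eta> - s (f i) < \<epsilon> \<and>
      s (f i) - s (f i) * exp (- (real n + 1) * \<eta>) < \<epsilon>" for i
    proof (intro eventually_conj)
      have "((\<lambda>\<eta>. s (f i) * exp \<eta> - s (f i)) \<longlongrightarrow> s (f i) * exp 0 - s (f i)) (at_right 0)"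
        by (intro tendsto_intros)
      then show "\<forall>\<^sub>F \<eta> in at_right 0. s (f i) * exp \<eta> - s (f i) < \<epsilon>"
        using \<open>0 < \<epsilon>\<close> by (intro order_tendstoD) auto
      have "((\<lambda>\<eta>. s (f i) - s (f i) * exp (- (real n + 1) * \<eta>)) \<longlongrightarrow>
          s (f i) - s (f i) * exp (- (real n + 1) * 0)) (at_right 0)"
        by (intro tendsto_intros)
      then show "\<forall>\<^sub>F \<eta> in at_right 0. s (f i) - s (f i) * exp (- (real n + 1) * \<eta>) < \<epsilon>"
        using \<open>0 < \<epsilon>\<close> by (intro order_tendstoD) auto
    qed
    then have "\<forall>\<^sub>F \<eta> in at_right 0. \<forall>i\<in>{..<n}. s (f i) * exp \<eta> - s (f i) < \<epsilon> \<and>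
      s (f i) - s (f i) * exp (- (real n + 1) * \<eta>) < \<epsilon>"
      by (simp add: eventually_ball_finite_distrib)
    then show ?thesis by (simp add: Ball_def)
  qed
  then have "\<forall>\<^sub>F \<eta> in at_right 0. 0 < \<eta> \<and> (\<forall>i<n. s (f i) * exp \<eta> - s (f i) < \<epsilon> \<and>
      s (f i) - s (f i) * exp (- (real n + 1) * \<eta>) < \<epsilon>)"
    using eventually_at_right_less[of "0::real"] by (rule eventually_conj[rotated])
  then obtain \<eta> where \<eta>: "0 < \<eta>" "\<And>i. i < n \<Longrightarrow> s (f i) * exp \<eta> - s (f i) < \<epsilon>"
    "\<And>i. i < n \<Longrightarrow> s (f i) - s (f i) * exp (- (real n + 1) * \<eta>) < \<epsilon>"
    using eventually_happens'[OF trivial_limit_at_right_real] by blast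
  define v where "v i = (if i < n then s (f i) else inverse (s g))" for i
  \<comment> \<open>Where \<open>s\<close> vanishes, an upper bound \<open>\<epsilon> / 2\<close> on
    the deformed value is all that is required.\<close>
  define w where "w i = (if v i = 0 then ln (\<epsilon> / 2) else ln (v i) + \<eta>)" for i
  have v0: "0 \<le> v i" for i using s0[OF f] sg_pos by (simp add: v_def)
  have exp_w: "exp (w i) = (if v i = 0 then \<epsilon> / 2 else v i * exp \<eta>)" for i
    using \<open>0 < \<epsilon>\<close> v0[of i] by (auto simp: w_def exp_add)
  have "v i < exp (w i)" for i
    using \<open>0 < \<epsilon>\<close> v0[of i] \<eta>(1) by (auto simp: exp_w)
  then obtain R0 where R0: "1 \<le> R0"
    "\<And>R. R0 \<le> R \<Longrightarrow> \<exists>\<phi>. cpoly.character \<phi> \<and> (\<forall>p. P.S p = 0 \<longrightarrow> \<phi> p = 0) \<and>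
      (\<forall>i<Suc n. cmod (\<phi> (xvar i)) \<le> R powr w i)"
    using trivially_valued_character[OF P.mult_over_S, of "Suc n" v w] v0 P.S_monom P.reach_small
    unfolding v_def by blast
  \<comment> \<open>For \<open>0 < r < d\<close> this gives \<open>R0 \<le> exp (1 / r)\<close>; the
    summand 1 keeps the denominator positive if \<open>R0 = 1\<close>.\<close>
  define d where "d = 1 / (ln R0 + 1)"
  have "0 < d" using R0(1) by (simp add: d_def add_nonneg_pos)
  have main: "\<exists>s'. mult_seminorm R s' \<and> (\<forall>c. s' (sc c) = cmod c powr r) \<and> (\<forall>a\<in>A. \<bar>s' a - s a\<bar> < \<epsilon>)"
    if r: "0 < r" "r \<le> 1" "r < d" for r
  proof -
    have "ln R0 + 1 < 1 / r" using r \<open>0 < d\<close> R0(1) by (simp add: d_def field_simps add_nonneg_pos)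
    then have "R0 \<le> exp (1 / r)" using R0(1) by (simp add: ln_le_cancel_iff[symmetric] del: ln_le_cancel_iff)
    from R0(2)[OF this] obtain \<phi> where \<phi>: "cpoly.character \<phi>" "\<And>p. P.S p = 0 \<Longrightarrow> \<phi> p = 0"
      "\<And>i. i < Suc n \<Longrightarrow> cmod (\<phi> (xvar i)) \<le> exp (1 / r) powr w i" by blast
    have \<phi>_le: "cmod (\<phi> (xvar i)) powr r \<le> exp (w i)" if "i < Suc n" for i
    proof -
      have "cmod (\<phi> (xvar i)) powr r \<le> (exp (1 / r) powr w i) powr r"
        using \<phi>(3)[OF that] r by (intro powr_mono2) auto
      also have "\<dots> = exp (w i)" using r by (simp add: powr_def)
      finally show ?thesis .
    qed
    obtain \<psi> where \<psi>: "\<And>a b. a \<in> carrier R \<Longrightarrow> b \<in> carrier R \<Longrightarrow> \<psi> (a \<oplus> b) = \<psi> a + \<psi> b"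
      "\<And>a b. a \<in> carrier R \<Longrightarrow> b \<in> carrier R \<Longrightarrow> \<psi> (a \<otimes> b) = \<psi> a * \<psi> b"
      "\<And>c. \<psi> (sc c) = c" "\<And>i. i < n \<Longrightarrow> \<psi> (f i) = \<phi> (xvar i)" "\<phi> (xvar n) * \<psi> g = 1"
      using P.descend_character[OF \<phi>(1,2)] by metis
    define t where "t = (\<lambda>a\<in>carrier R. cmod (\<psi> a) powr r)"
    have t: "mult_seminorm R t"
      unfolding t_def using r \<psi> by (intro character_powr_seminorm) auto
    have t_f: "t (f i) \<le> exp (w i)" if "i < n" for i
      using \<phi>_le[of i] \<psi>(4)[OF that] f[OF that] that by (simp add: t_def)
    have t0: "0 \<le> t a" if "a \<in> carrier R" for a using t that by (simp add: mult_seminorm_def)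
    have tg: "t g = (\<Prod>i\<in>J. t (f i))"
      using t by (intro prod_e) (auto simp: mult_seminorm_def)
    have "cmod (\<phi> (xvar n)) * cmod (\<psi> g) = 1" using \<psi>(5) by (metis norm_mult norm_one)
    then have "cmod (\<phi> (xvar n)) powr r * t g = 1"
      using g by (simp add: t_def flip: powr_mult)
    \<comment> \<open>The variable \<open>n\<close> has value \<open>inverse (s g)\<close>, so
      \<open>exp (w n)\<close> is \<open>exp \<eta> / s g\<close>: the upper bound for the inverse
      turns into a lower bound for \<open>g\<close>.\<close>
    then have "1 \<le> exp (w n) * t g"
      using \<phi>_le[of n] t0[OF g] by (metis lessI mult_right_mono)
    then have t_g: "s g * exp (- \<eta>) \<le> t g"
      using sg_pos by (simp add: exp_w v_def exp_minus field_simps)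
    have close: "\<bar>t (f i) - s (f i)\<bar> < \<epsilon>" if i: "i < n" for i
    proof (cases "i \<in> J")
      case False
      then have "s (f i) = 0" using i by (simp add: J_def)
      then show ?thesis using t_f[OF i] t0[OF f[OF i]] i \<open>0 < \<epsilon>\<close> by (simp add: exp_w v_def)
    next
      case True
      have ub: "t (f j) \<le> s (f j) * exp \<eta>" if "j \<in> J" for j
        using t_f[of j] that sJ[OF that] J(2) by (auto simp: exp_w v_def)
      \<comment> \<open>The lower bound for \<open>t (f i)\<close> results from dividing that for
        \<open>t g\<close> by upper bounds for the other factors.\<close>
      define Q where "Q = (\<Prod>j\<in>J - {i}. s (f j))"
      have Q: "0 < Q" unfolding Q_def using sJ by (intro prod_pos) auto
      have "(\<Prod>j\<in>J - {i}. t (f j)) \<le> (\<Prod>j\<in>J - {i}. s (f j) * exp \<eta>)"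
        using ub t0 f J(2) by (intro prod_mono) auto
      also have "\<dots> = Q * exp \<eta> ^ card (J - {i})" by (simp add: Q_def prod.distrib)
      also have "\<dots> \<le> Q * exp \<eta> ^ n"
      proof -
        have "card (J - {i}) \<le> n"
          using card_mono[of "{..<n}" "J - {i}"] J(2) by auto
        then show ?thesis using Q \<eta>(1) by (intro mult_left_mono power_increasing) auto
      qed
      finally have le: "(\<Prod>j\<in>J - {i}. t (f j)) \<le> Q * exp \<eta> ^ n" .
      have "s (f i) * Q * exp (- \<eta>) = s g * exp (- \<eta>)"
        using sg True J(1) by (simp add: Q_def prod.remove)
      also have "\<dots> \<le> t g" by (rule t_g)
      also have "\<dots> = t (f i) * (\<Prod>j\<in>J - {i}. t (f j))" using tg True J(1) by (simp add: prod.remove)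
      also have "\<dots> \<le> t (f i) * (Q * exp \<eta> ^ n)"
        using le t0[OF f[OF i]] by (intro mult_left_mono) auto
      finally have "s (f i) * exp (- \<eta>) \<le> t (f i) * exp \<eta> ^ n"
        using Q by (simp add: mult_ac mult_le_cancel_left_pos)
      then have *: "s (f i) * exp (- \<eta>) * exp (- (real n * \<eta>)) \<le> t (f i) * exp (real n * \<eta>) * exp (- (real n * \<eta>))"
        by (intro mult_right_mono) (auto simp: exp_of_nat_mult)
      have "s (f i) * exp (- (real n + 1) * \<eta>) \<le> t (f i)"
      proof -
        have "exp (- (real n + 1) * \<eta>) = exp (- \<eta>) * exp (- (real n * \<eta>))"
          by (simp add: algebra_simps flip: exp_add)
        moreover have "exp (real n * \<eta>) * exp (- (real n * \<eta>)) = 1" by (simp flip: exp_add)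
        ultimately show ?thesis using * by (simp add: mult.assoc)
      qed
      then show ?thesis using ub[OF True] \<eta>(2,3)[OF i] by linarith
    qed
    have "\<forall>a\<in>A. \<bar>t a - s a\<bar> < \<epsilon>"
    proof
      fix a assume "a \<in> A"
      then obtain i where "i < n" "a = f i" using fFA by blast
      then show "\<bar>t a - s a\<bar> < \<epsilon>" using close by simp
    qed
    moreover have "t (sc c) = cmod c powr r" for c by (simp add: t_def \<psi>(3))
    ultimately show ?thesis using t by blast
  qed
  show ?thesis
  proof (intro exI[of _ d] conjI ballI impI)
    fix r :: real assume "r \<in> {0..1}" "\<bar>r\<bar> < d"
    then show "\<exists>s'. mult_seminorm R s' \<and> (\<forall>c. s' (sc c) = cmod c powr r) \<and> (\<forall>a\<in>A. \<bar>s' a - s a\<bar> < \<epsilon>)"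
    proof (cases "r = 0")
      case True
      show ?thesis
        unfolding True using s(1) \<open>0 < \<epsilon>\<close> by (intro exI[of _ s] conjI allI s(2)) auto
    qed (use main[of r] in auto)
  qed (rule \<open>0 < d\<close>)
qed

theorem seminorm_deformation:
  assumes "generate_ring R (range sc \<union> F) = carrier R" "finite F" "F \<subseteq> carrier R"
    and "mult_seminorm R s" "\<And>c. s (sc c) = cmod c powr \<rho>" "\<rho> \<in> {0..1}"
    and "finite A" "A \<subseteq> carrier R" "0 < \<epsilon>"
  shows "\<exists>d>0. \<forall>r\<in>{0..1}. \<bar>r - \<rho>\<bar> < d \<longrightarrow> (\<exists>s'. mult_seminorm R s' \<and>
    (\<forall>c. s' (sc c) = cmod c powr r) \<and> (\<forall>a\<in>A. \<bar>s' a - s a\<bar> < \<epsilon>))"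
proof (cases "\<rho> = 0")
  case True
  then show ?thesis using seminorm_deformation_trivial[OF assms(1-4) _ assms(7-9)] assms(5) by simp
next
  case False
  then show ?thesis using seminorm_deformation_archimedean[OF assms(1-5) _ _ assms(7-9)] assms(6) by auto
qed

end

section \<open>Seminorms on the complex numbers\<close>

text \<open>\<open>L\<close> is linear on integers. Rounding \<open>real k * x\<close> to an integer
  bounds \<open>real k * (L x - x * L 1)\<close> by 2 for every \<open>k\<close>, so the difference
  vanishes.\<close>

lemma additive_bounded_imp_linear:
  fixes L :: "real \<Rightarrow> real"
  assumes add: "\<And>x y. L (x + y) = L x + L y" and bound: "\<And>x. \<bar>L x\<bar> \<le> \<bar>x\<bar>"
  shows "L x = x * L 1"
proof (rule ccontr)
  assume ne: "L x \<noteq> x * L 1"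
  have L_nat: "L (real k * y) = real k * L y" for k y
    using bound[of 0] by (induction k) (simp_all add: distrib_right add)
  have L_minus: "L (- y) = - L y" for y
    using add[of y "- y"] bound[of 0] by simp
  have L_int: "L (of_int m) = of_int m * L 1" for m
    using L_nat[of _ 1] L_minus by (cases m rule: int_cases2) auto
  obtain k :: nat where k: "2 < real k * \<bar>L x - x * L 1\<bar>"
    using reals_Archimedean3[of "\<bar>L x - x * L 1\<bar>"] ne by auto
  define m where "m = \<lfloor>real k * x\<rfloor>"
  have "real k * L x = L (of_int m) + L (real k * x - of_int m)"
    using L_nat[of k x] add[of "of_int m" "real k * x - of_int m"] by simp
  then have "real k * (L x - x * L 1) = (of_int m - real k * x) * L 1 + L (real k * x - of_int m)"
    by (simp add: L_int algebra_simps)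
  also have "\<bar>\<dots>\<bar> \<le> \<bar>of_int m - real k * x\<bar> * \<bar>L 1\<bar> + \<bar>real k * x - of_int m\<bar>"
    using bound[of "real k * x - of_int m"] by (simp add: abs_mult[symmetric])
  also have "\<dots> \<le> 1 * 1 + 1"
    using bound[of 1] unfolding m_def by (intro add_mono mult_mono) linarith+
  finally show False using k by (simp add: abs_mult)
qed

text \<open>The bounds at \<open>c\<close> and \<open>inverse c\<close> give the value 1 on the unit
  circle, so \<open>t c\<close> depends on \<open>cmod c\<close> only. Its logarithm is additive in
  \<open>ln (cmod c)\<close>, hence linear, with slope
  \<open>\<rho> = ln (t (exp 1))\<close>.\<close>

lemma bounded_by_hybrid_norm:
  fixes t :: "complex \<Rightarrow> real"
  assumes mult: "\<And>c d. t (c * d) = t c * t d" and nonneg: "\<And>c. 0 \<le> t c"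
    and t0: "t 0 = 0" and t1: "t 1 = 1" and le: "\<And>c. t c \<le> hybrid_norm c"
  shows "\<exists>\<rho>\<in>{0..1}. \<forall>c. t c = cmod c powr \<rho>"
proof -
  have inv: "t c * t (inverse c) = 1" if "c \<noteq> 0" for c
    using mult[of c "inverse c"] that t1 by simp
  have unit: "t c = 1" if "cmod c = 1" for c
  proof -
    have c: "c \<noteq> 0" using that by auto
    have "t c \<le> 1" "t (inverse c) \<le> 1"
      using le[of c] le[of "inverse c"] that c by (auto simp: hybrid_norm_def trivial_norm_def norm_inverse)
    then show ?thesis
      using inv[OF c] nonneg[of c] mult_left_mono[of "t (inverse c)" 1 "t c"] by simp
  qed
  define L where "L x = ln (t (of_real (exp x)))" for x
  have pos: "0 < t (of_real (exp x))" for x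
    using inv[of "of_real (exp x)"] nonneg[of "of_real (exp x)"]
    by (metis exp_not_eq_zero less_eq_real_def mult_zero_left of_real_eq_0_iff zero_neq_one)
  have add: "L (x + y) = L x + L y" for x y
    using pos by (simp add: L_def exp_add mult ln_mult_pos)
  have L0: "L 0 = 0" by (simp add: L_def t1)
  have hyb: "t (of_real (exp x)) \<le> exp (max x 0)" for x
    using le[of "of_real (exp x)"]
    by (auto simp: hybrid_norm_def trivial_norm_def max_def split: if_splits)
  have L_le: "L x \<le> max x 0" for x
    using pos[of x] hyb[of x] by (metis L_def exp_gt_zero ln_exp ln_le_cancel_iff)
  have "\<bar>L x\<bar> \<le> \<bar>x\<bar>" for x
    using L_le[of x] L_le[of "- x"] add[of x "- x"] L0 by (simp add: max_def split: if_splits)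
  then have lin: "L x = x * L 1" for x by (rule additive_bounded_imp_linear[OF add])
  have "t c = cmod c powr L 1" for c
  proof (cases "c = 0")
    case False
    define u where "u = c / of_real (cmod c)"
    have "c = of_real (exp (ln (cmod c))) * u" using False by (simp add: u_def)
    moreover have "t u = 1" using False by (intro unit) (simp add: u_def norm_divide)
    ultimately have "t c = t (of_real (exp (ln (cmod c))))" by (metis mult mult.right_neutral)
    also have "\<dots> = exp (L (ln (cmod c)))" unfolding L_def by (rule exp_ln[symmetric]) (rule pos)
    also have "\<dots> = cmod c powr L 1" using False lin[of "ln (cmod c)"] by (simp add: powr_def mult.commute)
    finally show ?thesis .
  qed (simp add: t0)
  moreover have "L 1 \<in> {0..1}" using L_le[of 1] L_le[of "-1"] lin[of "-1"] by simp
  ultimately show ?thesis by blast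
qed

section \<open>The structure homomorphism\<close>

lemma CC_simps [simp]:
  "carrier CC = UNIV" "x \<otimes>\<^bsub>CC\<^esub> y = x * y" "x \<oplus>\<^bsub>CC\<^esub> y = x + y" "\<one>\<^bsub>CC\<^esub> = 1" "\<zero>\<^bsub>CC\<^esub> = 0"
  by (simp_all add: ring_of_type_algebra_def)

lemma cring_CC: "cring CC"
  by (rule cring_from_type_algebra)

lemma CC_minus: "x \<ominus>\<^bsub>CC\<^esub> y = x - y"
proof -
  interpret cring CC by (rule cring_CC)
  have "\<ominus>\<^bsub>CC\<^esub> y = - y" by (rule minus_equality) simp_all
  then show ?thesis by (simp add: a_minus_def)
qed

lemma primeideal_CC:
  assumes "primeideal p CC"
  shows "p = {0}"
proof -
  interpret p: primeideal p CC by (rule assms)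
  have "1 \<notin> p" using p.one_imp_carrier p.I_notcarr by auto
  moreover have "1 \<in> p" if "a \<in> p" "a \<noteq> 0" for a
    using p.I_l_closed[OF that(1), of "inverse a"] that(2) by simp
  moreover have "0 \<in> p"
    using additive_subgroup.zero_closed[OF p.additive_subgroup_axioms] by simp
  ultimately show ?thesis by auto
qed

text \<open>The class of the fraction \<open>a / 1\<close> at the only prime ideal, the zero
  ideal.\<close>

definition CC_frac :: "complex \<Rightarrow> (complex \<times> complex) set" where
  "CC_frac a = {(b, g). g \<noteq> 0 \<and> a * g = b}"

lemma fraction_CC:
  assumes "primeideal p CC" "f \<noteq> 0"
  shows "fraction CC (carrier CC - p) (a * f) f = CC_frac a"
proof -
  have "(\<exists>h. h \<noteq> 0 \<and> h * (a * f * g - b * f) = 0) \<longleftrightarrow> a * g = b" for b g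
  proof -
    have "a * f * g - b * f = (a * g - b) * f" by (simp add: algebra_simps)
    then show ?thesis using assms(2) by (auto intro: exI[of _ 1])
  qed
  then show ?thesis
    unfolding fraction_def primeideal_CC[OF assms(1)]
    by (auto simp: CC_frac_def CC_minus Bex_def)
qed

lemma fraction_at_CC: "primeideal p CC \<Longrightarrow> fraction_at CC p a \<one>\<^bsub>CC\<^esub> = CC_frac a"
  using fraction_CC[of p 1 a] by (simp add: fraction_at_def)

text \<open>Evaluates an operation of the localization, a union over representatives, once its term
  is seen not to depend on them.\<close>

lemma UN_CC_frac:
  assumes "\<And>f. f \<noteq> 0 \<Longrightarrow> F (a * f) f = T"
  shows "(\<Union>(b, f)\<in>CC_frac a. F b f) = T"
proof -
  have "(a * 1, 1) \<in> CC_frac a" by (simp add: CC_frac_def)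
  moreover have "F b f = T" if "(b, f) \<in> CC_frac a" for b f
    using that assms by (auto simp: CC_frac_def)
  ultimately show ?thesis by fastforce
qed

lemma local_at_CC:
  assumes p: "primeideal p CC"
  shows "CC_frac a \<otimes>\<^bsub>local_at CC p\<^esub> CC_frac b = CC_frac (a * b)"
    and "CC_frac a \<oplus>\<^bsub>local_at CC p\<^esub> CC_frac b = CC_frac (a + b)"
    and "\<one>\<^bsub>local_at CC p\<^esub> = CC_frac 1"
    and "CC_frac a \<in> carrier (local_at CC p)"
proof -
  have "fraction CC (carrier CC - p) (a * f * (b * g)) (f * g) = CC_frac (a * b)"
    if "f \<noteq> 0" "g \<noteq> 0" for f g
    using fraction_CC[OF p, of "f * g" "a * b"] that by (simp add: mult_ac)
  then show "CC_frac a \<otimes>\<^bsub>local_at CC p\<^esub> CC_frac b = CC_frac (a * b)"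
    by (simp add: local_at_def localization_def) (intro UN_CC_frac, simp)
  have "fraction CC (carrier CC - p) (a * f * g + b * g * f) (f * g) = CC_frac (a + b)"
    if "f \<noteq> 0" "g \<noteq> 0" for f g
    using fraction_CC[OF p, of "f * g" "a + b"] that by (simp add: algebra_simps)
  then show "CC_frac a \<oplus>\<^bsub>local_at CC p\<^esub> CC_frac b = CC_frac (a + b)"
    by (simp add: local_at_def localization_def) (intro UN_CC_frac, simp)
  have one: "fraction CC (carrier CC - p) c 1 = CC_frac c" for c
    using fraction_CC[OF p, of 1 c] by simp
  show "\<one>\<^bsub>local_at CC p\<^esub> = CC_frac 1"
    using one[of 1] by (simp add: local_at_def localization_def)
  have "1 \<in> carrier CC - p" using primeideal_CC[OF p] by simp
  then show "CC_frac a \<in> carrier (local_at CC p)"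
    using one[of a] by (auto simp: local_at_def localization_def)
qed

lemma points_Spec: "p \<in> points (Spec A) \<Longrightarrow> primeideal p A"
  by (auto simp: Spec_def zariski_def topology_generated_by_topspace)

lemma spec_const_CC: "spec_const CC a = (\<lambda>p\<in>points (Spec CC). CC_frac a)"
  unfolding spec_const_def by (intro restrict_ext fraction_at_CC points_Spec)

text \<open>The first of the three maps that compose to \<open>scalar\<close>; the other two,
  \<open>comap\<close> and \<open>restr\<close>, are homomorphisms by the definitions of morphism
  and presheaf.\<close>

lemma spec_const_hom: "spec_const CC \<in> ring_hom CC (sections (Spec CC) (points (Spec CC)))"
proof (rule ring_hom_memI)
  let ?P = "points (Spec CC)"
  have secs: "sections (Spec CC) = spec_sections CC" by (simp add: Spec_def)
  fix a b :: complex
  have "\<exists>V. openin (zariski CC) V \<and> p \<in> V \<and> V \<subseteq> ?P \<and>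
      (\<exists>c\<in>carrier CC. \<exists>f\<in>carrier CC. \<forall>q\<in>V. f \<notin> q \<and> spec_const CC a q = fraction_at CC q c f)"
    if "p \<in> ?P" for p
  proof (intro exI[of _ ?P] conjI)
    show "openin (zariski CC) ?P" by (simp add: Spec_def)
    have "\<forall>q\<in>?P. \<one>\<^bsub>CC\<^esub> \<notin> q \<and> spec_const CC a q = fraction_at CC q a \<one>\<^bsub>CC\<^esub>"
      by (auto simp: spec_const_def dest!: points_Spec primeideal_CC)
    then show "\<exists>c\<in>carrier CC. \<exists>f\<in>carrier CC. \<forall>q\<in>?P. f \<notin> q \<and> spec_const CC a q = fraction_at CC q c f"
      by (intro bexI[of _ a, OF bexI[of _ "\<one>\<^bsub>CC\<^esub>"]]) simp_all
  qed (use that in auto)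
  moreover have "spec_const CC a \<in> (\<Pi>\<^sub>E p\<in>?P. carrier (local_at CC p))"
    unfolding spec_const_CC using local_at_CC(4)[OF points_Spec] by auto
  ultimately show "spec_const CC a \<in> carrier (sections (Spec CC) ?P)"
    unfolding secs by (simp add: spec_sections_def)
  show "spec_const CC (a \<otimes>\<^bsub>CC\<^esub> b) = spec_const CC a \<otimes>\<^bsub>sections (Spec CC) ?P\<^esub> spec_const CC b"
    and "spec_const CC (a \<oplus>\<^bsub>CC\<^esub> b) = spec_const CC a \<oplus>\<^bsub>sections (Spec CC) ?P\<^esub> spec_const CC b"
    unfolding secs spec_const_CC
    by (auto simp: spec_sections_def local_at_CC[OF points_Spec] intro!: restrict_ext)
  show "spec_const CC \<one>\<^bsub>CC\<^esub> = \<one>\<^bsub>sections (Spec CC) ?P\<^esub>"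
    unfolding secs spec_const_CC
    by (auto simp: spec_sections_def local_at_CC[OF points_Spec] intro!: restrict_ext)
qed

context
  fixes Z :: "('p, 'a) ringed_space" and \<pi> :: "('p, 'a, cpt, csec) mor"
  assumes over: "scheme_over_C Z \<pi>"
begin

lemma presheaf: "presheaf_of_rings Z"
  using over by (auto simp: scheme_over_C_def morphism_def locally_ringed_space_def sheaf_of_rings_def)

lemma restr_hom:
  "opens Z U \<Longrightarrow> opens Z V \<Longrightarrow> V \<subseteq> U \<Longrightarrow> restr Z U V \<in> ring_hom (sections Z U) (sections Z V)"
  using presheaf by (simp add: presheaf_of_rings_def)

lemma global_scalar_hom:
  "(\<lambda>c. comap \<pi> (points (Spec CC)) (spec_const CC c)) \<in> ring_hom CC (sections Z (points Z))"
proof -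
  have \<pi>: "morphism Z (Spec CC) \<pi>" using over by (simp add: scheme_over_C_def)
  then have "preim Z \<pi> (points (Spec CC)) = points Z"
    by (auto simp: morphism_def preim_def dest: continuous_map_image_subset_topspace)
  then have "comap \<pi> (points (Spec CC)) \<in> ring_hom (sections (Spec CC) (points (Spec CC))) (sections Z (points Z))"
    using \<pi> by (metis morphism_def openin_topspace)
  from ring_hom_trans[OF spec_const_hom this] show ?thesis by (simp add: comp_def)
qed

lemma scalar_hom:
  assumes "opens Z U"
  shows "scalar Z \<pi> U \<in> ring_hom CC (sections Z U)"
proof -
  have "restr Z (points Z) U \<in> ring_hom (sections Z (points Z)) (sections Z U)"
    using assms by (intro restr_hom openin_subset openin_topspace)
  from ring_hom_trans[OF global_scalar_hom this] show ?thesis by (simp add: comp_def scalar_def[abs_def])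
qed

lemma record_algebra_sections:
  assumes "opens Z U"
  shows "record_algebra (sections Z U) (scalar Z \<pi> U)"
proof -
  interpret cring "sections Z U" using presheaf assms by (simp add: presheaf_of_rings_def)
  show ?thesis
    by unfold_locales
      (use ring_hom_closed[OF scalar_hom[OF assms]] ring_hom_add[OF scalar_hom[OF assms]]
        ring_hom_mult[OF scalar_hom[OF assms]] ring_hom_one[OF scalar_hom[OF assms]] in auto)
qed

lemma restr_scalar:
  assumes "opens Z U" "opens Z V" "V \<subseteq> U"
  shows "restr Z U V (scalar Z \<pi> U c) = scalar Z \<pi> V c"
proof -
  have "comap \<pi> (points (Spec CC)) (spec_const CC c) \<in> secs Z (points Z)"
    using ring_hom_closed[OF global_scalar_hom] by simp
  then show ?thesis
    using presheaf assms openin_subset[OF assms(1)] unfolding scalar_def presheaf_of_rings_def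
    by (metis openin_topspace)
qed

section \<open>Openness\<close>

lemma An_set_scalar:
  assumes U: "opens Z U" and s: "s \<in> An_set Z \<pi> U"
  shows "\<exists>\<rho>\<in>{0..1}. \<forall>c. s (scalar Z \<pi> U c) = cmod c powr \<rho>"
proof (rule bounded_by_hybrid_norm)
  interpret R: record_algebra "sections Z U" "scalar Z \<pi> U" by (rule record_algebra_sections[OF U])
  have "mult_seminorm (sections Z U) s" using s by (simp add: An_set_def)
  then show "s (scalar Z \<pi> U (c * d)) = s (scalar Z \<pi> U c) * s (scalar Z \<pi> U d)"
    "0 \<le> s (scalar Z \<pi> U c)" "s (scalar Z \<pi> U 0) = 0" "s (scalar Z \<pi> U 1) = 1" for c d
    by (auto simp: mult_seminorm_def R.sc_mult)
  show "s (scalar Z \<pi> U c) \<le> hybrid_norm c" for c using s by (simp add: An_set_def)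
qed

lemma topspace_An_affine:
  assumes "opens Z U"
  shows "topspace (An_affine Z \<pi> U) = An_set Z \<pi> U"
proof -
  interpret R: record_algebra "sections Z U" "scalar Z \<pi> U" by (rule record_algebra_sections[OF assms])
  have "An_set Z \<pi> U = {s \<in> An_set Z \<pi> U. s \<one>\<^bsub>sections Z U\<^esub> \<in> UNIV}" by simp
  then show ?thesis
    unfolding An_affine_def topology_generated_by_topspace using R.one_closed open_UNIV by blast
qed

text \<open>Brings a neighbourhood into the form handled by \<open>seminorm_deformation\<close>:
  finitely many functions and one tolerance.\<close>

lemma An_affine_neighbourhood:
  assumes "openin (An_affine Z \<pi> U) W" "s \<in> W"
  shows "\<exists>A \<epsilon>. finite A \<and> A \<subseteq> secs Z U \<and> 0 < \<epsilon> \<and>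
    (\<forall>s'\<in>An_set Z \<pi> U. (\<forall>f\<in>A. \<bar>s' f - s f\<bar> < \<epsilon>) \<longrightarrow> s' \<in> W)"
proof -
  have "generate_topology_on {{s \<in> An_set Z \<pi> U. s f \<in> V} | f V. f \<in> secs Z U \<and> open V} W"
    using assms(1) unfolding An_affine_def by (rule openin_topology_generated_by)
  then show ?thesis
    using assms(2)
  proof induction
    case (Int G H)
    then have "s \<in> G" "s \<in> H" by auto
    obtain A \<epsilon> where A: "finite A" "A \<subseteq> secs Z U" "0 < \<epsilon>"
      "\<forall>s'\<in>An_set Z \<pi> U. (\<forall>f\<in>A. \<bar>s' f - s f\<bar> < \<epsilon>) \<longrightarrow> s' \<in> G"
      using Int.IH(1)[OF \<open>s \<in> G\<close>] by (elim exE conjE)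
    obtain B \<delta> where B: "finite B" "B \<subseteq> secs Z U" "0 < \<delta>"
      "\<forall>s'\<in>An_set Z \<pi> U. (\<forall>f\<in>B. \<bar>s' f - s f\<bar> < \<delta>) \<longrightarrow> s' \<in> H"
      using Int.IH(2)[OF \<open>s \<in> H\<close>] by (elim exE conjE)
    show ?case by (rule exI[of _ "A \<union> B"], rule exI[of _ "min \<epsilon> \<delta>"]) (use A B in auto)
  next
    case (UN K)
    then obtain G where "G \<in> K" "s \<in> G" by blast
    then show ?case using UN.IH by (meson UnionI)
  next
    case (Basis G)
    then obtain f V where fV: "f \<in> secs Z U" "open V" "G = {s \<in> An_set Z \<pi> U. s f \<in> V}" by auto
    then obtain \<epsilon> where "0 < \<epsilon>" "\<And>y. dist y (s f) < \<epsilon> \<Longrightarrow> y \<in> V"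
      using Basis.prems by (auto simp: open_dist)
    then show ?case using fV by (intro exI[of _ "{f}"] exI[of _ \<epsilon>]) (auto simp: dist_real_def)
  qed simp
qed

lemma An_glue_scalar:
  assumes "An_glue Z \<pi> w z"
  shows "snd w (scalar Z \<pi> (fst w) c) = snd z (scalar Z \<pi> (fst z) c)"
proof -
  have opens: "opens Z (fst w)" "opens Z (fst z)"
    using assms by (auto simp: An_glue_def An_disjoint_def affine_open_def)
  interpret R: record_algebra "sections Z (fst z)" "scalar Z \<pi> (fst z)"
    by (rule record_algebra_sections[OF opens(2)])
  show ?thesis
    using assms restr_scalar[OF opens(2,1)] by (simp add: An_glue_def)
qed

text \<open>Restriction maps respect constants, so gluing leaves the restriction to constants
  unchanged and any representative determines the exponent. Its uniqueness is seen at the constant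
  \<open>exp 1\<close>.\<close>

lemma An_lambda_An_class:
  assumes "\<rho> \<in> {0..1}" "\<And>c. s (scalar Z \<pi> U c) = cmod c powr \<rho>"
  shows "An_lambda Z \<pi> (An_class Z \<pi> (U, s)) = \<rho>"
proof -
  have inv: "snd w (scalar Z \<pi> (fst w) c) = cmod c powr \<rho>" if "equivclp (An_glue Z \<pi>) (U, s) w" for w c
    using that
  proof (induction rule: equivclp_induct)
    case base
    then show ?case using assms(2) by simp
  next
    case (step y z)
    then show ?case using An_glue_scalar[of y z c] An_glue_scalar[of z y c] by auto
  qed
  show ?thesis
    unfolding An_lambda_def
  proof (rule the_equality)
    show "\<rho> \<in> {0..1} \<and> (\<forall>(V, t)\<in>An_class Z \<pi> (U, s). \<forall>c. t (scalar Z \<pi> V c) = cmod c powr \<rho>)"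
      using assms(1) inv by (force simp: An_class_def)
    fix r assume "r \<in> {0..1} \<and> (\<forall>(V, t)\<in>An_class Z \<pi> (U, s). \<forall>c. t (scalar Z \<pi> V c) = cmod c powr r)"
    moreover have "(U, s) \<in> An_class Z \<pi> (U, s)" by (simp add: An_class_def)
    ultimately have "s (scalar Z \<pi> U (of_real (exp 1))) = cmod (of_real (exp 1)) powr r" by blast
    then show "r = \<rho>" by (simp add: assms(2) powr_def)
  qed
qed

end

theorem theoremC:
  fixes Z :: "('p, 'a) ringed_space" and \<pi> :: "('p, 'a, cpt, csec) mor"
  assumes "complex_variety Z \<pi>"
  shows "open_map (An_space Z \<pi>) (top_of_set {0..1}) (An_lambda Z \<pi>)"
  unfolding open_map_def openin_contains_ball
proof (intro allI impI conjI ballI subsetI)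
  have ft: "finite_type_over_C Z \<pi>" using assms by (simp add: complex_variety_def)
  then have over: "scheme_over_C Z \<pi>" by (simp add: finite_type_over_C_def)
  let ?T = "An_disjoint Z \<pi>" and ?c = "An_class Z \<pi>"
  fix G assume G: "openin (An_space Z \<pi>) G"
  have pt: "\<exists>U s \<rho>. affine_open Z U \<and> s \<in> An_set Z \<pi> U \<and> x = ?c (U, s) \<and> \<rho> \<in> {0..1} \<and>
      (\<forall>c. s (scalar Z \<pi> U c) = cmod c powr \<rho>) \<and> An_lambda Z \<pi> x = \<rho>" if x: "x \<in> G" for x
  proof -
    obtain z where z: "z \<in> topspace ?T" "x = ?c z" using G x by (auto simp: openin_An_space)
    then obtain U s where U: "z = (U, s)" "affine_open Z U" "s \<in> topspace (An_affine Z \<pi> U)"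
      by (auto simp: An_disjoint_def)
    then have "opens Z U" by (simp add: affine_open_def)
    then have "s \<in> An_set Z \<pi> U" using U(3) topspace_An_affine[OF over] by blast
    moreover from this obtain \<rho> where "\<rho> \<in> {0..1}" "\<forall>c. s (scalar Z \<pi> U c) = cmod c powr \<rho>"
      using An_set_scalar[OF over \<open>opens Z U\<close>] by blast
    ultimately show ?thesis using U z An_lambda_An_class[OF over, of \<rho> s U] by blast
  qed
  show "y \<in> {0..1}" if "y \<in> An_lambda Z \<pi> ` G" for y using that pt by blast
  fix y assume "y \<in> An_lambda Z \<pi> ` G"
  then obtain x where x: "x \<in> G" "y = An_lambda Z \<pi> x" by blast
  then obtain U s where U: "affine_open Z U" and s: "s \<in> An_set Z \<pi> U" "x = ?c (U, s)" "y \<in> {0..1}"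
    "\<And>c. s (scalar Z \<pi> U c) = cmod c powr y"
    using pt[OF x(1)] by blast
  have opU: "opens Z U" using U by (simp add: affine_open_def)
  interpret R: record_algebra "sections Z U" "scalar Z \<pi> U" by (rule record_algebra_sections[OF over opU])
  note top = topspace_An_affine[OF over opU]
  \<comment> \<open>An open set of the quotient has an open trace on every chart, so it suffices to
    deform within the single chart \<open>U\<close>.\<close>
  define W where "W = {t. (U, t) \<in> topspace ?T \<and> ?c (U, t) \<in> G}"
  have "openin ?T {z \<in> topspace ?T. ?c z \<in> G}" using G by (simp add: openin_An_space)
  then have "openin (An_affine Z \<pi> U) {t. (U, t) \<in> {z \<in> topspace ?T. ?c z \<in> G}}"
    using U unfolding An_disjoint_def openin_sum_topology by blast
  then have W: "openin (An_affine Z \<pi> U) W" by (simp add: W_def)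
  have "s \<in> W" using s(1,2) x(1) U top by (simp add: W_def An_disjoint_def)
  from An_affine_neighbourhood[OF over W this] obtain A \<epsilon> where
    A: "finite A" "A \<subseteq> secs Z U" "0 < \<epsilon>"
      "\<And>t. t \<in> An_set Z \<pi> U \<Longrightarrow> \<forall>f\<in>A. \<bar>t f - s f\<bar> < \<epsilon> \<Longrightarrow> t \<in> W"
    by blast
  obtain F where F: "finite F" "F \<subseteq> secs Z U"
    "generate_ring (sections Z U) (range (scalar Z \<pi> U) \<union> F) = secs Z U"
    using ft U by (auto simp: finite_type_over_C_def)
  have ms: "mult_seminorm (sections Z U) s" using s(1) by (simp add: An_set_def)
  obtain d where d: "0 < d" "\<And>r. r \<in> {0..1} \<Longrightarrow> \<bar>r - y\<bar> < d \<Longrightarrow>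
    \<exists>t. mult_seminorm (sections Z U) t \<and> (\<forall>c. t (scalar Z \<pi> U c) = cmod c powr r) \<and> (\<forall>f\<in>A. \<bar>t f - s f\<bar> < \<epsilon>)"
    using R.seminorm_deformation[OF F(3,1,2) ms s(4,3) A(1-3)] by blast
  have "ball y d \<inter> {0..1} \<subseteq> An_lambda Z \<pi> ` G"
  proof
    fix r assume "r \<in> ball y d \<inter> {0..1}"
    then have r: "r \<in> {0..1}" "\<bar>r - y\<bar> < d" by (auto simp: dist_real_def)
    then obtain t where t: "mult_seminorm (sections Z U) t" "\<And>c. t (scalar Z \<pi> U c) = cmod c powr r"
      "\<forall>f\<in>A. \<bar>t f - s f\<bar> < \<epsilon>"
      using d(2)[OF r] by blast
    \<comment> \<open>This places \<open>t\<close> in \<open>An_set\<close>: for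
      \<open>cmod c \<ge> 1\<close> the Archimedean norm dominates as \<open>r \<le> 1\<close>,
      otherwise the trivial norm does as \<open>r \<ge> 0\<close>.\<close>
    have "cmod c powr r \<le> hybrid_norm c" for c
    proof (cases "1 \<le> cmod c")
      case True
      then have "cmod c powr r \<le> cmod c powr 1" using r by (intro powr_mono) auto
      then show ?thesis using True by (auto simp: hybrid_norm_def powr_one)
    next
      case False
      then have "cmod c powr r \<le> 1" if "c \<noteq> 0" using r that by (intro powr_le1) auto
      then show ?thesis by (auto simp: hybrid_norm_def trivial_norm_def)
    qed
    then have "t \<in> An_set Z \<pi> U" using t by (simp add: An_set_def)
    then have "?c (U, t) \<in> G" using A(4) t(3) by (simp add: W_def)
    then show "r \<in> An_lambda Z \<pi> ` G"
      using An_lambda_An_class[OF over r(1) t(2)] by (metis image_eqI)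
  qed
  then show "\<exists>e>0. ball y e \<inter> {0..1} \<subseteq> An_lambda Z \<pi> ` G" using d(1) by blast
qed

end
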